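(* Let $(X,d)$ be a (nonempty) compact metric space, $\alpha:X\to X$ a continuous map that is a non-contracting local homeomorphism on $X_\alpha$ (i.e. the restriction $\alpha:X_\alpha\to X_\alpha$ is a non-contracting local homeomorphism), $A:C(X)\to C(X)$ an $X_\alpha$-compatible transfer operator for $(X,\alpha)$ with cocycle $\rho$ on $X_\alpha$, and $g\in C(X)$, $g\ge0$. Then for any nonnegative continuous extension of $\rho$ from $X_\alpha$ onto $X$ (again denoted $\rho$) we have $$\ell(g)=P\bigl(\alpha,\ln(g\rho)\bigr),$$ where for nonnegative $a\in C(X)$ $$P(\alpha,\ln a):=\sup_{\mu\in M_\alpha(X)}\Bigl(\int_X\ln a\,d\mu+h_\alpha(\mu)\Bigr).$$
   Context: A transfer operator for $(X,\alpha)$ is a positive linear operator $A:C(X)\to C(X)$ with $A((f\circ\alpha)g)=f\,Ag$ for all $f,g\in C(X)$. For $g\in C(X)$, $g\ge0$, let $Ag$ denote the operator $f\mapsto A(gf)$ on $C(X)$, and let $\ell(g)$ be the logarithm of its spectral radius, with $\ln0=-\infty$. $M_\alpha(X)$ is the set of Borel $\alpha$-invariant probability measures on $X$; $h_\alpha(\mu)$ is the Kolmogorov–Sinai (metric) entropy of $\alpha$ with respect to $\mu$. Integrals of $\ln a$ take values in $[-\infty,\infty)$. A point $x\in X$ is essential if every neighborhood $V$ of $x$ satisfies $\mu(V)>0$ for some $\mu\in M_\alpha(X)$; $X_\alpha$ is the (closed) set of essential points; $\alpha(X_\alpha)=X_\alpha$ and every $\mu\in M_\alpha(X)$ is supported in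 $X_\alpha$. For $x\in X_\alpha$ put $\tilde\alpha^{-1}(x):=\alpha^{-1}(x)\cap X_\alpha$. A local homeomorphism is a map such that every point has an open neighborhood mapped homeomorphically onto an open set; on $X_\alpha$ this makes all the sets $\tilde\alpha^{-1}(x)$ finite with uniformly bounded cardinality. A map $\alpha$ of a metric space into itself is non-contracting if there is $r>0$ such that $d(x,y)\le r$ implies $d(\alpha(x),\alpha(y))\ge d(x,y)$. Compatibility and cocycle: for $x\in X$ let $\nu_x$ be the regular Borel measure (possibly $0$) with $\int f\,d\nu_x=[Af](x)$ for $f\in C(X)$; its support lies in $\alpha^{-1}(x)$. $A$ is $X_\alpha$-compatible if for every $f\in C(X_\alpha)$ the function $x\mapsto\int_{X_\alpha}f\,d\nu_x$ is continuous on $X_\alpha$; then $[A_{X_\alpha}f](x):=\int_{X_\alpha}f\,d\nu_x$ defines a transfer operator on $C(X_\alpha)$. It has the form $[A_{X_\alpha}f](x)=\sum_{y\in\tilde\alpha^{-1}(x)}\rho(y)f(y)$, where $\rho(y)=\nu_{\alpha(y)}(\{y\})\ge0$, $y\in X_\alpha$; $\rho$ is called the cocycle. (When $\alpha$ is a local homeomorphism on $X_\alpha$, $\rho$ is continuous on $X_\alpha$.) *)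

theory Defs
  imports "HOL-Probability.Probability"
begin

section \<open>Invariant measures and essential points\<close>

text \<open>The compact metric space \<open>X\<close> is a type of class \<open>metric_space\<close> with compact \<open>UNIV\<close>, and
  \<open>C(X)\<close> is the type \<open>'a \<Rightarrow>\<^sub>C real\<close>: on a compact space every continuous function is bounded.
  A pointwise formula is turned into an element of \<open>C(X)\<close> by \<^const>\<open>Bcontfun\<close>, which is
  meaningful for every continuous formula by the following fact.\<close>

lemma apply_Bcontfun_compact:
  fixes f :: "'a::metric_space \<Rightarrow> 'b::metric_space"
  assumes "compact (UNIV :: 'a set)" and "continuous_on UNIV f"
  shows "apply_bcontfun (Bcontfun f) = f"
proof -
  have "compact (range f)"
    by (rule compact_continuous_image[OF assms(2,1)])
  then have "f \<in> bcontfun"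
    using assms by (simp add: bcontfun_def compact_imp_bounded)
  then show ?thesis by (rule Bcontfun_inverse)
qed

definition invariant_measures :: "('a::topological_space \<Rightarrow> 'a) \<Rightarrow> 'a measure set" where
  "invariant_measures \<alpha> =
     {\<mu>. prob_space \<mu> \<and> sets \<mu> = sets borel \<and> distr \<mu> borel \<alpha> = \<mu>}"

definition essential_points :: "('a::topological_space \<Rightarrow> 'a) \<Rightarrow> 'a set" where
  "essential_points \<alpha> =
     {x. \<forall>V. open V \<and> x \<in> V \<longrightarrow> (\<exists>\<mu>\<in>invariant_measures \<alpha>. measure \<mu> V > 0)}"

definition local_homeomorphism_on ::
    "'a::topological_space set \<Rightarrow> 'b::topological_space set \<Rightarrow> ('a \<Rightarrow> 'b) \<Rightarrow> bool" where
  "local_homeomorphism_on S T f \<longleftrightarrow>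
     (\<forall>x\<in>S. \<exists>U. openin (top_of_set S) U \<and> x \<in> U \<and> openin (top_of_set T) (f ` U) \<and>
        (\<exists>h. homeomorphism U (f ` U) f h))"

definition non_contracting_on :: "'a::metric_space set \<Rightarrow> ('a \<Rightarrow> 'a) \<Rightarrow> bool" where
  "non_contracting_on S f \<longleftrightarrow>
     (\<exists>r>0. \<forall>x\<in>S. \<forall>y\<in>S. dist x y \<le> r \<longrightarrow> dist (f x) (f y) \<ge> dist x y)"

section \<open>Kolmogorov--Sinai entropy\<close>

definition partition_entropy :: "'a measure \<Rightarrow> 'a set set \<Rightarrow> real" where
  "partition_entropy \<mu> P = (\<Sum>C\<in>P. - (measure \<mu> C * ln (measure \<mu> C)))"

text \<open>The nonempty cells of the common refinement of the preimages of \<open>P\<close> under \<open>T ^^ i\<close>, \<open>i < n\<close>.\<close>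

definition iterated_join :: "'a measure \<Rightarrow> ('a \<Rightarrow> 'a) \<Rightarrow> 'a set set \<Rightarrow> nat \<Rightarrow> 'a set set" where
  "iterated_join \<mu> T P n =
     {{x \<in> space \<mu>. \<forall>i<n. (T ^^ i) x \<in> w i} | w. \<forall>i<n. w i \<in> P} - {{}}"

definition finite_measurable_partitions :: "'a measure \<Rightarrow> 'a set set set" where
  "finite_measurable_partitions \<mu> = {P. finite P \<and> P \<subseteq> sets \<mu> \<and> partition_on (space \<mu>) P}"

text \<open>The limit exists by subadditivity whenever \<open>\<mu>\<close> is a \<open>T\<close>-invariant probability measure.\<close>

definition partition_entropy_rate :: "'a measure \<Rightarrow> ('a \<Rightarrow> 'a) \<Rightarrow> 'a set set \<Rightarrow> real" where
  "partition_entropy_rate \<mu> T P = lim (\<lambda>n. partition_entropy \<mu> (iterated_join \<mu> T P n) / real n)"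

definition KS_entropy :: "'a measure \<Rightarrow> ('a \<Rightarrow> 'a) \<Rightarrow> ereal" where
  "KS_entropy \<mu> T = (SUP P\<in>finite_measurable_partitions \<mu>. ereal (partition_entropy_rate \<mu> T P))"

section \<open>Logarithmic integrals and pressure\<close>

definition ln_ereal :: "real \<Rightarrow> ereal" where
  "ln_ereal x = (if x > 0 then ereal (ln x) else -\<infinity>)"

text \<open>Integral of the positive part minus integral of the negative part (\<^const>\<open>e2ennreal\<close>
  sends negative numbers to \<open>0\<close>). For bounded \<open>a\<close> and finite \<open>\<mu>\<close> the first term is finite.\<close>

definition ln_integral :: "'a measure \<Rightarrow> ('a \<Rightarrow> real) \<Rightarrow> ereal" where
  "ln_integral \<mu> a =
     enn2ereal (\<integral>\<^sup>+x. e2ennreal (ln_ereal (a x)) \<partial>\<mu>) -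
     enn2ereal (\<integral>\<^sup>+x. e2ennreal (- ln_ereal (a x)) \<partial>\<mu>)"

text \<open>\<open>ln_pressure \<alpha> a\<close> is \<open>P(\<alpha>, ln a)\<close>. The sum is of the undefined form \<open>-\<infinity> + \<infinity>\<close> only if
  \<open>\<mu>\<close> has infinite entropy; this does not occur when \<open>\<alpha>\<close> is a non-contracting local
  homeomorphism on its essential points, since the number of preimages is then bounded and the
  inverse branches do not expand.\<close>

definition ln_pressure :: "('a::topological_space \<Rightarrow> 'a) \<Rightarrow> ('a \<Rightarrow> real) \<Rightarrow> ereal" where
  "ln_pressure \<alpha> a = (SUP \<mu>\<in>invariant_measures \<alpha>. ln_integral \<mu> a + KS_entropy \<mu> \<alpha>)"

section \<open>Spectral radius of an operator on a real normed space\<close>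

text \<open>As usual, the spectrum of a real operator is that of its complexification. The
  complexification of \<open>'v\<close> is \<open>'v \<times> 'v\<close>, with \<open>(u, v)\<close> standing for \<open>u + \<i>v\<close>, and
  \<open>complexified_resolvent_map T z\<close> is \<open>u + \<i>v \<mapsto> z(u + \<i>v) - (T u + \<i> T v)\<close>. An inverse
  of this complex linear map is automatically complex linear.\<close>

definition complexified_resolvent_map ::
    "('v::real_normed_vector \<Rightarrow> 'v) \<Rightarrow> complex \<Rightarrow> 'v \<times> 'v \<Rightarrow> 'v \<times> 'v" where
  "complexified_resolvent_map T z = (\<lambda>(u, v).
     (Re z *\<^sub>R u - Im z *\<^sub>R v - T u, Re z *\<^sub>R v + Im z *\<^sub>R u - T v))"

definition operator_spectrum :: "('v::real_normed_vector \<Rightarrow> 'v) \<Rightarrow> complex set" where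
  "operator_spectrum T =
     {z. \<not> (\<exists>S. bounded_linear S \<and> S \<circ> complexified_resolvent_map T z = id \<and>
                complexified_resolvent_map T z \<circ> S = id)}"

definition operator_spectral_radius :: "('v::real_normed_vector \<Rightarrow> 'v) \<Rightarrow> real" where
  "operator_spectral_radius T = Sup (cmod ` operator_spectrum T)"

section \<open>Transfer operators\<close>

definition transfer_operator ::
    "('a::metric_space \<Rightarrow> 'a) \<Rightarrow> (('a \<Rightarrow>\<^sub>C real) \<Rightarrow> ('a \<Rightarrow>\<^sub>C real)) \<Rightarrow> bool" where
  "transfer_operator \<alpha> A \<longleftrightarrow>
     linear A \<and>
     (\<forall>f. (\<forall>x. apply_bcontfun f x \<ge> 0) \<longrightarrow> (\<forall>x. A f x \<ge> 0)) \<and>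
     (\<forall>f g. A (Bcontfun (\<lambda>x. apply_bcontfun f (\<alpha> x) * apply_bcontfun g x)) =
            Bcontfun (\<lambda>x. apply_bcontfun f x * A g x))"

definition weighted_operator ::
    "(('a::metric_space \<Rightarrow>\<^sub>C real) \<Rightarrow> ('a \<Rightarrow>\<^sub>C real)) \<Rightarrow> ('a \<Rightarrow>\<^sub>C real) \<Rightarrow>
      ('a \<Rightarrow>\<^sub>C real) \<Rightarrow> ('a \<Rightarrow>\<^sub>C real)" where
  "weighted_operator A g = (\<lambda>f. A (Bcontfun (\<lambda>x. g x * apply_bcontfun f x)))"

definition spectral_exponent ::
    "(('a::metric_space \<Rightarrow>\<^sub>C real) \<Rightarrow> ('a \<Rightarrow>\<^sub>C real)) \<Rightarrow> ('a \<Rightarrow>\<^sub>C real) \<Rightarrow> ereal" where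
  "spectral_exponent A g = ln_ereal (operator_spectral_radius (weighted_operator A g))"

text \<open>The measure representing \<open>f \<mapsto> A f x\<close>, which exists uniquely by the Riesz theorem for a
  positive linear \<open>A\<close>. Finite Borel measures on a compact metric space are automatically regular.\<close>

definition transfer_measure ::
    "(('a::metric_space \<Rightarrow>\<^sub>C real) \<Rightarrow> ('a \<Rightarrow>\<^sub>C real)) \<Rightarrow> 'a \<Rightarrow> 'a measure" where
  "transfer_measure A x =
     (THE \<nu>. sets \<nu> = sets borel \<and> finite_measure \<nu> \<and>
        (\<forall>f. (\<integral>y. apply_bcontfun f y \<partial>\<nu>) = A f x))"

definition compatible_on ::
    "'a set \<Rightarrow> (('a::metric_space \<Rightarrow>\<^sub>C real) \<Rightarrow> ('a \<Rightarrow>\<^sub>C real)) \<Rightarrow> bool" where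
  "compatible_on K A \<longleftrightarrow>
     (\<forall>f :: 'a \<Rightarrow> real. continuous_on K f \<longrightarrow>
        continuous_on K (\<lambda>x. LINT y:K|transfer_measure A x. f y))"

definition cocycle ::
    "('a::metric_space \<Rightarrow> 'a) \<Rightarrow> (('a \<Rightarrow>\<^sub>C real) \<Rightarrow> ('a \<Rightarrow>\<^sub>C real)) \<Rightarrow> 'a \<Rightarrow> real" where
  "cocycle \<alpha> A y = measure (transfer_measure A (\<alpha> y)) {y}"

end

theory Submission
  imports Defs
begin

text \<open>
  Let \<open>K\<close> be the set of essential points, \<open>w = g \<rho>\<close>, and let \<open>Z\<^sub>n(x)\<close> be the sum over all \<open>y \<in> K\<close> with
  \<open>\<alpha>\<^sup>n(y) = x\<close> of the products of \<open>w\<close> along the orbit of \<open>y\<close>. For the positive operator \<open>B = Ag\<close> the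
  spectral radius is the limit of \<open>\<parallel>B\<^sup>n 1\<parallel>\<^sup>1\<^sup>/\<^sup>n\<close>, and it lies in the spectrum.

  Let \<open>\<psi> \<ge> 0\<close> vanish exactly on \<open>K\<close>. Every invariant measure lives on \<open>K\<close>, so the Birkhoff averages of \<open>\<psi>\<close>
  tend to \<open>0\<close> uniformly, and replacing \<open>g\<close> by \<open>g exp(-t\<psi>)\<close> leaves the spectral radius unchanged for every
  \<open>t\<close>. As \<open>t \<rightarrow> \<infinity>\<close> the functions \<open>B\<^sub>t\<^sup>n 1\<close> decrease to \<open>Z\<^sub>n\<close>, hence by Dini the spectral radius is the
  growth rate of \<open>sup Z\<^sub>n\<close>.

  Upper bound for the pressure: inverse branches do not expand, so an orbit of length \<open>n\<close> in \<open>K\<close> is shadowed by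
  the orbit of an \<open>n\<close>-th preimage of a point of a fixed finite net, and the Gibbs inequality for the weights
  \<open>max w \<epsilon>\<close> bounds entropy plus integral by the growth rate of \<open>Z\<^sub>n\<close>. Lower bound: as in Misiurewicz's proof of
  the variational principle, take the probabilities on the \<open>n\<close>-th preimages of nearly maximal points
  with weights proportional to the products of \<open>w\<close>, average them along orbits and pass to a limit. By the
  non-contraction property a partition into sets of small diameter separates these preimages.
\<close>

section \<open>The Riesz representation theorem on compact metric spaces\<close>

text \<open>The essential points form a forward invariant set K, but fibres of \<alpha> may also
  meet the complement of K, and the measures representing A may put mass there; so the operator
  cannot simply be restricted to K. Damping the weight off K removes this mass in the limit, and it
  costs nothing in growth rate because orbits spend a vanishing proportion of time away from K.
  Three further obstacles shape the argument. The weight may vanish, so logarithms are taken of max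
  w \<epsilon>; the perturbation is controlled at one fixed iterate, where the number of preimages
  is uniformly bounded, and submultiplicativity carries it to all iterates. Partitions in the
  definition of entropy are merely measurable while shadowing only sees distances; closed cores
  inside the cells reconcile the two. Limits of orbit averages are needed for all continuous
  functions at once: they are taken along a filter supplied by Tychonoff's theorem, and the Riesz
  theorem turns the limit functional into a measure. The same theorem yields the measures behind the
  cocycle.\<close>

lemma exists_positive_exactly_on_open:
  fixes U :: "'a::metric_space set"
  assumes "open U"
  obtains \<phi> :: "'a \<Rightarrow> real"
  where "continuous_on UNIV \<phi>" "\<And>x. 0 \<le> \<phi> x" "\<And>x. \<phi> x \<le> 1" "\<And>x. \<phi> x > 0 \<longleftrightarrow> x \<in> U"
proof (cases "U = UNIV")
  case True
  then show ?thesis by (intro that[of "\<lambda>_. 1"]) auto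
next
  case False
  have cl: "closed (-U)" "-U \<noteq> {}" using assms False by auto
  show ?thesis
  proof (rule that[of "\<lambda>x. min 1 (infdist x (-U))"])
    fix x
    show "0 < min 1 (infdist x (-U)) \<longleftrightarrow> x \<in> U"
      using in_closed_iff_infdist_zero[OF cl, of x] infdist_nonneg[of x "-U"]
      by (auto simp: min_def less_le)
  qed (auto intro!: continuous_intros simp: infdist_nonneg)
qed

locale positive_functional =
  fixes L :: "('a::metric_space \<Rightarrow> real) \<Rightarrow> real"
  assumes compact_space: "compact (UNIV :: 'a set)"
    and add: "\<And>f g. continuous_on UNIV f \<Longrightarrow> continuous_on UNIV g \<Longrightarrow> L (\<lambda>x. f x + g x) = L f + L g"
    and scale: "\<And>c f. continuous_on UNIV f \<Longrightarrow> L (\<lambda>x. c * f x) = c * L f"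
    and nonneg: "\<And>f. continuous_on UNIV f \<Longrightarrow> (\<And>x. 0 \<le> f x) \<Longrightarrow> 0 \<le> L f"
begin

lemma diff:
  assumes "continuous_on UNIV f" "continuous_on UNIV g"
  shows "L (\<lambda>x. f x - g x) = L f - L g"
  using add[of f "\<lambda>x. (-1) * g x"] scale[of g "-1"] assms
  by (simp add: continuous_on_minus)

lemma mono:
  assumes "continuous_on UNIV f" "continuous_on UNIV g" "\<And>x. f x \<le> g x"
  shows "L f \<le> L g"
  using nonneg[of "\<lambda>x. g x - f x"] diff[of g f] assms
  by (simp add: continuous_on_diff)

lemma sum:
  assumes "finite I" "\<And>i. i \<in> I \<Longrightarrow> continuous_on UNIV (f i)"
  shows "L (\<lambda>x. \<Sum>i\<in>I. f i x) = (\<Sum>i\<in>I. L (f i))"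
  using assms
proof (induction I rule: finite_induct)
  case empty
  then show ?case using scale[of "\<lambda>_. 0" 0] by simp
next
  case (insert i I)
  then show ?case
    by (simp add: add continuous_on_sum)
qed

text \<open>Test functions vanish off U but need not have compact support in U;
  \<open>cut_off\<close> supplies a compact set when one is required.\<close>

definition test :: "'a set \<Rightarrow> ('a \<Rightarrow> real) \<Rightarrow> bool" where
  "test U f \<longleftrightarrow> continuous_on UNIV f \<and> (\<forall>x. 0 \<le> f x \<and> f x \<le> indicator U x)"

definition content :: "'a set \<Rightarrow> ennreal" where
  "content U = (SUP f\<in>Collect (test U). ennreal (L f))"

definition outer :: "'a set \<Rightarrow> ennreal" where
  "outer E = (INF U\<in>{U. open U \<and> E \<subseteq> U}. content U)"

lemma testI:
  assumes "continuous_on UNIV f" "\<And>x. 0 \<le> f x" "\<And>x. f x \<le> 1" "\<And>x. x \<notin> U \<Longrightarrow> f x = 0"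
  shows "test U f"
  using assms by (auto simp: test_def indicator_def)

lemma testD:
  assumes "test U f"
  shows "continuous_on UNIV f" "0 \<le> f x" "f x \<le> 1" "x \<notin> U \<Longrightarrow> f x = 0"
proof -
  have a: "continuous_on UNIV f" "0 \<le> f x" "f x \<le> indicator U x" using assms by (auto simp: test_def)
  then show "continuous_on UNIV f" "0 \<le> f x" "f x \<le> 1" "x \<notin> U \<Longrightarrow> f x = 0"
    by (cases "x \<in> U"; simp add: indicator_def)+
qed

lemma L1: "0 \<le> L (\<lambda>_. 1)" by (rule nonneg) auto

lemma test_zero: "test U (\<lambda>_. 0)" by (auto simp: test_def)

lemma le_content: "test U f \<Longrightarrow> ennreal (L f) \<le> content U"
  unfolding content_def by (rule SUP_upper) simp

lemma test_mono: "test U f \<Longrightarrow> U \<subseteq> V \<Longrightarrow> test V f"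
  unfolding test_def by (meson indicator_leI order_trans subsetD)

lemma content_mono: "U \<subseteq> V \<Longrightarrow> content U \<le> content V"
  unfolding content_def by (rule SUP_subset_mono) (auto intro: test_mono)

lemma content_UNIV: "content UNIV = ennreal (L (\<lambda>_. 1))"
proof (rule antisym)
  show "content UNIV \<le> ennreal (L (\<lambda>_. 1))"
    unfolding content_def
    by (rule SUP_least) (auto simp: test_def intro!: ennreal_leI mono)
  show "ennreal (L (\<lambda>_. 1)) \<le> content UNIV"
    by (rule le_content) (auto simp: test_def)
qed

lemma content_finite: "content U < top"
  using content_mono[of U UNIV] content_UNIV by (simp add: order_le_less_trans)

lemma outer_open: "open U \<Longrightarrow> outer U = content U"
  unfolding outer_def
  by (rule antisym) (auto intro!: INF_lower INF_greatest content_mono)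

lemma outer_mono: "E \<subseteq> F \<Longrightarrow> outer E \<le> outer F"
  unfolding outer_def by (rule INF_superset_mono) auto

text \<open>Lowering f by e costs at most e times the mass of the constant 1, and the lowered
  function lives on the closed set where f is at least e. On a compact space this replaces compact
  support.\<close>

lemma cut_off:
  assumes "test U f" "e > 0"
  shows "test U (\<lambda>x. max (f x - e) 0)" "L f \<le> L (\<lambda>x. max (f x - e) 0) + e * L (\<lambda>_. 1)"
    "closed {x. f x \<ge> e}" "{x. f x \<ge> e} \<subseteq> U"
proof -
  have c: "continuous_on UNIV f" using assms by (auto simp: test_def)
  then have c': "continuous_on UNIV (\<lambda>x. max (f x - e) 0)" by (intro continuous_intros)
  show "test U (\<lambda>x. max (f x - e) 0)"
    using testD[OF assms(1)] assms(2) c'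
  proof (intro testI)
    show "max (f x - e) 0 \<le> 1" for x using testD(3)[OF assms(1), of x] assms(2) by simp
  qed (auto simp: max_def)
  have "L f \<le> L (\<lambda>x. max (f x - e) 0 + e * 1)"
    using c c' by (intro mono continuous_intros) auto
  also have "\<dots> = L (\<lambda>x. max (f x - e) 0) + e * L (\<lambda>_. 1)"
    using add[OF c', of "\<lambda>_. e * 1"] scale[of "\<lambda>_. 1" e] by simp
  finally show "L f \<le> L (\<lambda>x. max (f x - e) 0) + e * L (\<lambda>_. 1)" .
  show "closed {x. f x \<ge> e}" using c by (intro closed_Collect_le continuous_intros)
  show "{x. f x \<ge> e} \<subseteq> U"
    using testD(4)[OF assms(1)] assms(2) by force
qed

lemma content_le_add:
  assumes "0 < e"
  obtains f where "test U f" "content U \<le> ennreal (L f) + ennreal e"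
proof -
  have "\<exists>f\<in>Collect (test U). content U < ennreal (L f) + ennreal e"
  proof (rule ccontr)
    assume "\<not> ?thesis"
    then have le: "\<And>f. test U f \<Longrightarrow> ennreal (L f) + ennreal e \<le> content U" by force
    have "content U + ennreal e = (SUP f\<in>Collect (test U). ennreal (L f) + ennreal e)"
      unfolding content_def using test_zero by (subst ennreal_SUP_add_left) auto
    also have "\<dots> \<le> content U" by (rule SUP_least) (use le in auto)
    finally have "content U + ennreal e \<le> content U" .
    moreover obtain c where "content U = ennreal c" "c \<ge> 0"
      using content_finite[of U] by (cases "content U") auto
    ultimately show False using assms by (simp add: ennreal_plus[symmetric] del: ennreal_plus)
  qed
  then show ?thesis using that by force
qed

text \<open>The set where a test function is at least e is compact, so finitely many U i cover it; a
  partition of unity subordinate to them splits the cut-off function into one test function for each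
  U i.\<close>

lemma content_UN_le:
  assumes "\<And>i::nat. open (U i)"
  shows "content (\<Union>i. U i) \<le> (\<Sum>i. content (U i))"
proof -
  have main: "ennreal (L f) \<le> (\<Sum>i. content (U i)) + ennreal (e * L (\<lambda>_. 1))"
    if f: "test (\<Union>i. U i) f" and e: "e > 0" for f e
  proof -
    define C where "C = {x. f x \<ge> e}"
    note cut = cut_off[OF f e, folded C_def]
    have "compact C" using cut(3) compact_space by (metis compact_Int_closed inf_top_left)
    then obtain N :: nat where N: "C \<subseteq> (\<Union>i<N. U i)"
    proof -
      obtain J where J: "finite J" "C \<subseteq> (\<Union>i\<in>J. U i)"
        using compactE_image[OF \<open>compact C\<close>, of UNIV U] assms cut(4) by auto
      then obtain N where "J \<subseteq> {..<N}" using finite_nat_iff_bounded by auto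
      with J show ?thesis by (intro that[of N]) blast
    qed
    have "\<exists>\<phi> :: nat \<Rightarrow> 'a \<Rightarrow> real. \<forall>i. continuous_on UNIV (\<phi> i) \<and> (\<forall>x. 0 \<le> \<phi> i x \<and> \<phi> i x \<le> 1 \<and> (\<phi> i x > 0 \<longleftrightarrow> x \<in> U i))"
    proof (intro choice allI)
      fix i
      obtain \<phi> :: "'a \<Rightarrow> real"
        where "continuous_on UNIV \<phi>" "\<And>x. 0 \<le> \<phi> x" "\<And>x. \<phi> x \<le> 1" "\<And>x. \<phi> x > 0 \<longleftrightarrow> x \<in> U i"
        using exists_positive_exactly_on_open[OF assms[of i]] by blast
      then show "\<exists>y :: 'a \<Rightarrow> real. continuous_on UNIV y \<and> (\<forall>x. 0 \<le> y x \<and> y x \<le> 1 \<and> (y x > 0 \<longleftrightarrow> x \<in> U i))"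
        by (intro exI[of _ \<phi>]) blast
    qed
    then obtain \<phi> :: "nat \<Rightarrow> 'a \<Rightarrow> real" where \<phi>: "\<And>i. continuous_on UNIV (\<phi> i)"
      "\<And>i x. 0 \<le> \<phi> i x" "\<And>i x. \<phi> i x \<le> 1" "\<And>i x. \<phi> i x > 0 \<longleftrightarrow> x \<in> U i" by metis
    define S where "S x = (\<Sum>i<N. \<phi> i x)" for x
    have cS: "continuous_on T S" for T unfolding S_def using \<phi>(1) 
      by (auto intro!: continuous_intros intro: continuous_on_subset)
    have S0: "S x \<ge> 0" for x unfolding S_def by (intro sum_nonneg \<phi>)
    have SC: "S x > 0" if "x \<in> C" for x
    proof -
      obtain i where "i < N" "x \<in> U i" using \<open>x \<in> C\<close> N by blast
      then show ?thesis unfolding S_def using \<phi> by (intro sum_pos2[where i=i]) auto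
    qed
    obtain c where c: "c > 0" "\<And>x. x \<in> C \<Longrightarrow> c \<le> S x"
    proof (cases "C = {}")
      case False
      obtain z where "z \<in> C" "\<forall>y\<in>C. S z \<le> S y"
        using continuous_attains_inf[OF \<open>compact C\<close> False cS] by blast
      then show ?thesis using SC by (intro that[of "S z"]) auto
    qed (use that[of 1] in auto)
    define f' where "f' x = max (f x - e) 0" for x
    have cf': "continuous_on UNIV f'" using cut(1) by (simp add: test_def f'_def[abs_def])
    have f'1: "0 \<le> f' x" "f' x \<le> 1" for x using testD[OF cut(1)] unfolding f'_def by auto
    have f'C: "f' x = 0" if "x \<notin> C" for x using that by (auto simp: f'_def C_def)
    \<comment> \<open>The denominator equals S on C, where S is at least c, and is bounded below
      everywhere. So h i is continuous on the whole space, and off C the factor f' vanishes.\<close>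
    define h where "h i x = f' x * \<phi> i x / max (S x) c" for i x
    have ch: "continuous_on UNIV (h i)" for i
      unfolding h_def using cf' \<phi>(1) cS c by (intro continuous_intros) (auto simp: max_def less_le split: if_splits)
    have sum_h: "(\<Sum>i<N. h i x) = f' x" for x
    proof (cases "x \<in> C")
      case True
      then have "max (S x) c = S x" "S x > 0" using c SC by auto
      then show ?thesis unfolding h_def S_def
        by (simp add: sum_distrib_left[symmetric] sum_divide_distrib[symmetric])
    qed (simp add: h_def f'C)
    have "test (U i) (h i)" if "i < N" for i
      unfolding test_def
    proof (intro conjI allI ch)
      fix x
      show "0 \<le> h i x" unfolding h_def using f'1 \<phi> S0 c by (intro divide_nonneg_nonneg mult_nonneg_nonneg) (auto simp: max_def)
      have "h i x \<le> (\<Sum>i<N. h i x)"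
        by (rule member_le_sum) (use that f'1 \<phi> S0 c in \<open>auto simp: h_def intro!: divide_nonneg_nonneg mult_nonneg_nonneg simp: le_max_iff_disj\<close>)
      then have "h i x \<le> 1" using sum_h f'1 by (metis order_trans)
      moreover have "h i x = 0" if "x \<notin> U i"
        using \<phi>(2,4)[of i x] that by (auto simp: h_def less_le)
      ultimately show "h i x \<le> indicator (U i) x" by (auto simp: indicator_def)
    qed
    then have "ennreal (L (h i)) \<le> content (U i)" if "i < N" for i
      using that le_content by blast
    then have "(\<Sum>i<N. ennreal (L (h i))) \<le> (\<Sum>i<N. content (U i))"
      by (intro sum_mono) auto
    also have "\<dots> \<le> (\<Sum>i. content (U i))" by (intro sum_le_suminf) auto
    finally have 1: "(\<Sum>i<N. ennreal (L (h i))) \<le> (\<Sum>i. content (U i))" .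
    have "L f' = (\<Sum>i<N. L (h i))"
      using sum[of "{..<N}" h] ch by (simp add: sum_h)
    moreover have "L (h i) \<ge> 0" for i
      using ch f'1 \<phi> S0 c by (intro nonneg) (auto simp: h_def intro!: divide_nonneg_nonneg mult_nonneg_nonneg simp: le_max_iff_disj)
    ultimately have "ennreal (L f') \<le> (\<Sum>i. content (U i))"
      using 1 by (simp add: sum_ennreal)
    moreover have "ennreal (L f) \<le> ennreal (L f') + ennreal (e * L (\<lambda>_. 1))"
      using cut(2) e L1 nonneg[OF cf' f'1(1)] unfolding f'_def
      by (subst ennreal_plus[symmetric]) (auto intro!: ennreal_leI simp del: ennreal_plus)
    ultimately show ?thesis by (meson add_right_mono order_trans)
  qed
  show ?thesis
    unfolding content_def[of "\<Union>i. U i"]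
  proof (rule SUP_least)
    fix f assume "f \<in> Collect (test (\<Union>i. U i))"
    then have f: "test (\<Union>i. U i) f" by simp
    show "ennreal (L f) \<le> (\<Sum>i. content (U i))"
    proof (rule ennreal_le_epsilon)
      fix e :: real assume "e > 0"
      define d where "d = e / (1 + L (\<lambda>_. 1))"
      have "d > 0" "d * L (\<lambda>_. 1) \<le> e" using \<open>e > 0\<close> L1 by (auto simp: d_def field_simps)
      then show "ennreal (L f) \<le> (\<Sum>i. content (U i)) + ennreal e"
        using main[OF f \<open>d > 0\<close>] by (meson add_left_mono ennreal_leI order_trans)
    qed
  qed
qed

lemma outer_close:
  assumes "e > 0"
  obtains U where "open U" "E \<subseteq> U" "content U \<le> outer E + ennreal e"
proof -
  have "outer E < top"
    using outer_mono[of E UNIV] outer_open[of UNIV] content_finite[of UNIV] by (simp add: order_le_less_trans)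
  then have "outer E < outer E + ennreal e" using assms
    by (cases "outer E") (auto simp: ennreal_plus[symmetric] ennreal_less_iff simp del: ennreal_plus)
  then show ?thesis unfolding outer_def INF_less_iff using that by (auto simp: outer_def)
qed

lemma outer_measure_space_outer: "outer_measure_space (Pow UNIV) outer"
  unfolding outer_measure_space_def
proof (intro conjI)
  have "content {} \<le> 0"
    unfolding content_def
  proof (rule SUP_least)
    fix f assume "f \<in> Collect (test {})"
    then have "f = (\<lambda>_. 0 * 1)" using testD(4)[of "{}" f] by auto
    then show "ennreal (L f) \<le> 0" using scale[of "\<lambda>_. 1" 0] by simp
  qed
  then have "content {} = 0" by simp
  then show "positive (Pow UNIV) outer"
    by (simp add: positive_def outer_open)
  show "increasing (Pow UNIV) outer"
    by (auto simp: increasing_def intro: outer_mono)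
  show "countably_subadditive (Pow UNIV) outer"
  proof (simp add: countably_subadditive_def, safe)
    fix A :: "nat \<Rightarrow> 'a set"
    show "outer (\<Union>i. A i) \<le> (\<Sum>i. outer (A i))"
    proof (rule ennreal_le_epsilon)
      fix e :: real assume e: "0 < e"
      have "\<exists>U. open U \<and> A n \<subseteq> U \<and> content U \<le> outer (A n) + ennreal (e * (1/2)^Suc n)" for n
        using outer_close[of "e * (1/2)^Suc n" "A n"] e by (metis mult_pos_pos zero_less_power half_gt_zero_iff zero_less_one)
      then obtain U where U: "\<And>n. open (U n)" "\<And>n. A n \<subseteq> U n"
        "\<And>n. content (U n) \<le> outer (A n) + ennreal (e * (1/2)^Suc n)" by metis
      have "outer (\<Union>i. A i) \<le> outer (\<Union>i. U i)" using U by (intro outer_mono) blast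
      also have "\<dots> = content (\<Union>i. U i)" using U by (intro outer_open) auto
      also have "\<dots> \<le> (\<Sum>i. content (U i))" using U by (intro content_UN_le) auto
      also have "\<dots> \<le> (\<Sum>n. outer (A n) + ennreal (e * (1/2)^Suc n))"
        by (intro suminf_le U) auto
      also have "... = (\<Sum>n. outer (A n)) + (\<Sum>n. ennreal e * ennreal ((1/2) ^ Suc n))"
        using \<open>0 < e\<close> by (subst suminf_add[symmetric])
                         (auto simp del: ennreal_suminf_cmult simp add: ennreal_mult[symmetric])
      also have "\<dots> = (\<Sum>n. outer (A n)) + e"
        unfolding ennreal_suminf_cmult
        by (subst suminf_ennreal_eq[OF zero_le_power power_half_series]) auto
      finally show "outer (\<Union>i. A i) \<le> (\<Sum>i. outer (A i)) + ennreal e" .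
    qed
  qed
qed

text \<open>Caratheodory's criterion. A nearly optimal test function for W \<inter> V is cut off,
  and the closed set carrying it is removed from W. A test function on the remaining open set W'
  then lives where the first one vanishes, so their sum is again a test function for W; and W' still
  contains E - V.\<close>

lemma open_in_lambda_system:
  assumes V: "open V"
  shows "V \<in> lambda_system UNIV (Pow UNIV) outer"
proof -
  have ge: "outer (E \<inter> V) + outer (E - V) \<le> outer E" for E
  proof (rule ennreal_le_epsilon)
    fix e' :: real assume e': "0 < e'"
    \<comment> \<open>Error account: one e for the choice of W, one for each of the two nearly
      optimal test functions, and e times the mass of 1 for the cut-off.\<close>
    define e where "e = e' / (3 + L (\<lambda>_. 1))"
    have e: "e > 0" "e * (3 + L (\<lambda>_. 1)) = e'" using e' L1 by (auto simp: e_def)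
    obtain W where W: "open W" "E \<subseteq> W" "content W \<le> outer E + ennreal e"
      using outer_close[OF e(1)] by blast
    obtain f where f: "test (W \<inter> V) f" "content (W \<inter> V) \<le> ennreal (L f) + ennreal e"
      using content_le_add[of e "W \<inter> V"] e by blast
    note cut = cut_off[OF f(1) e(1)]
    define f' where "f' x = max (f x - e) 0" for x
    have tf': "test (W \<inter> V) f'" using cut(1) by (simp add: f'_def[abs_def])
    define W' where "W' = W - {x. f x \<ge> e}"
    have W': "open W'" using W cut(3) by (auto simp: W'_def)
    obtain h where h: "test W' h" "content W' \<le> ennreal (L h) + ennreal e"
      using content_le_add[of e W'] e by blast
    have ch: "continuous_on UNIV h" "continuous_on UNIV f'" using h tf' by (auto simp: test_def)
    have "test W (\<lambda>x. f' x + h x)"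
      unfolding test_def
    proof (intro conjI allI)
      show "continuous_on UNIV (\<lambda>x. f' x + h x)" using ch by (intro continuous_intros)
      fix x
      show "0 \<le> f' x + h x" using h tf' by (auto simp: test_def)
      show "f' x + h x \<le> indicator W x"
      proof (cases "f x \<ge> e")
        case True
        then have "x \<notin> W'" by (auto simp: W'_def)
        then have "h x \<le> 0" using h(1) by (auto simp: test_def dest: spec[of _ x])
        moreover have "f' x \<le> indicator W x" using test_mono[OF tf', of W] by (auto simp: test_def)
        ultimately show ?thesis by auto
      next
        case False
        then have "f' x = 0" by (auto simp: f'_def)
        moreover have "h x \<le> indicator W x" using test_mono[OF h(1), of W] by (auto simp: test_def W'_def)
        ultimately show ?thesis by auto
      qed
    qed
    then have 1: "ennreal (L f' + L h) \<le> content W" using le_content add[OF ch(2,1)] by fastforce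
    have L0: "L f' \<ge> 0" "L h \<ge> 0" using nonneg ch h(1) tf' by (auto simp: test_def)
    have Lf: "L f \<le> L f' + e * L (\<lambda>_. 1)" using cut(2) by (simp add: f'_def[abs_def])
    have "outer (E \<inter> V) \<le> ennreal (L f' + e * L (\<lambda>_. 1) + e)"
    proof -
      have "outer (E \<inter> V) \<le> content (W \<inter> V)"
        using outer_open[of "W \<inter> V"] outer_mono[of "E \<inter> V" "W \<inter> V"] W V by (metis Int_mono open_Int order_refl)
      also have "\<dots> \<le> ennreal (L f) + ennreal e" by (rule f)
      also have "\<dots> \<le> ennreal (L f' + e * L (\<lambda>_. 1)) + ennreal e" using Lf by (intro add_mono ennreal_leI) auto
      finally show ?thesis using L0 L1 e by (simp add: ennreal_plus)
    qed
    moreover have "outer (E - V) \<le> ennreal (L h + e)"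
    proof -
      have "outer (E - V) \<le> content W'"
        using outer_open[of W'] outer_mono[of "E - V" "W'"] W W' cut(4) by (auto simp: W'_def)
      also have "\<dots> \<le> ennreal (L h) + ennreal e" by (rule h)
      finally show ?thesis using L0 e by (simp add: ennreal_plus)
    qed
    ultimately have "outer (E \<inter> V) + outer (E - V) \<le> ennreal (L f' + e * L (\<lambda>_. 1) + e) + ennreal (L h + e)"
      by (rule add_mono)
    also have "\<dots> = ennreal (L f' + L h) + ennreal (e * (2 + L (\<lambda>_. 1)))"
      using L0 L1 e by (simp add: ennreal_plus[symmetric] algebra_simps del: ennreal_plus)
    also have "\<dots> \<le> (outer E + ennreal e) + ennreal (e * (2 + L (\<lambda>_. 1)))"
      using 1 W(3) by (intro add_right_mono) auto
    also have "\<dots> = outer E + ennreal e'"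
      using L1 e by (simp add: ennreal_plus[symmetric] algebra_simps add.assoc del: ennreal_plus)
    finally show "outer (E \<inter> V) + outer (E - V) \<le> outer E + ennreal e'" .
  qed
  have oms: "outer_measure_space (Pow UNIV) outer" by (rule outer_measure_space_outer)
  have "outer E \<le> outer (E \<inter> V) + outer (E - V)" for E
  proof -
    interpret sigma_algebra UNIV "Pow UNIV :: 'a set set" by (rule sigma_algebra_Pow)
    have "subadditive (Pow UNIV) outer"
      using oms countably_subadditive_subadditive by (auto simp: outer_measure_space_def)
    from subadditiveD[OF this, of "E \<inter> V" "E - V"] show ?thesis
      by (simp add: Int_Diff_Un Int_Diff_disjoint)
  qed
  with ge have "outer (E \<inter> V) + outer (E - V) = outer E" for E by (rule antisym)
  then show ?thesis
    using algebra.lambda_system_eq[OF sigma_algebra.axioms(1)[OF sigma_algebra_Pow], of UNIV outer]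
    by auto
qed

definition riesz :: "'a measure" where
  "riesz = measure_of UNIV (sets borel) outer"

lemma sets_riesz [simp]: "sets riesz = sets borel" "space riesz = UNIV"
proof -
  have "sets borel \<subseteq> Pow (UNIV :: 'a set)" by auto
  then show "sets riesz = sets borel" 
    unfolding riesz_def using sets.sigma_sets_eq[of "borel :: 'a measure"] by (simp add: sets_measure_of)
  show "space riesz = UNIV" by (simp add: riesz_def space_measure_of_conv)
qed

lemma emeasure_riesz:
  assumes "E \<in> sets borel"
  shows "emeasure riesz E = outer E"
proof -
  define \<Lambda> where "\<Lambda> = lambda_system UNIV (Pow UNIV) outer"
  interpret sigma_algebra UNIV "Pow UNIV :: 'a set set" by (rule sigma_algebra_Pow)
  have ms: "measure_space UNIV \<Lambda> outer"
    unfolding \<Lambda>_def by (rule caratheodory_lemma[OF outer_measure_space_outer])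
  then have sa: "sigma_algebra UNIV \<Lambda>" by (simp add: measure_space_def)
  have "sets borel \<subseteq> \<Lambda>"
  proof -
    have "{S::'a set. open S} \<subseteq> \<Lambda>" using open_in_lambda_system by (auto simp: \<Lambda>_def)
    then show ?thesis
      using sigma_algebra.sigma_sets_subset[OF sa] by (simp add: borel_def)
  qed
  then have ms': "measure_space UNIV (sets borel) outer"
    using ms measure_space_def sets.sigma_algebra_axioms[of "borel :: 'a measure"]
    unfolding measure_space_def
    by (auto simp: positive_def countably_additive_def)
  show ?thesis
    unfolding riesz_def
    by (rule emeasure_measure_of_sigma)
      (use ms' assms in \<open>auto simp: measure_space_def\<close>)
qed

lemma finite_measure_riesz: "finite_measure riesz"
  by standard (use emeasure_riesz[of UNIV] outer_open[of UNIV] content_finite[of UNIV] in auto)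

lemma measure_riesz_UNIV: "measure riesz UNIV = L (\<lambda>_. 1)"
  unfolding measure_def using emeasure_riesz[of UNIV] outer_open[of UNIV] content_UNIV L1 by simp

lemma L_test_le: "open U \<Longrightarrow> test U f \<Longrightarrow> L f \<le> measure riesz U"
proof -
  assume a: "open U" "test U f"
  have "ennreal (L f) \<le> emeasure riesz U"
    using le_content[OF a(2)] emeasure_riesz[of U] outer_open[OF a(1)] a by auto
  then show ?thesis
    using finite_measure.emeasure_eq_measure[OF finite_measure_riesz, of U] by (simp add: ennreal_le_iff)
qed

lemma integrable_riesz:
  fixes f :: "'a \<Rightarrow> real"
  assumes "continuous_on UNIV f"
  shows "integrable riesz f"
proof -
  interpret finite_measure riesz by (rule finite_measure_riesz)
  have "bounded (range f)"
    using compact_continuous_image[OF assms compact_space] compact_imp_bounded by auto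
  then obtain B where "\<And>x. norm (f x) \<le> B" by (auto simp: bounded_iff)
  then show ?thesis using borel_measurable_continuous_onI[OF assms]
    by (intro integrable_const_bound[of _ B]) (auto simp: measurable_cong_sets[OF sets_riesz(1) refl])
qed

text \<open>Layer cake: f is cut into n slices \<open>h k\<close> of height 1/n. Since n times
  \<open>h k\<close> is a test function for the level set U k, L bounds the slice by the measure of
  U k over n, whereas \<open>h k\<close> equals 1/n on U (k + 1), which bounds its integral from
  below. The two sums differ by an index shift, which costs one term of size
  \<open>?M / n\<close>.\<close>

lemma L_le_integral:
  assumes c: "continuous_on UNIV f" and f: "\<And>x. 0 \<le> f x" "\<And>x. f x \<le> 1"
  shows "L f \<le> integral\<^sup>L riesz f"
proof -
  interpret finite_measure riesz by (rule finite_measure_riesz)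
  let ?M = "measure riesz UNIV"
  have main: "L f \<le> integral\<^sup>L riesz f + ?M / real n" if n: "n > 0" for n
  proof -
    define h where "h k x = min (max (f x - real k / n) 0) (1 / n)" for k x
    have ch: "continuous_on UNIV (h k)" for k unfolding h_def using c n by (intro continuous_intros) auto
    define U where "U k = {x. f x > real k / n}" for k :: nat
    have oU: "open (U k)" for k unfolding U_def using c by (intro open_Collect_less continuous_intros)
    have tail: "(\<Sum>k<m. h k x) = min (f x) (real m / n)" for x m
    proof (induction m)
      case 0 then show ?case using f(1) by simp
    next
      case (Suc m)
      have "real (Suc m) / n = real m / n + 1 / n" using n by (simp add: field_simps)
      moreover have "min (f x) a + min (max (f x - a) 0) d = min (f x) (a + d)" if "d \<ge> 0" for a d :: real
        using that by (auto simp: min_def max_def)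
      ultimately show ?case
        using Suc by (simp add: h_def[of m])
    qed
    have fs: "f x = (\<Sum>k<n. h k x)" for x using tail[of x n] f(2)[of x] n by simp
    have Lh: "L (h k) \<le> measure riesz (U k) / n" for k
    proof -
      have "test (U k) (\<lambda>x. real n * h k x)"
        unfolding test_def
      proof (intro conjI allI continuous_intros ch)
        fix x show "0 \<le> real n * h k x" by (simp add: h_def)
        have "real n * h k x \<le> real n * (1 / real n)" unfolding h_def by (intro mult_left_mono) auto
        moreover have "h k x = 0" if "x \<notin> U k" using that n by (auto simp: h_def U_def)
        ultimately show "real n * h k x \<le> indicator (U k) x" using n by (auto simp: indicator_def)
      qed
      from L_test_le[OF oU this] have "real n * L (h k) \<le> measure riesz (U k)"
        using scale[OF ch, of "real n" k] by simp
      then show ?thesis using n by (simp add: field_simps)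
    qed
    have Uh: "measure riesz (U (Suc k)) / n \<le> integral\<^sup>L riesz (h k)" for k
    proof -
      have "measure riesz (U (Suc k)) / n = (\<integral>x. indicator (U (Suc k)) x * (1 / n) \<partial>riesz)"
        by simp
      also have "\<dots> \<le> integral\<^sup>L riesz (h k)"
      proof (rule integral_mono)
        show "integrable riesz (\<lambda>x. indicator (U (Suc k)) x * (1 / real n))"
          using oU by (intro integrable_mult_left integrable_real_indicator) (auto simp: emeasure_eq_measure)
        show "integrable riesz (h k)" by (rule integrable_riesz[OF ch])
        fix x
        have "real (Suc k) / n = real k / n + 1 / n" using n by (simp add: field_simps)
        then show "indicator (U (Suc k)) x * (1 / real n) \<le> h k x"
          by (auto simp: h_def U_def indicator_def)
      qed
      finally show ?thesis .
    qed
    have "L f = L (\<lambda>x. \<Sum>k<n. h k x)" by (intro arg_cong[of _ _ L] ext fs)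
    also have "\<dots> = (\<Sum>k<n. L (h k))" using sum[of "{..<n}" h] ch by simp
    also have "\<dots> \<le> (\<Sum>k<n. measure riesz (U k) / n)" by (intro sum_mono Lh)
    also have "\<dots> \<le> (\<Sum>k<Suc n. measure riesz (U k) / n)" using n by simp
    also have "\<dots> = measure riesz (U 0) / n + (\<Sum>k<n. measure riesz (U (Suc k)) / n)"
      by (rule sum.lessThan_Suc_shift)
    also have "\<dots> \<le> ?M / n + (\<Sum>k<n. integral\<^sup>L riesz (h k))"
      using n Uh by (intro add_mono sum_mono divide_right_mono finite_measure_mono) auto
    also have "(\<Sum>k<n. integral\<^sup>L riesz (h k)) = (\<integral>x. (\<Sum>k<n. h k x) \<partial>riesz)"
      using integrable_riesz[OF ch] by (subst Bochner_Integration.integral_sum) auto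
    also have "\<dots> = integral\<^sup>L riesz f" using fs by (intro Bochner_Integration.integral_cong) auto
    finally show ?thesis by simp
  qed
  have "(\<lambda>n. integral\<^sup>L riesz f + ?M / real n) \<longlonglongrightarrow> integral\<^sup>L riesz f + 0"
    by (intro tendsto_intros lim_const_over_n)
  then show ?thesis
    using main by (intro LIMSEQ_le_const[of _ "integral\<^sup>L riesz f + 0", simplified]) (auto intro!: exI[of _ 1])
qed

text \<open>The one-sided bound \<open>L_le_integral\<close>, applied to h and to 1 - h, gives
  equality for functions with values in [0,1], because both sides agree on the constant 1. An affine
  change brings every continuous function into this range.\<close>

theorem integral_riesz:
  assumes c: "continuous_on UNIV f"
  shows "integral\<^sup>L riesz f = L f"
proof -
  interpret finite_measure riesz by (rule finite_measure_riesz)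
  have unit: "integral\<^sup>L riesz h = L h" if h: "continuous_on UNIV h" "\<And>x. 0 \<le> h x" "\<And>x. h x \<le> 1" for h
  proof (rule antisym)
    have "L (\<lambda>x. 1 - h x) \<le> integral\<^sup>L riesz (\<lambda>x. 1 - h x)"
      using h by (intro L_le_integral continuous_intros) auto
    then show "integral\<^sup>L riesz h \<le> L h"
      using diff[of "\<lambda>_. 1" h] h(1) measure_riesz_UNIV integrable_riesz[OF h(1)] by simp
  qed (rule L_le_integral[OF h])
  have "bounded (range f)"
    using compact_continuous_image[OF assms compact_space] compact_imp_bounded by auto
  then obtain B where B: "B > 0" "\<And>x. norm (f x) \<le> B" by (auto simp: bounded_pos)
  define h where "h x = (1 / (2 * B)) * (f x + B)" for x
  have ch: "continuous_on UNIV h" unfolding h_def using c by (intro continuous_intros)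
  have "integral\<^sup>L riesz h = L h"
    using B by (intro unit ch) (auto simp: h_def field_simps abs_le_iff minus_le_iff, smt (verit))
  moreover have "integral\<^sup>L riesz h = (1 / (2 * B)) * (integral\<^sup>L riesz f + B * measure riesz UNIV)"
    unfolding h_def using integrable_riesz[OF c] B(1) by (simp add: field_simps)
  moreover have "L h = (1 / (2 * B)) * (L f + B * L (\<lambda>_. 1))"
    using scale[of "\<lambda>x. f x + B * 1" "1 / (2*B)"] add[OF c, of "\<lambda>_. B * 1"] scale[of "\<lambda>_. 1" B] c
    unfolding h_def by (simp add: continuous_on_add)
  ultimately show ?thesis using B measure_riesz_UNIV by simp
qed

end

section \<open>Uniqueness and regularity of finite Borel measures\<close>

lemma bounded_range_of_compact:
  fixes f :: "'a::metric_space \<Rightarrow> real"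
  assumes "compact (UNIV :: 'a set)" "continuous_on UNIV f"
  obtains B where "B > 0" "\<And>x. \<bar>f x\<bar> \<le> B"
proof -
  have "bounded (range f)"
    using compact_continuous_image[OF assms(2,1)] compact_imp_bounded by auto
  then show ?thesis using that by (auto simp: bounded_pos)
qed

lemma closed_indicator_approx:
  fixes F :: "'a::metric_space set"
  assumes "closed F"
  obtains f :: "nat \<Rightarrow> 'a \<Rightarrow> real"
  where "\<And>k. continuous_on UNIV (f k)" "\<And>k x. 0 \<le> f k x" "\<And>k x. f k x \<le> 1"
    "\<And>x. (\<lambda>k. f k x) \<longlonglongrightarrow> indicator F x"
proof -
  obtain \<phi> :: "'a \<Rightarrow> real" where \<phi>: "continuous_on UNIV \<phi>" "\<And>x. 0 \<le> \<phi> x" "\<And>x. \<phi> x \<le> 1" "\<And>x. \<phi> x > 0 \<longleftrightarrow> x \<in> -F"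
    by (rule exists_positive_exactly_on_open[OF open_Compl[OF assms]]) (rule that)
  show ?thesis
  proof (rule that[of "\<lambda>k x. max 0 (1 - real k * \<phi> x)"])
    show "continuous_on UNIV (\<lambda>x. max 0 (1 - real k * \<phi> x))" for k
      using \<phi>(1) by (intro continuous_intros)
    show "(\<lambda>k. max 0 (1 - real k * \<phi> x)) \<longlonglongrightarrow> indicator F x" for x
    proof (cases "x \<in> F")
      case True
      then have "\<phi> x = 0" using \<phi>(2,4)[of x] by (auto simp: less_le)
      then show ?thesis using True by simp
    next
      case False
      then have p: "\<phi> x > 0" using \<phi>(4) by auto
      have "eventually (\<lambda>k. max 0 (1 - real k * \<phi> x) = 0) sequentially"
      proof -
        obtain N :: nat where "1 / \<phi> x < real N" using reals_Archimedean2 by blast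
        then have "max 0 (1 - real k * \<phi> x) = 0" if "k \<ge> N" for k
        proof -
          have "1 / \<phi> x \<le> real k" using \<open>1 / \<phi> x < real N\<close> that by linarith
          then have "1 \<le> real k * \<phi> x" using p by (simp add: field_simps)
          then show ?thesis by simp
        qed
        then show ?thesis by (auto simp: eventually_sequentially)
      qed
      then show ?thesis using False by (simp add: tendsto_eventually)
    qed
  qed (use \<phi>(2) in auto)
qed

lemma finite_borel_measure_eqI:
  fixes M N :: "'a::metric_space measure"
  assumes M: "finite_measure M" "sets M = sets borel" and N: "finite_measure N" "sets N = sets borel"
    and eq: "\<And>f :: 'a \<Rightarrow> real. continuous_on UNIV f \<Longrightarrow> (\<And>x. 0 \<le> f x \<and> f x \<le> 1) \<Longrightarrow>
      integral\<^sup>L M f = integral\<^sup>L N f"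
  shows "M = N"
proof (rule measure_eqI_generator_eq[where E="Collect closed" and \<Omega>=UNIV and A="\<lambda>_. UNIV"])
  interpret M: finite_measure M by fact
  interpret N: finite_measure N by fact
  have sp: "space M = UNIV" "space N = UNIV" using sets_eq_imp_space_eq[OF M(2)] sets_eq_imp_space_eq[OF N(2)] by auto
  show "Int_stable (Collect closed :: 'a set set)" by (auto simp: Int_stable_def)
  show "sets M = sigma_sets UNIV (Collect closed)" "sets N = sigma_sets UNIV (Collect closed)"
    using M N by (simp_all add: borel_eq_closed)
  show "emeasure M UNIV \<noteq> \<infinity>" for i :: nat using M.emeasure_finite[of UNIV] by simp
  fix F :: "'a set" assume "F \<in> Collect closed"
  then have cF: "closed F" by simp
  obtain f :: "nat \<Rightarrow> 'a \<Rightarrow> real" where f: "\<And>k. continuous_on UNIV (f k)" "\<And>k x. 0 \<le> f k x" "\<And>k x. f k x \<le> 1"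
    "\<And>x. (\<lambda>k. f k x) \<longlonglongrightarrow> indicator F x" using closed_indicator_approx[OF cF] by blast
  have lim: "(\<lambda>k. integral\<^sup>L P (f k)) \<longlonglongrightarrow> measure P F"
    if P: "finite_measure P" "sets P = sets borel" for P
  proof -
    interpret P: finite_measure P by fact
    have F: "F \<in> sets P" using cF P by simp
    have "(\<lambda>k. integral\<^sup>L P (f k)) \<longlonglongrightarrow> integral\<^sup>L P (indicator F)"
    proof (rule integral_dominated_convergence[where w="\<lambda>_. 1"])
      show "f k \<in> borel_measurable P" for k
        using borel_measurable_continuous_onI[OF f(1)] by (simp add: measurable_cong_sets[OF P(2) refl])
    qed (use f F in auto)
    then show ?thesis using F by simp
  qed
  have "integral\<^sup>L M (f k) = integral\<^sup>L N (f k)" for k using f by (intro eq) auto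
  then have "measure M F = measure N F"
    using LIMSEQ_unique[OF lim[OF M]] lim[OF N] by simp
  then show "emeasure M F = emeasure N F" by (simp add: M.emeasure_eq_measure N.emeasure_eq_measure)
qed auto

text \<open>Approximating from inside and outside at once is what lets the induction over the
  generated sigma-algebra pass to complements: closed and open sets merely exchange roles.\<close>

lemma borel_closed_open_regular:
  fixes M :: "'a::metric_space measure"
  assumes M: "finite_measure M" "sets M = sets borel" and "E \<in> sets borel"
  shows "\<forall>e>0. \<exists>F U. closed F \<and> open U \<and> F \<subseteq> E \<and> E \<subseteq> U \<and> measure M (U - F) < e"
proof -
  interpret finite_measure M by fact
  have mb: "A \<in> sets M" if "closed A \<or> open A" for A :: "'a set"
    using that borel_open[of A] borel_closed[of A] unfolding M(2) by blast
  have "E \<in> sigma_sets UNIV (Collect closed)" using assms(3) by (simp add: borel_eq_closed)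
  then show ?thesis
  proof (induction E rule: sigma_sets.induct)
    case (Basic F)
    show ?case
    proof (intro allI impI)
      fix e :: real assume e: "e > 0"
      obtain \<phi> :: "'a \<Rightarrow> real" where \<phi>: "continuous_on UNIV \<phi>" "\<And>x. 0 \<le> \<phi> x" "\<And>x. \<phi> x \<le> 1" "\<And>x. \<phi> x > 0 \<longleftrightarrow> x \<in> -F"
        by (rule exists_positive_exactly_on_open[OF open_Compl[of F]]) (use Basic in simp, rule that)
      define U where "U k = {x. \<phi> x < 1 / real (Suc k)}" for k
      have oU: "open (U k)" for k unfolding U_def using \<phi>(1) by (intro open_Collect_less continuous_intros)
      have FU: "F \<subseteq> U k" for k using \<phi>(2,4) by (force simp: U_def less_le)
      have lim: "(\<lambda>k. measure M (U k - F)) \<longlonglongrightarrow> measure M (\<Inter>k. U k - F)"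
      proof (rule finite_Lim_measure_decseq)
        show "range (\<lambda>k. U k - F) \<subseteq> sets M" using oU Basic mb by auto
        show "decseq (\<lambda>k. U k - F)"
        proof (rule decseq_SucI)
          fix k
          have "1 / real (Suc (Suc k)) \<le> 1 / real (Suc k)" by (simp add: frac_le)
          then show "U (Suc k) - F \<subseteq> U k - F" by (auto simp: U_def)
        qed
      qed
      have eq: "(\<Inter>k. U k - F) = {}"
      proof -
        have "\<exists>k. x \<notin> U k" if "x \<notin> F" for x
        proof -
          have "\<phi> x > 0" using that \<phi>(4) by auto
          then obtain k where "inverse (real (Suc k)) < \<phi> x" using reals_Archimedean by blast
          then show ?thesis by (auto simp: U_def inverse_eq_divide intro!: exI[of _ k])
        qed
        then show ?thesis by blast
      qed
      have "(\<lambda>k. measure M (U k - F)) \<longlonglongrightarrow> 0" using lim unfolding eq measure_empty .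
      then obtain k where "measure M (U k - F) < e"
        using eventually_happens'[OF sequentially_bot order_tendstoD(2)[OF _ e]] by blast
      then show "\<exists>F' U. closed F' \<and> open U \<and> F' \<subseteq> F \<and> F \<subseteq> U \<and> measure M (U - F') < e"
        using Basic oU[of k] FU[of k] by blast
    qed
  next
    case Empty
    then show ?case by (auto intro!: exI[of _ "{}"])
  next
    case (Compl E)
    show ?case
    proof (intro allI impI)
      fix e :: real assume "e > 0"
      from Compl.IH[rule_format, OF this] obtain F U
        where FU: "closed F" "open U" "F \<subseteq> E" "E \<subseteq> U" "measure M (U - F) < e"
        by (elim exE conjE)
      then have "closed (-U) \<and> open (-F) \<and> -U \<subseteq> UNIV - E \<and> UNIV - E \<subseteq> -F \<and> measure M (-F - -U) < e"
        by (intro conjI) (auto simp: Diff_eq Int_commute)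
      then show "\<exists>F U. closed F \<and> open U \<and> F \<subseteq> UNIV - E \<and> UNIV - E \<subseteq> U \<and> measure M (U - F) < e"
        by (intro exI)
    qed
  next
    case (Union E)
    show ?case
    proof (intro allI impI)
      fix e :: real assume e: "e > 0"
      have "\<exists>F U. closed F \<and> open U \<and> F \<subseteq> E i \<and> E i \<subseteq> U \<and> measure M (U - F) < (e/2) * (1/2)^Suc i" for i
        by (rule Union.IH[rule_format]) (use e in simp)
      then obtain F U where FU: "\<And>i. closed (F i)" "\<And>i. open (U i)" "\<And>i. F i \<subseteq> E i" "\<And>i. E i \<subseteq> U i"
        "\<And>i. measure M (U i - F i) < (e/2) * (1/2)^Suc i" by metis
      have sU: "measure M ((\<Union>i. U i) - (\<Union>i. F i)) \<le> e/2"
      proof -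
        have ss: "(\<lambda>i. (e/2) * (1/2)^Suc i) sums (e/2 * 1)" by (intro sums_mult power_half_series)
        have sm: "summable (\<lambda>i. measure M (U i - F i))"
          using FU(5) by (intro summable_comparison_test'[OF sums_summable[OF ss]]) (auto simp: less_imp_le)
        have "measure M ((\<Union>i. U i) - (\<Union>i. F i)) \<le> measure M (\<Union>i. U i - F i)"
          using FU mb by (intro finite_measure_mono) auto
        also have "\<dots> \<le> (\<Sum>i. measure M (U i - F i))"
          using FU mb sm by (intro finite_measure_subadditive_countably) auto
        also have "\<dots> \<le> (\<Sum>i. (e/2) * (1/2)^Suc i)"
          using FU(5) sm ss by (intro suminf_le) (auto simp: less_imp_le sums_iff)
        finally show ?thesis using ss by (simp add: sums_iff)
      qed
      \<comment> \<open>The union of all F i need not be closed. It is replaced by a finite union,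
        and continuity from above makes the lost part smaller than the second half of e.\<close>
      have lim: "(\<lambda>n. measure M ((\<Union>i. F i) - (\<Union>i<n. F i))) \<longlonglongrightarrow> measure M (\<Inter>n. (\<Union>i. F i) - (\<Union>i<n. F i))"
      proof (rule finite_Lim_measure_decseq)
        show "range (\<lambda>n. (\<Union>i. F i) - (\<Union>i<n. F i)) \<subseteq> sets M"
          using FU mb by (intro image_subsetI sets.Diff sets.finite_UN sets.countable_UN) auto
        show "decseq (\<lambda>n. (\<Union>i. F i) - (\<Union>i<n. F i))"
          by (intro decseq_SucI) (auto simp: lessThan_Suc)
      qed
      have eq: "(\<Inter>n. (\<Union>i. F i) - (\<Union>i<n. F i)) = {}" by blast
      have "(\<lambda>n. measure M ((\<Union>i. F i) - (\<Union>i<n. F i))) \<longlonglongrightarrow> 0"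
        using lim unfolding eq measure_empty .
      then obtain n where n: "measure M ((\<Union>i. F i) - (\<Union>i<n. F i)) < e/2"
        using eventually_happens'[OF sequentially_bot order_tendstoD(2)[OF _ half_gt_zero[OF e]]] by blast
      have "measure M ((\<Union>i. U i) - (\<Union>i<n. F i)) \<le>
         measure M (((\<Union>i. U i) - (\<Union>i. F i)) \<union> ((\<Union>i. F i) - (\<Union>i<n. F i)))"
        using FU mb by (intro finite_measure_mono sets.Un sets.Diff sets.finite_UN sets.countable_UN) auto
      also have "\<dots> \<le> measure M ((\<Union>i. U i) - (\<Union>i. F i)) + measure M ((\<Union>i. F i) - (\<Union>i<n. F i))"
        using FU mb by (intro measure_Un_le sets.Diff sets.finite_UN sets.countable_UN) auto
      also have "\<dots> < e" using sU n by simp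
      finally have "measure M ((\<Union>i. U i) - (\<Union>i<n. F i)) < e" .
      moreover have "closed (\<Union>i<n. F i)" "open (\<Union>i. U i)" using FU by auto
      moreover have "(\<Union>i<n. F i) \<subseteq> (\<Union>i. E i)" "(\<Union>i. E i) \<subseteq> (\<Union>i. U i)"
        using FU(3,4) by (intro UN_least order_trans[OF FU(3)] order_trans[OF FU(4)] UN_upper UNIV_I)+
      ultimately show "\<exists>F U. closed F \<and> open U \<and> F \<subseteq> (\<Union>i. E i) \<and> (\<Union>i. E i) \<subseteq> U \<and> measure M (U - F) < e"
        by (intro exI conjI)
    qed
  qed
qed

section \<open>Limits of orbit averages and invariant measures\<close>

lemma invariant_measuresD:
  assumes "\<mu> \<in> invariant_measures \<alpha>"
  shows "prob_space \<mu>" "finite_measure \<mu>" "sets \<mu> = sets borel" "space \<mu> = UNIV" "distr \<mu> borel \<alpha> = \<mu>"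
  using assms sets_eq_imp_space_eq[of \<mu> borel] unfolding invariant_measures_def
  by (auto simp: prob_space.finite_measure)

lemma continuous_on_funpow:
  fixes \<alpha> :: "'a::topological_space \<Rightarrow> 'a"
  assumes "continuous_on UNIV \<alpha>"
  shows "continuous_on UNIV (\<alpha> ^^ i)"
proof (induction i)
  case (Suc i)
  then show ?case using continuous_on_compose[OF Suc, of \<alpha>] assms continuous_on_subset by auto
qed simp

lemma continuous_on_compose_funpow:
  fixes \<alpha> :: "'a::topological_space \<Rightarrow> 'a"
  assumes "continuous_on UNIV \<alpha>" "continuous_on UNIV f"
  shows "continuous_on UNIV (\<lambda>x. f ((\<alpha> ^^ i) x))"
  using continuous_on_compose2[OF assms(2) continuous_on_funpow[OF assms(1)]] by auto

text \<open>Tychonoff's theorem for the product of the intervals [-B i, B i]. The index type will be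
  the type of all functions on X, so a diagonal subsequence is replaced by a finer filter along
  which every coordinate converges.\<close>

lemma tendsto_cluster_fun:
  fixes \<Phi> :: "nat \<Rightarrow> 'i \<Rightarrow> real"
  assumes F: "F \<noteq> bot" and b: "\<And>n i. \<bar>\<Phi> n i\<bar> \<le> B i"
  obtains G \<Lambda> where "G \<le> F" "G \<noteq> bot" "\<And>i. ((\<lambda>n. \<Phi> n i) \<longlongrightarrow> \<Lambda> i) G"
proof -
  define C where "C = (\<Pi>\<^sub>E i\<in>UNIV. {- B i..B i})"
  have "compactin (product_topology (\<lambda>_. euclidean) UNIV) C"
    unfolding C_def by (subst compactin_PiE) auto
  then have "compact C"
    by (simp add: euclidean_product_topology)
  moreover have "eventually (\<lambda>x. x \<in> C) (filtermap \<Phi> F)"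
    using b by (auto simp: eventually_filtermap C_def abs_le_iff minus_le_iff intro!: always_eventually)
  moreover have "filtermap \<Phi> F \<noteq> bot" using F by (simp add: filtermap_bot_iff)
  ultimately obtain \<Lambda> where \<Lambda>: "inf (nhds \<Lambda>) (filtermap \<Phi> F) \<noteq> bot"
    unfolding compact_filter by blast
  define G where "G = inf F (filtercomap \<Phi> (nhds \<Lambda>))"
  have "G \<noteq> bot"
  proof
    assume "G = bot"
    then have "eventually (\<lambda>_. False) G" by simp
    then obtain P Q where PQ: "eventually P F" "eventually Q (filtercomap \<Phi> (nhds \<Lambda>))" "\<And>n. P n \<Longrightarrow> Q n \<Longrightarrow> False"
      unfolding G_def eventually_inf by blast
    then obtain R where R: "eventually R (nhds \<Lambda>)" "\<And>n. R (\<Phi> n) \<Longrightarrow> Q n"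
      unfolding eventually_filtercomap by blast
    have "eventually (\<lambda>x. \<not> R x) (filtermap \<Phi> F)"
      unfolding eventually_filtermap using PQ R by (auto elim!: eventually_mono)
    then have "eventually (\<lambda>_. False) (inf (nhds \<Lambda>) (filtermap \<Phi> F))"
      using R(1) unfolding eventually_inf by blast
    then show False using \<Lambda> by (simp add: trivial_limit_def)
  qed
  have "filterlim \<Phi> (nhds \<Lambda>) G"
    unfolding filterlim_def G_def
    by (meson filtermap_filtercomap filtermap_mono inf_le2 order_trans)
  then have "((\<lambda>n. \<Phi> n i) \<longlongrightarrow> \<Lambda> i) G" for i
    using continuous_on_tendsto_compose[OF continuous_on_product_coordinates[of i], of \<Phi> \<Lambda> G] by simp
  with \<open>G \<noteq> bot\<close> show ?thesis by (intro that[of G \<Lambda>]) (auto simp: G_def)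
qed

lemma integrable_pmf_bounded:
  fixes f :: "'a \<Rightarrow> real"
  assumes "\<And>x. \<bar>f x\<bar> \<le> B"
  shows "integrable (measure_pmf p) f"
  using assms by (intro measure_pmf.integrable_const_bound[of _ B]) auto

definition orbit_average :: "('a \<Rightarrow> 'a) \<Rightarrow> (nat \<Rightarrow> 'a pmf) \<Rightarrow> nat \<Rightarrow> ('a \<Rightarrow> real) \<Rightarrow> real" where
  "orbit_average \<alpha> \<eta> n f = (\<Sum>i<n. measure_pmf.expectation (\<eta> n) (\<lambda>y. f ((\<alpha> ^^ i) y))) / real n"

lemma orbit_average_add:
  assumes "\<And>x. \<bar>f x\<bar> \<le> B" "\<And>x. \<bar>g x\<bar> \<le> C"
  shows "orbit_average \<alpha> \<eta> n (\<lambda>x. f x + g x) = orbit_average \<alpha> \<eta> n f + orbit_average \<alpha> \<eta> n g"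
  unfolding orbit_average_def add_divide_distrib[symmetric] sum.distrib[symmetric]
  using assms by (intro arg_cong2[where f="(/)"] sum.cong Bochner_Integration.integral_add integrable_pmf_bounded) auto

lemma orbit_average_scale:
  "orbit_average \<alpha> \<eta> n (\<lambda>x. c * f x) = c * orbit_average \<alpha> \<eta> n f"
  by (simp add: orbit_average_def sum_distrib_left)

lemma orbit_average_mono:
  assumes "\<And>x. \<bar>f x\<bar> \<le> B" "\<And>x. \<bar>g x\<bar> \<le> C" "\<And>x. f x \<le> g x"
  shows "orbit_average \<alpha> \<eta> n f \<le> orbit_average \<alpha> \<eta> n g"
  unfolding orbit_average_def
  using assms by (intro divide_right_mono sum_mono integral_mono integrable_pmf_bounded) auto

lemma orbit_average_const: "n > 0 \<Longrightarrow> orbit_average \<alpha> \<eta> n (\<lambda>_. c) = c"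
  by (simp add: orbit_average_def)

lemma abs_orbit_average_le:
  assumes "\<And>x. \<bar>f x\<bar> \<le> B"
  shows "\<bar>orbit_average \<alpha> \<eta> n f\<bar> \<le> B"
proof (cases "n = 0")
  case True
  then show ?thesis using assms[of undefined] by (simp add: orbit_average_def)
next
  case False
  then have "orbit_average \<alpha> \<eta> n f \<le> orbit_average \<alpha> \<eta> n (\<lambda>_. B)" "orbit_average \<alpha> \<eta> n (\<lambda>_. - B) \<le> orbit_average \<alpha> \<eta> n f"
    using assms abs_ge_zero[of "f undefined"] order_trans[OF abs_ge_zero assms[of undefined]]
    by (intro orbit_average_mono[where B=B and C=B]; simp add: abs_le_iff minus_le_iff; metis minus_le_iff)+
  then show ?thesis using False by (simp add: orbit_average_const)
qed

text \<open>The sums telescope and only the terms at times 0 and n survive; this is the source of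
  invariance in the limit.\<close>

lemma orbit_average_shift:
  assumes "\<And>x. \<bar>f x\<bar> \<le> B"
  shows "\<bar>orbit_average \<alpha> \<eta> n (\<lambda>x. f (\<alpha> x)) - orbit_average \<alpha> \<eta> n f\<bar> \<le> 2 * B / real n"
proof -
  let ?E = "\<lambda>i. measure_pmf.expectation (\<eta> n) (\<lambda>y. f ((\<alpha> ^^ i) y))"
  have b: "\<bar>?E i\<bar> \<le> B" for i
  proof -
    have "\<bar>?E i\<bar> \<le> measure_pmf.expectation (\<eta> n) (\<lambda>y. \<bar>f ((\<alpha> ^^ i) y)\<bar>)" by simp
    also have "\<dots> \<le> measure_pmf.expectation (\<eta> n) (\<lambda>_. B)"
      using assms order_trans[OF abs_ge_zero assms]
      by (intro integral_mono integrable_pmf_bounded[where B=B]) auto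
    finally show ?thesis by simp
  qed
  have "orbit_average \<alpha> \<eta> n (\<lambda>x. f (\<alpha> x)) - orbit_average \<alpha> \<eta> n f = ((\<Sum>i<n. ?E (Suc i)) - (\<Sum>i<n. ?E i)) / real n"
    unfolding orbit_average_def diff_divide_distrib by simp
  also have "(\<Sum>i<n. ?E (Suc i)) - (\<Sum>i<n. ?E i) = ?E n - ?E 0"
    using sum_lessThan_telescope[of ?E n] by (simp add: sum_subtractf)
  finally have "\<bar>orbit_average \<alpha> \<eta> n (\<lambda>x. f (\<alpha> x)) - orbit_average \<alpha> \<eta> n f\<bar> = \<bar>?E n - ?E 0\<bar> / real n" by simp
  also have "\<dots> \<le> 2 * B / real n" using b[of n] b[of 0] by (intro divide_right_mono) auto
  finally show ?thesis .
qed

text \<open>Krylov-Bogolyubov argument. The filter F is a parameter so that the limit can be forced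
  to run through a prescribed infinite set of times.\<close>

lemma orbit_average_invariant_limit:
  fixes \<alpha> :: "'a::metric_space \<Rightarrow> 'a"
  assumes cX: "compact (UNIV :: 'a set)" and ca: "continuous_on UNIV \<alpha>"
    and F: "F \<le> sequentially" "F \<noteq> bot"
  obtains G \<mu> where "G \<le> F" "G \<noteq> bot" "\<mu> \<in> invariant_measures \<alpha>"
    "\<And>f. continuous_on UNIV f \<Longrightarrow> ((\<lambda>n. orbit_average \<alpha> \<eta> n f) \<longlongrightarrow> integral\<^sup>L \<mu> f) G"
proof -
  have ex: "\<exists>B. continuous_on UNIV f \<longrightarrow> (\<forall>x. \<bar>f x\<bar> \<le> B)" for f :: "'a \<Rightarrow> real"
  proof (cases "continuous_on UNIV f")
    case True
    obtain B where "\<And>x. \<bar>f x\<bar> \<le> B"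
      by (rule bounded_range_of_compact[OF cX True]) (rule that)
    then show ?thesis by blast
  qed simp
  define Bd where "Bd f = (SOME B. continuous_on UNIV f \<longrightarrow> (\<forall>x. \<bar>f x\<bar> \<le> B))" for f :: "'a \<Rightarrow> real"
  have Bd: "\<bar>f x\<bar> \<le> Bd f" if "continuous_on UNIV f" for f x
    using mp[OF someI_ex[OF ex[of f], folded Bd_def] that] by (rule spec)
  \<comment> \<open>The value 0 at discontinuous functions provides the bound that the compactness
    argument demands at every index.\<close>
  define \<Phi> where "\<Phi> n f = (if continuous_on UNIV f then orbit_average \<alpha> \<eta> n f else 0)" for n f
  have Phib: "\<bar>\<Phi> n f\<bar> \<le> (if continuous_on UNIV f then Bd f else 0)" for n f
    using abs_orbit_average_le[of f "Bd f"] Bd by (auto simp: \<Phi>_def)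
  obtain G \<Lambda> where G: "G \<le> F" "G \<noteq> bot"
    and lim: "\<And>f. ((\<lambda>n. \<Phi> n f) \<longlongrightarrow> \<Lambda> f) G"
    by (rule tendsto_cluster_fun[where \<Phi>=\<Phi>, OF F(2) Phib]) (rule that)
  have Gs: "G \<le> sequentially" using G F by auto
  have lim': "((\<lambda>n. orbit_average \<alpha> \<eta> n f) \<longlongrightarrow> \<Lambda> f) G" if "continuous_on UNIV f" for f
    using lim[of f] that by (simp add: \<Phi>_def)
  interpret positive_functional \<Lambda>
  proof
    fix f g :: "'a \<Rightarrow> real" assume c: "continuous_on UNIV f" "continuous_on UNIV g"
    have "((\<lambda>n. orbit_average \<alpha> \<eta> n f + orbit_average \<alpha> \<eta> n g) \<longlongrightarrow> \<Lambda> f + \<Lambda> g) G"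
      by (intro tendsto_add lim' c)
    then have "((\<lambda>n. orbit_average \<alpha> \<eta> n (\<lambda>x. f x + g x)) \<longlongrightarrow> \<Lambda> f + \<Lambda> g) G"
      using Bd c by (subst orbit_average_add[of f "Bd f" g "Bd g"]) auto
    moreover have "((\<lambda>n. orbit_average \<alpha> \<eta> n (\<lambda>x. f x + g x)) \<longlongrightarrow> \<Lambda> (\<lambda>x. f x + g x)) G"
      using c by (intro lim' continuous_intros)
    ultimately show "\<Lambda> (\<lambda>x. f x + g x) = \<Lambda> f + \<Lambda> g" using tendsto_unique G(2) by blast
  next
    fix c and f :: "'a \<Rightarrow> real" assume cf: "continuous_on UNIV f"
    have "((\<lambda>n. c * orbit_average \<alpha> \<eta> n f) \<longlongrightarrow> c * \<Lambda> f) G" by (intro tendsto_intros lim' cf)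
    then have "((\<lambda>n. orbit_average \<alpha> \<eta> n (\<lambda>x. c * f x)) \<longlongrightarrow> c * \<Lambda> f) G" by (simp add: orbit_average_scale)
    moreover have "((\<lambda>n. orbit_average \<alpha> \<eta> n (\<lambda>x. c * f x)) \<longlongrightarrow> \<Lambda> (\<lambda>x. c * f x)) G"
      using cf by (intro lim' continuous_intros)
    ultimately show "\<Lambda> (\<lambda>x. c * f x) = c * \<Lambda> f" using tendsto_unique G(2) by blast
  next
    fix f :: "'a \<Rightarrow> real" assume c: "continuous_on UNIV f" and f: "\<And>x. 0 \<le> f x"
    have "orbit_average \<alpha> \<eta> n f \<ge> 0" for n
      unfolding orbit_average_def using f by (intro divide_nonneg_nonneg sum_nonneg integral_nonneg) auto
    then show "0 \<le> \<Lambda> f" using tendsto_lowerbound[OF lim'[OF c] _ G(2), of 0] by simp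
  qed (rule cX)
  define \<mu> where "\<mu> = riesz"
  have int: "integral\<^sup>L \<mu> f = \<Lambda> f" if "continuous_on UNIV f" for f
    unfolding \<mu>_def using that by (rule integral_riesz)
  have fm: "finite_measure \<mu>" unfolding \<mu>_def by (rule finite_measure_riesz)
  have st: "sets \<mu> = sets borel" "space \<mu> = UNIV" by (auto simp: \<mu>_def)
  have one: "\<Lambda> (\<lambda>_. 1) = 1"
  proof -
    have "eventually (\<lambda>n. n > 0) G" using Gs eventually_gt_at_top[of "0::nat"] by (simp add: le_filter_def)
    then have "eventually (\<lambda>n. orbit_average \<alpha> \<eta> n (\<lambda>_. 1) = 1) G"
      by (rule eventually_mono) (simp add: orbit_average_const)
    then have "((\<lambda>n. orbit_average \<alpha> \<eta> n (\<lambda>_. 1)) \<longlongrightarrow> 1) G" by (rule tendsto_eventually)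
    then show ?thesis using tendsto_unique[OF G(2) lim'[of "\<lambda>_. 1"]] by auto
  qed
  have pr: "prob_space \<mu>"
  proof
    have "measure \<mu> (space \<mu>) = 1" using measure_riesz_UNIV one by (simp add: st \<mu>_def)
    then show "emeasure \<mu> (space \<mu>) = 1" using finite_measure.emeasure_eq_measure[OF fm] by simp
  qed
  have ma: "\<alpha> \<in> measurable \<mu> borel" using borel_measurable_continuous_onI[OF ca] st
    by (simp add: measurable_cong_sets[OF st(1) refl])
  have "distr \<mu> borel \<alpha> = \<mu>"
  proof (rule finite_borel_measure_eqI)
    show "finite_measure (distr \<mu> borel \<alpha>)" by (rule finite_measure.finite_measure_distr[OF fm ma])
    fix f :: "'a \<Rightarrow> real" assume c: "continuous_on UNIV f"
    have c': "continuous_on UNIV (\<lambda>x. f (\<alpha> x))" using continuous_on_compose2[OF c ca] by auto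
    have "integral\<^sup>L (distr \<mu> borel \<alpha>) f = (\<integral>x. f (\<alpha> x) \<partial>\<mu>)"
      using ma borel_measurable_continuous_onI[OF c] by (rule integral_distr)
    also have "\<dots> = \<Lambda> (\<lambda>x. f (\<alpha> x))" by (rule int[OF c'])
    also have "\<dots> = \<Lambda> f"
    proof -
      have "((\<lambda>n. 2 * Bd f / real n) \<longlongrightarrow> 0) G"
        using lim_const_over_n[of "2 * Bd f"] Gs by (rule tendsto_mono[rotated])
      then have "((\<lambda>n. orbit_average \<alpha> \<eta> n (\<lambda>x. f (\<alpha> x)) - orbit_average \<alpha> \<eta> n f) \<longlongrightarrow> 0) G"
      proof (rule Lim_null_comparison[rotated])
        show "\<forall>\<^sub>F n in G. norm (orbit_average \<alpha> \<eta> n (\<lambda>x. f (\<alpha> x)) - orbit_average \<alpha> \<eta> n f) \<le> 2 * Bd f / real n"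
          unfolding real_norm_def by (intro always_eventually allI orbit_average_shift Bd c)
      qed
      moreover have "((\<lambda>n. orbit_average \<alpha> \<eta> n (\<lambda>x. f (\<alpha> x)) - orbit_average \<alpha> \<eta> n f) \<longlongrightarrow> \<Lambda> (\<lambda>x. f (\<alpha> x)) - \<Lambda> f) G"
        by (intro tendsto_diff lim' c c')
      ultimately show ?thesis using tendsto_unique[OF G(2)] by fastforce
    qed
    also have "\<dots> = integral\<^sup>L \<mu> f" using int[OF c] by simp
    finally show "integral\<^sup>L (distr \<mu> borel \<alpha>) f = integral\<^sup>L \<mu> f" .
  qed (use fm st in auto)
  then have "\<mu> \<in> invariant_measures \<alpha>" using pr st by (auto simp: invariant_measures_def)
  then show ?thesis using that[OF G, of \<mu>] lim' int by auto
qed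

section \<open>Essential points\<close>

lemma closed_essential_points: "closed (essential_points \<alpha>)"
proof -
  have "open (- essential_points \<alpha>)"
    unfolding open_subopen[of "- essential_points \<alpha>"]
  proof
    fix x assume "x \<in> - essential_points \<alpha>"
    then obtain V where V: "open V" "x \<in> V" "\<forall>\<mu>\<in>invariant_measures \<alpha>. \<not> measure \<mu> V > 0"
      by (auto simp: essential_points_def)
    then have "V \<subseteq> - essential_points \<alpha>" by (auto simp: essential_points_def)
    with V show "\<exists>T. open T \<and> x \<in> T \<and> T \<subseteq> - essential_points \<alpha>" by blast
  qed
  then show ?thesis by (simp add: closed_def)
qed

lemma measure_vimage_invariant:
  assumes "\<mu> \<in> invariant_measures \<alpha>" "continuous_on UNIV \<alpha>" "E \<in> sets borel"
  shows "measure \<mu> (\<alpha> -` E) = measure \<mu> E"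
proof -
  note i = invariant_measuresD[OF assms(1)]
  have "\<alpha> \<in> measurable \<mu> borel" using borel_measurable_continuous_onI[OF assms(2)]
    by (simp add: measurable_cong_sets[OF i(3) refl])
  from measure_distr[OF this assms(3)] show ?thesis using i by simp
qed

lemma essential_points_forward:
  assumes "continuous_on UNIV \<alpha>" "x \<in> essential_points \<alpha>"
  shows "\<alpha> x \<in> essential_points \<alpha>"
  unfolding essential_points_def
proof (intro CollectI allI impI)
  fix V assume V: "open V \<and> \<alpha> x \<in> V"
  then have "open (\<alpha> -` V)" "x \<in> \<alpha> -` V" using assms(1) by (auto simp: open_vimage)
  then obtain \<mu> where "\<mu> \<in> invariant_measures \<alpha>" "measure \<mu> (\<alpha> -` V) > 0"
    using assms(2) unfolding essential_points_def by blast
  then show "\<exists>\<mu>\<in>invariant_measures \<alpha>. measure \<mu> V > 0"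
    using measure_vimage_invariant[OF _ assms(1), of \<mu> V] V by auto
qed

text \<open>The inessential points are covered by null open sets, possibly uncountably many. On each
  compact set where \<phi> \<ge> 1/(n+1) finitely many of them suffice, and countably many such
  compact sets exhaust the complement.\<close>

lemma AE_essential:
  fixes \<alpha> :: "'a::metric_space \<Rightarrow> 'a"
  assumes cX: "compact (UNIV :: 'a set)" and m: "\<mu> \<in> invariant_measures \<alpha>"
  shows "AE x in \<mu>. x \<in> essential_points \<alpha>"
proof -
  let ?K = "essential_points \<alpha>"
  note i = invariant_measuresD[OF m]
  interpret finite_measure \<mu> by (rule i)
  obtain \<phi> :: "'a \<Rightarrow> real" where \<phi>: "continuous_on UNIV \<phi>" "\<And>x. 0 \<le> \<phi> x" "\<And>x. \<phi> x \<le> 1" "\<And>x. \<phi> x > 0 \<longleftrightarrow> x \<in> - ?K"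
    by (rule exists_positive_exactly_on_open[OF open_Compl[OF closed_essential_points[of \<alpha>]]]) (rule that)
  have nul: "{x. \<phi> x \<ge> e} \<in> null_sets \<mu>" if "e > 0" for e
  proof -
    let ?C = "{x. \<phi> x \<ge> e}"
    have clC: "closed ?C" using \<phi>(1) by (intro closed_Collect_le continuous_intros)
    then have "compact ?C" using cX by (metis compact_Int_closed inf_top_left)
    moreover have "?C \<subseteq> \<Union>{V. open V \<and> measure \<mu> V = 0}"
    proof
      fix x assume "x \<in> ?C"
      then have "x \<notin> ?K" using \<phi>(4)[of x] that by auto
      then obtain V where "open V" "x \<in> V" "\<not> measure \<mu> V > 0" using m by (auto simp: essential_points_def)
      then show "x \<in> \<Union>{V. open V \<and> measure \<mu> V = 0}" using measure_nonneg[of \<mu> V] by (auto simp: less_le)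
    qed
    ultimately obtain \<V> where V: "\<V> \<subseteq> {V. open V \<and> measure \<mu> V = 0}" "finite \<V>" "?C \<subseteq> \<Union>\<V>"
      by (elim compactE) auto
    have "\<Union>\<V> \<in> null_sets \<mu>"
      using V i by (intro null_sets.finite_Union) (auto simp: null_sets_def emeasure_eq_measure)
    then show ?thesis by (rule null_sets_subset) (use V clC i in auto)
  qed
  have "(\<Union>n::nat. {x. \<phi> x \<ge> inverse (real (Suc n))}) \<in> null_sets \<mu>"
    by (intro null_sets_UN nul) auto
  then show ?thesis
  proof (rule AE_I', intro subsetI)
    fix x assume "x \<in> {x \<in> space \<mu>. x \<notin> ?K}"
    then have "\<phi> x > 0" using \<phi>(4) by auto
    then obtain n where "inverse (real (Suc n)) < \<phi> x" using reals_Archimedean by blast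
    then show "x \<in> (\<Union>n::nat. {x. \<phi> x \<ge> inverse (real (Suc n))})" by (auto intro: less_imp_le)
  qed
qed

text \<open>If some orbit violated the bound for infinitely many n, the empirical measures of these
  orbits would cluster at an invariant measure giving \<psi> an integral of at least e, although
  \<psi> vanishes almost everywhere for every invariant measure.\<close>

lemma ergodic_sums_vanishing_on_essential:
  fixes \<alpha> :: "'a::metric_space \<Rightarrow> 'a"
  assumes cX: "compact (UNIV :: 'a set)" and ca: "continuous_on UNIV \<alpha>"
    and \<psi>: "continuous_on UNIV \<psi>" "\<And>x. x \<in> essential_points \<alpha> \<Longrightarrow> \<psi> x = 0"
    and e: "e > 0"
  shows "eventually (\<lambda>n. \<forall>x. (\<Sum>i<n. \<psi> ((\<alpha> ^^ i) x)) \<le> e * real n) sequentially"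
proof (rule ccontr)
  assume ne: "\<not> ?thesis"
  define S where "S = {n. \<exists>x. (\<Sum>i<n. \<psi> ((\<alpha> ^^ i) x)) > e * real n}"
  \<comment> \<open>The filter of large times restricted to the violating ones; it is proper exactly
    because there are infinitely many of them.\<close>
  define F where "F = inf sequentially (principal S)"
  have Fs: "F \<le> sequentially" by (simp add: F_def)
  have "F \<noteq> bot"
    using ne unfolding F_def S_def trivial_limit_def eventually_inf_principal
    by (auto simp: not_less elim: eventually_mono)
  have "\<forall>n. \<exists>x. n \<in> S \<longrightarrow> (\<Sum>i<n. \<psi> ((\<alpha> ^^ i) x)) > e * real n" by (auto simp: S_def)
  then obtain x where x: "\<And>n. n \<in> S \<Longrightarrow> (\<Sum>i<n. \<psi> ((\<alpha> ^^ i) (x n))) > e * real n" by metis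
  obtain G \<mu> where G: "G \<le> F" "G \<noteq> bot" "\<mu> \<in> invariant_measures \<alpha>"
    and lim: "\<And>f. continuous_on UNIV f \<Longrightarrow> ((\<lambda>n. orbit_average \<alpha> (\<lambda>n. return_pmf (x n)) n f) \<longlongrightarrow> integral\<^sup>L \<mu> f) G"
    by (rule orbit_average_invariant_limit[OF cX ca Fs \<open>F \<noteq> bot\<close>, where \<eta> = "\<lambda>n. return_pmf (x n)"]) (rule that)
  have "integral\<^sup>L \<mu> \<psi> = (\<integral>x. 0 \<partial>\<mu>)"
  proof (rule integral_cong_AE)
    show "\<psi> \<in> borel_measurable \<mu>"
      using borel_measurable_continuous_onI[OF \<psi>(1)]
      by (simp add: measurable_cong_sets[OF invariant_measuresD(3)[OF G(3)] refl])
    show "AE x in \<mu>. \<psi> x = 0"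
      using AE_essential[OF cX G(3)] by (rule eventually_mono) (rule \<psi>(2))
  qed simp
  then have 0: "integral\<^sup>L \<mu> \<psi> = 0" by simp
  have "eventually (\<lambda>n. n \<in> S \<and> n > 0) F"
    unfolding F_def eventually_inf_principal using eventually_gt_at_top[of "0::nat"]
    by (rule eventually_mono) simp
  then have "eventually (\<lambda>n. n \<in> S \<and> n > 0) G" using G(1) by (simp add: le_filter_def)
  then have "eventually (\<lambda>n. e \<le> orbit_average \<alpha> (\<lambda>n. return_pmf (x n)) n \<psi>) G"
    by (rule eventually_mono) (use x in \<open>auto simp: orbit_average_def field_simps less_imp_le\<close>)
  from tendsto_lowerbound[OF lim[OF \<psi>(1)] this G(2)] show False using 0 e by simp
qed

section \<open>Spectral radius\<close>

lemma bounded_linear_funpow: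
  fixes T :: "'v::real_normed_vector \<Rightarrow> 'v"
  assumes "bounded_linear T"
  shows "bounded_linear (T ^^ n)"
proof (induction n)
  case 0
  then show ?case by (simp add: id_def)
next
  case (Suc n)
  then show ?case using bounded_linear_compose[OF assms Suc] by (simp add: o_def)
qed

text \<open>The bound concerns all powers, with a constant C: an operator whose powers decay
  geometrically may itself have norm above 1.\<close>

lemma neumann_series:
  fixes T :: "'w::banach \<Rightarrow> 'w"
  assumes T: "bounded_linear T" and q: "0 \<le> q" "q < 1" and C: "0 \<le> C"
    and b: "\<And>n p. norm ((T ^^ n) p) \<le> C * q ^ n * norm p"
  obtains S where "bounded_linear S" "\<And>p. S (p - T p) = p" "\<And>p. S p - T (S p) = p"
proof -
  define S where "S p = (\<Sum>n. (T ^^ n) p)" for p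
  have Tn: "bounded_linear (T ^^ n)" for n by (rule bounded_linear_funpow[OF T])
  have gs: "summable (\<lambda>n. C * q ^ n * norm p)" for p
    using q by (intro summable_mult2 summable_mult summable_geometric) auto
  have sm: "summable (\<lambda>n. (T ^^ n) p)" for p
    by (rule summable_comparison_test'[OF gs[of p], of 0]) (use b in auto)
  have smn: "summable (\<lambda>n. norm ((T ^^ n) p))" for p
    by (rule summable_comparison_test'[OF gs[of p], of 0]) (use b in auto)
  have "bounded_linear S"
  proof (rule bounded_linear_intro[where K="C * (1 / (1 - q))"])
    fix x y :: 'w
    show "S (x + y) = S x + S y"
      unfolding S_def using sm by (subst suminf_add) (auto simp: bounded_linear.linear[OF Tn, THEN linear_add])
    show "S (c *\<^sub>R x) = c *\<^sub>R S x" for c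
      unfolding S_def bounded_linear.linear[OF Tn, THEN linear_scale] by (rule suminf_scaleR_right[OF sm, symmetric])
    have "norm (S x) \<le> (\<Sum>n. norm ((T ^^ n) x))"
      unfolding S_def by (rule summable_norm[OF smn])
    also have "\<dots> \<le> (\<Sum>n. C * q ^ n * norm x)" by (rule suminf_le[OF b smn gs])
    also have "\<dots> = (C * (1 / (1 - q))) * norm x"
      using q by (subst suminf_mult2[symmetric]) (auto simp: suminf_mult summable_geometric suminf_geometric intro: summable_mult)
    finally show "norm (S x) \<le> norm x * (C * (1 / (1 - q)))" by (simp add: mult.commute)
  qed
  moreover have split: "S p = p + (\<Sum>n. (T ^^ Suc n) p)" for p
    unfolding S_def using suminf_split_head[OF sm, of p] by (simp add: algebra_simps)
  have "S (p - T p) = p" for p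
  proof -
    have "S (p - T p) = S p - S (T p)"
      using \<open>bounded_linear S\<close> by (simp add: bounded_linear.linear linear_diff)
    also have "S (T p) = (\<Sum>n. (T ^^ Suc n) p)" unfolding S_def by (simp add: funpow_swap1)
    finally show ?thesis using split[of p] by simp
  qed
  moreover have "S p - T (S p) = p" for p
  proof -
    have "T (S p) = (\<Sum>n. (T ^^ Suc n) p)" unfolding S_def using bounded_linear.suminf[OF T sm] by simp
    then show ?thesis using split[of p] by simp
  qed
  ultimately show ?thesis by (rule that)
qed

text \<open>Complex scalar multiplication on the complexification, where the pair (u, v) stands for
  u + iv.\<close>

definition cmul :: "complex \<Rightarrow> 'v::real_vector \<times> 'v \<Rightarrow> 'v \<times> 'v" where
  "cmul z p = (Re z *\<^sub>R fst p - Im z *\<^sub>R snd p, Re z *\<^sub>R snd p + Im z *\<^sub>R fst p)"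

lemma cmul_mult: "cmul (z * w) p = cmul z (cmul w p)"
  by (simp add: cmul_def algebra_simps)

lemma cmul_one: "cmul 1 p = p"
  by (simp add: cmul_def)

lemma norm_cmul_le:
  fixes p :: "'v::real_normed_vector \<times> 'v"
  shows "norm (cmul z p) \<le> 4 * cmod z * norm p"
proof -
  have b: "norm (Re z *\<^sub>R x) \<le> cmod z * norm p" "norm (Im z *\<^sub>R x) \<le> cmod z * norm p"
    if "norm x \<le> norm p" for x :: 'v
    using that abs_Re_le_cmod[of z] abs_Im_le_cmod[of z] by (auto intro!: mult_mono)
  have f: "norm (fst p) \<le> norm p" "norm (snd p) \<le> norm p"
    using norm_fst_le[of "fst p" "snd p"] norm_snd_le[of "snd p" "fst p"] by auto
  have "norm (cmul z p) \<le> norm (Re z *\<^sub>R fst p - Im z *\<^sub>R snd p) + norm (Re z *\<^sub>R snd p + Im z *\<^sub>R fst p)"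
    unfolding cmul_def by (rule norm_Pair_le)
  also have "\<dots> \<le> (norm (Re z *\<^sub>R fst p) + norm (Im z *\<^sub>R snd p)) + (norm (Re z *\<^sub>R snd p) + norm (Im z *\<^sub>R fst p))"
    by (intro add_mono norm_triangle_ineq4 norm_triangle_ineq)
  also have "\<dots> \<le> 4 * cmod z * norm p"
    using b(1)[OF f(1)] b(1)[OF f(2)] b(2)[OF f(1)] b(2)[OF f(2)] by linarith
  finally show ?thesis .
qed

lemma bounded_linear_cmul: "bounded_linear (cmul z :: 'v::real_normed_vector \<times> 'v \<Rightarrow> _)"
proof (rule bounded_linear_intro[where K="4 * cmod z"])
  show "norm (cmul z p) \<le> norm p * (4 * cmod z)" for p :: "'v \<times> 'v"
    using norm_cmul_le[of z p] by (simp add: mult_ac)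
qed (auto simp: cmul_def algebra_simps scaleR_add_right)

text \<open>On the complexification z - B factors as z times (1 - T) with T = B/z. The powers of T
  are bounded by 8 C (q/|z|)^n, so the Neumann series inverts 1 - T. The 8 is 4 from
  \<open>norm_cmul_le\<close> times 2 for the two components.\<close>

lemma not_in_spectrum:
  fixes B :: "'v::banach \<Rightarrow> 'v"
  assumes B: "bounded_linear B" and q: "0 \<le> q" and C: "0 \<le> C"
    and b: "\<And>n p. norm ((B ^^ n) p) \<le> C * q ^ n * norm p" and z: "q < cmod z"
  shows "z \<notin> operator_spectrum B"
proof -
  have z0: "z \<noteq> 0" using q z by auto
  define D where "D p = (B (fst p), B (snd p))" for p
  have D: "bounded_linear D"
    unfolding D_def by (intro bounded_linear_Pair bounded_linear_compose[OF B] bounded_linear_fst bounded_linear_snd)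
  have Dc: "D (cmul w p) = cmul w (D p)" for w p
    using bounded_linear.linear[OF B] by (simp add: D_def cmul_def linear_add linear_diff linear_scale)
  have Dn: "(D ^^ n) p = ((B ^^ n) (fst p), (B ^^ n) (snd p))" for n p
    by (induction n) (auto simp: D_def)
  define T where "T p = cmul (1 / z) (D p)" for p
  have T: "bounded_linear T" unfolding T_def by (rule bounded_linear_compose[OF bounded_linear_cmul D])
  have Tn: "(T ^^ n) p = cmul ((1 / z) ^ n) ((D ^^ n) p)" for n p
    by (induction n) (auto simp: T_def cmul_one Dc cmul_mult[symmetric])
  have bT: "norm ((T ^^ n) p) \<le> (8 * C) * (q / cmod z) ^ n * norm p" for n p
  proof -
    have f: "norm (fst p) \<le> norm p" "norm (snd p) \<le> norm p"
      using norm_fst_le[of "fst p" "snd p"] norm_snd_le[of "snd p" "fst p"] by auto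
    have "norm ((D ^^ n) p) \<le> norm ((B ^^ n) (fst p)) + norm ((B ^^ n) (snd p))"
      unfolding Dn by (rule norm_Pair_le)
    also have "\<dots> \<le> C * q ^ n * norm p + C * q ^ n * norm p"
      using f q C by (intro add_mono order_trans[OF b] mult_left_mono) auto
    finally have 1: "norm ((D ^^ n) p) \<le> 2 * C * q ^ n * norm p" by (simp add: mult_ac)
    have "norm ((T ^^ n) p) \<le> 4 * cmod ((1 / z) ^ n) * norm ((D ^^ n) p)"
      unfolding Tn by (rule norm_cmul_le)
    also have "\<dots> \<le> 4 * cmod ((1 / z) ^ n) * (2 * C * q ^ n * norm p)"
      using 1 by (intro mult_left_mono) auto
    also have "\<dots> = (8 * C) * (q / cmod z) ^ n * norm p"
      by (simp add: norm_power norm_divide power_divide)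
    finally show ?thesis .
  qed
  have "0 \<le> q / cmod z" "q / cmod z < 1" "0 \<le> 8 * C" using q z C z0 by (auto simp: divide_less_eq)
  then obtain S0 where S0: "bounded_linear S0" "\<And>p. S0 (p - T p) = p" "\<And>p. S0 p - T (S0 p) = p"
    by (rule neumann_series[OF T _ _ _ bT]) (rule that)
  define S where "S p = S0 (cmul (1 / z) p)" for p
  have M: "complexified_resolvent_map B z p = cmul z (p - T p)" for p
  proof -
    have "cmul z (p - T p) = cmul z p - cmul z (T p)"
      using bounded_linear.linear[OF bounded_linear_cmul] by (rule linear_diff)
    also have "cmul z (T p) = D p" using z0 by (simp add: T_def cmul_mult[symmetric] cmul_one)
    finally show ?thesis
      by (cases p) (simp add: complexified_resolvent_map_def cmul_def D_def)
  qed
  have inv: "cmul z (cmul (1 / z) p) = p" "cmul (1 / z) (cmul z p) = p" for p :: "'v \<times> 'v"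
    using z0 by (simp_all add: cmul_mult[symmetric] cmul_one)
  have "bounded_linear S" unfolding S_def by (rule bounded_linear_compose[OF S0(1) bounded_linear_cmul])
  moreover have "S \<circ> complexified_resolvent_map B z = id"
    by (rule ext) (simp add: M S_def inv S0)
  moreover have "complexified_resolvent_map B z \<circ> S = id"
    by (rule ext) (simp add: M S_def inv S0)
  ultimately show ?thesis unfolding operator_spectrum_def by blast
qed

text \<open>At a real point of the resolvent set, the complex inverse is restricted to real vectors
  and its real part is taken. The resulting left inverse is all that the later norm estimates
  use.\<close>

lemma real_resolvent:
  fixes B :: "'v::real_normed_vector \<Rightarrow> 'v"
  assumes B: "bounded_linear B" and r: "complex_of_real r \<notin> operator_spectrum B"
  obtains R where "bounded_linear R" "\<And>u. R (r *\<^sub>R u - B u) = u"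
proof -
  obtain S where S: "bounded_linear S" "S \<circ> complexified_resolvent_map B (complex_of_real r) = id"
    using r unfolding operator_spectrum_def by blast
  have "bounded_linear (\<lambda>u. fst (S (u, 0)))"
    by (intro bounded_linear_compose[OF bounded_linear_fst] bounded_linear_compose[OF S(1)]
        bounded_linear_Pair bounded_linear_ident bounded_linear_zero)
  moreover have "fst (S (r *\<^sub>R u - B u, 0)) = u" for u
  proof -
    have "complexified_resolvent_map B (complex_of_real r) (u, 0) = (r *\<^sub>R u - B u, 0)"
      using linear_0[OF bounded_linear.linear[OF B]] by (simp add: complexified_resolvent_map_def)
    then show ?thesis using fun_cong[OF S(2), of "(u, 0)"] by simp
  qed
  ultimately show ?thesis by (rule that)
qed

section \<open>Spectral radius of a positive operator on C(X)\<close>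

instance bcontfun :: (metric_space, banach) banach ..

lemma apply_bcontfun_sum:
  fixes f :: "'i \<Rightarrow> 'a::topological_space \<Rightarrow>\<^sub>C 'b::real_normed_vector"
  shows "apply_bcontfun (\<Sum>i\<in>I. f i) x = (\<Sum>i\<in>I. apply_bcontfun (f i) x)"
  by (induction I rule: infinite_finite_induct) auto

locale positive_operator =
  fixes B :: "('a::metric_space \<Rightarrow>\<^sub>C real) \<Rightarrow> ('a \<Rightarrow>\<^sub>C real)"
  assumes linear: "linear B"
    and positive: "\<And>f x. (\<And>y. 0 \<le> apply_bcontfun f y) \<Longrightarrow> 0 \<le> apply_bcontfun (B f) x"
begin

abbreviation "one \<equiv> const_bcontfun 1 :: 'a \<Rightarrow>\<^sub>C real"

text \<open>By positivity this is the operator norm of the n-th power: a function of norm at most 1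
  lies between the constants -1 and 1.\<close>

definition growth :: "nat \<Rightarrow> real" where
  "growth n = norm ((B ^^ n) one)"

lemma growth_nonneg: "0 \<le> growth n" by (simp add: growth_def)

lemma linear_pow: "linear (B ^^ n)"
proof (induction n)
  case 0
  then show ?case by (simp add: linear_iff)
next
  case (Suc n)
  then show ?case using linear_compose[OF Suc linear] by (simp add: o_def)
qed

lemma positive_pow: "(\<And>y. 0 \<le> apply_bcontfun f y) \<Longrightarrow> 0 \<le> apply_bcontfun ((B ^^ n) f) x"
proof (induction n arbitrary: x)
  case (Suc n)
  then show ?case using positive by simp
qed simp

lemma mono_pow:
  assumes "\<And>y. apply_bcontfun f y \<le> apply_bcontfun h y"
  shows "apply_bcontfun ((B ^^ n) f) x \<le> apply_bcontfun ((B ^^ n) h) x"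
proof -
  have "0 \<le> apply_bcontfun ((B ^^ n) (h - f)) x" using assms by (intro positive_pow) simp
  then show ?thesis by (simp add: linear_diff[OF linear_pow])
qed

lemma pow_one_le_growth: "apply_bcontfun ((B ^^ n) one) x \<le> growth n"
  using norm_bounded[of "(B ^^ n) one" x] by (simp add: growth_def)

lemma pow_one_nonneg: "0 \<le> apply_bcontfun ((B ^^ n) one) x"
  by (rule positive_pow) simp

lemma abs_pow_le: "\<bar>apply_bcontfun ((B ^^ n) f) x\<bar> \<le> norm f * apply_bcontfun ((B ^^ n) one) x"
proof -
  have f: "\<bar>apply_bcontfun f y\<bar> \<le> norm f" for y using norm_bounded[of f y] by simp
  have "apply_bcontfun ((B ^^ n) f) x \<le> apply_bcontfun ((B ^^ n) (norm f *\<^sub>R one)) x"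
    using f by (intro mono_pow) (simp add: abs_le_iff)
  moreover have "apply_bcontfun ((B ^^ n) ((- norm f) *\<^sub>R one)) x \<le> apply_bcontfun ((B ^^ n) f) x"
    using f by (intro mono_pow) (simp add: abs_le_iff minus_le_iff)
  ultimately show ?thesis by (simp add: linear_scale[OF linear_pow] linear_neg[OF linear_pow])
qed

lemma norm_pow_le: "norm ((B ^^ n) f) \<le> growth n * norm f"
proof (rule norm_bound)
  fix x
  have "norm f * apply_bcontfun ((B ^^ n) one) x \<le> norm f * growth n"
    by (intro mult_left_mono pow_one_le_growth) simp
  then show "norm (apply_bcontfun ((B ^^ n) f) x) \<le> growth n * norm f"
    using abs_pow_le[of n f x] by (simp add: mult.commute)
qed

lemma bounded_linear: "bounded_linear B"
proof -
  have "norm (B f) \<le> norm f * growth 1" for f using norm_pow_le[of 1 f] by (simp add: mult.commute)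
  then show ?thesis using linear by (intro bounded_linear_intro) (auto simp: linear_add linear_scale)
qed

lemma growth_0: "growth 0 = 1"
proof (rule antisym)
  show "growth 0 \<le> 1" unfolding growth_def by (rule norm_bound) simp
  show "1 \<le> growth 0" using pow_one_le_growth[of 0 undefined] by simp
qed

lemma growth_add: "growth (m + n) \<le> growth m * growth n"
  unfolding growth_def funpow_add o_apply using norm_pow_le[of m "(B ^^ n) one"] by (simp add: growth_def)

lemma growth_mult: "growth (m * k) \<le> growth m ^ k"
proof (induction k)
  case (Suc k)
  have "growth (m * Suc k) \<le> growth m * growth (m * k)" using growth_add[of m "m * k"] by simp
  also have "\<dots> \<le> growth m * growth m ^ k" using Suc growth_nonneg by (intro mult_left_mono)
  finally show ?case by simp
qed (simp add: growth_0)

text \<open>Gelfand's formula with an infimum in place of the limit; \<open>radius_power_le\<close>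
  and \<open>growth_le_power\<close> pin down the exponential rate of \<open>growth\<close> from
  both sides.\<close>

definition radius :: real where
  "radius = (INF n\<in>{1..}. root n (growth n))"

lemma bdd: "bdd_below ((\<lambda>n. root n (growth n)) ` {1..})"
  using growth_nonneg by (intro bdd_belowI[of _ 0]) auto

lemma radius_le: "n \<ge> 1 \<Longrightarrow> radius \<le> root n (growth n)"
  unfolding radius_def by (rule cINF_lower[OF bdd]) auto

lemma radius_nonneg: "0 \<le> radius"
  unfolding radius_def using growth_nonneg by (intro cINF_greatest) auto

lemma radius_power_le: "radius ^ n \<le> growth n"
proof (cases "n = 0")
  case False
  have "radius ^ n \<le> root n (growth n) ^ n" using False radius_nonneg by (intro power_mono radius_le) auto
  then show ?thesis using False growth_nonneg by simp
qed (simp add: growth_0)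

lemma growth_le_power:
  assumes "radius < q"
  obtains C where "C > 0" "\<And>n. growth n \<le> C * q ^ n"
proof -
  have q: "q > 0" using assms radius_nonneg by linarith
  have "\<exists>n\<in>{1..}. root n (growth n) < q"
    using assms bdd unfolding radius_def by (subst (asm) cINF_less_iff) auto
  then obtain m where m: "m \<ge> 1" "root m (growth m) < q" by auto
  have am: "growth m \<le> q ^ m"
  proof -
    have "root m (growth m) ^ m \<le> q ^ m" using m growth_nonneg by (intro power_mono) auto
    then show ?thesis using m growth_nonneg by simp
  qed
  \<comment> \<open>After division of n by m, C absorbs the remainder \<open>n mod m\<close>, which
    takes only the values below m.\<close>
  define C where "C = 1 + (\<Sum>j<m. growth j / q ^ j)"
  have C: "growth j / q ^ j \<le> C" if "j < m" for j
    using member_le_sum[of j "{..<m}" "\<lambda>j. growth j / q ^ j"] that growth_nonneg q by (auto simp: C_def)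
  have Cp: "C > 0" unfolding C_def using growth_nonneg q by (intro add_pos_nonneg sum_nonneg) auto
  show ?thesis
  proof (rule that[OF Cp])
    fix n
    have "growth n = growth (m * (n div m) + n mod m)" by simp
    also have "\<dots> \<le> growth (m * (n div m)) * growth (n mod m)" by (rule growth_add)
    also have "\<dots> \<le> (q ^ m) ^ (n div m) * growth (n mod m)"
      using am growth_nonneg by (intro mult_right_mono order_trans[OF growth_mult] power_mono) auto
    also have "\<dots> \<le> (q ^ m) ^ (n div m) * (C * q ^ (n mod m))"
      using C[of "n mod m"] m q by (intro mult_left_mono) (auto simp: field_simps)
    also have "\<dots> = C * (q ^ (m * (n div m)) * q ^ (n mod m))" by (simp add: power_mult)
    also have "\<dots> = C * q ^ n" unfolding power_add[symmetric] by simp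
    finally show "growth n \<le> C * q ^ n" .
  qed
qed

lemma spectrum_le_radius:
  assumes "z \<in> operator_spectrum B"
  shows "cmod z \<le> radius"
proof (rule ccontr)
  assume "\<not> ?thesis"
  then have "radius < (radius + cmod z) / 2" "(radius + cmod z) / 2 < cmod z" by auto
  moreover define q where "q = (radius + cmod z) / 2"
  ultimately have q: "radius < q" "q < cmod z" by auto
  obtain C where C: "C > 0" "\<And>n. growth n \<le> C * q ^ n"
    by (rule growth_le_power[OF q(1)]) (rule that)
  have "norm ((B ^^ n) p) \<le> C * q ^ n * norm p" for n p
    by (rule order_trans[OF norm_pow_le mult_right_mono[OF C(2)]]) simp
  then have "z \<notin> operator_spectrum B"
    using q radius_nonneg C(1) by (intro not_in_spectrum[OF bounded_linear, of q C]) auto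
  then show False using assms by simp
qed

text \<open>The truncated series of (l - B)^(-1) applied to \<open>one\<close>. Truncation keeps it
  meaningful and continuous in l at l = \<open>radius\<close>, where the full series may
  diverge.\<close>

definition partial_resolvent :: "real \<Rightarrow> nat \<Rightarrow> 'a \<Rightarrow>\<^sub>C real" where
  "partial_resolvent l N = (\<Sum>n\<le>N. (1 / l ^ Suc n) *\<^sub>R (B ^^ n) one)"

lemma partial_resolvent_apply:
  "apply_bcontfun (partial_resolvent l N) x = (\<Sum>n\<le>N. apply_bcontfun ((B ^^ n) one) x / l ^ Suc n)"
  by (simp add: partial_resolvent_def apply_bcontfun_sum)

lemma resolvent_telescope:
  assumes "l > 0"
  shows "l *\<^sub>R partial_resolvent l N - B (partial_resolvent l N) = one - (1 / l ^ Suc N) *\<^sub>R (B ^^ Suc N) one"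
proof (induction N)
  case 0
  then show ?case using assms by (simp add: partial_resolvent_def linear_scale[OF linear])
next
  case (Suc N)
  have "partial_resolvent l (Suc N) = partial_resolvent l N + (1 / l ^ Suc (Suc N)) *\<^sub>R (B ^^ Suc N) one"
    by (simp add: partial_resolvent_def)
  then have "l *\<^sub>R partial_resolvent l (Suc N) - B (partial_resolvent l (Suc N)) =
     (l *\<^sub>R partial_resolvent l N - B (partial_resolvent l N)) +
     (l * (1 / l ^ Suc (Suc N))) *\<^sub>R (B ^^ Suc N) one - (1 / l ^ Suc (Suc N)) *\<^sub>R B ((B ^^ Suc N) one)"
    by (simp only: linear_add[OF linear] linear_scale[OF linear] scaleR_add_right scaleR_scaleR) (simp add: algebra_simps)
  also have "l * (1 / l ^ Suc (Suc N)) = 1 / l ^ Suc N" using assms by simp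
  finally show ?case unfolding Suc by simp
qed

text \<open>If \<open>r = radius\<close> were in the resolvent set, the partial sums of the resolvent series would stay
  bounded as \<open>l\<close> decreases to \<open>r\<close>; by positivity this gives a bound at \<open>l = r\<close>, and then
  \<open>growth N = O(r^N / N)\<close>, which contradicts \<open>r^N \<le> growth N\<close>.\<close>

lemma radius_in_spectrum_pos:
  assumes r: "radius > 0"
  shows "complex_of_real radius \<in> operator_spectrum B"
proof (rule ccontr)
  assume ns: "complex_of_real radius \<notin> operator_spectrum B"
  let ?r = radius and ?s = partial_resolvent
  obtain R where R: "bounded_linear R" "\<And>u. R (?r *\<^sub>R u - B u) = u"
    by (rule real_resolvent[OF bounded_linear ns]) (rule that)
  obtain K where K: "K > 0" "\<And>u. norm (R u) \<le> norm u * K"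
    using bounded_linear.pos_bounded[OF R(1)] by blast
  have norm_one: "norm one = 1" using growth_0 by (simp add: growth_def)
  \<comment> \<open>The hypothetical inverse R at \<open>radius\<close> is applied at the nearby l.
    The discrepancy (l - r) times the partial sum reappears on the right with a factor at most 1/2,
    and is absorbed into the left side.\<close>
  have bound: "norm (?s l N) \<le> 2 * K * (1 + growth (Suc N) / l ^ Suc N)"
    if l: "?r < l" "(l - ?r) * K \<le> 1 / 2" for l N
  proof -
    have l0: "l > 0" using l r by linarith
    have "?r *\<^sub>R ?s l N - B (?s l N) = one - (1 / l ^ Suc N) *\<^sub>R (B ^^ Suc N) one - (l - ?r) *\<^sub>R ?s l N"
      using resolvent_telescope[OF l0, of N] by (simp add: algebra_simps)
    then have eq: "?s l N = R (one - (1 / l ^ Suc N) *\<^sub>R (B ^^ Suc N) one - (l - ?r) *\<^sub>R ?s l N)"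
      using R(2)[of "?s l N"] by simp
    have "norm (one - (1 / l ^ Suc N) *\<^sub>R (B ^^ Suc N) one - (l - ?r) *\<^sub>R ?s l N)
        \<le> norm one + norm ((1 / l ^ Suc N) *\<^sub>R (B ^^ Suc N) one) + norm ((l - ?r) *\<^sub>R ?s l N)"
      by (meson norm_triangle_ineq4 add_right_mono order_trans)
    also have "norm ((1 / l ^ Suc N) *\<^sub>R (B ^^ Suc N) one) = growth (Suc N) / l ^ Suc N"
      unfolding norm_scaleR growth_def using l0 by simp
    also have "norm ((l - ?r) *\<^sub>R ?s l N) = (l - ?r) * norm (?s l N)" using l by simp
    finally have e1: "norm (?s l N) \<le> (1 + growth (Suc N) / l ^ Suc N + (l - ?r) * norm (?s l N)) * K"
      unfolding norm_one eq[symmetric]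
      using order_trans[OF K(2) mult_right_mono] K(1) eq by (metis less_imp_le)
    have e2: "(l - ?r) * K * norm (?s l N) \<le> 1 / 2 * norm (?s l N)"
      using l by (intro mult_right_mono) auto
    have "s \<le> 2 * K * (1 + g)" if "s \<le> (1 + g + (l - ?r) * s) * K" "(l - ?r) * K * s \<le> 1 / 2 * s"
      for g s :: real
    proof -
      have "(1 + g + (l - ?r) * s) * K = K * (1 + g) + (l - ?r) * K * s" by (simp add: algebra_simps)
      then show ?thesis using that by linarith
    qed
    from this[OF e1 e2] show ?thesis .
  qed
  have nn: "0 \<le> apply_bcontfun ((B ^^ n) one) x / l ^ Suc n" if "l > 0" for n x l
    using pow_one_nonneg[of n x] that by simp
  \<comment> \<open>Partial sums increase with N by positivity, so N may be enlarged until the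
    remainder term in \<open>bound\<close> is at most 1. This turns 2K(1 + ...) into 4K, uniformly
    in l and N.\<close>
  have bound_x: "apply_bcontfun (?s l N) x \<le> 4 * K" if l: "?r < l" "(l - ?r) * K \<le> 1 / 2" for l N x
  proof -
    define q where "q = (?r + l) / 2"
    have q: "?r < q" "q < l" using l by (auto simp: q_def)
    have l0: "l > 0" using l r by linarith
    obtain C where C: "C > 0" "\<And>n. growth n \<le> C * q ^ n"
      by (rule growth_le_power[OF q(1)]) (rule that)
    have "(\<lambda>n. C * (q / l) ^ n) \<longlonglongrightarrow> C * 0"
      using q l0 r by (intro tendsto_mult tendsto_const LIMSEQ_power_zero) auto
    then have "eventually (\<lambda>n. C * (q / l) ^ n < 1) sequentially"
      by (intro order_tendstoD(2)[of _ "C * 0"]) auto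
    then obtain n0 where n0: "\<And>n. n \<ge> n0 \<Longrightarrow> C * (q / l) ^ n < 1" unfolding eventually_sequentially by auto
    define N' where "N' = max N n0"
    have "growth (Suc N') / l ^ Suc N' \<le> C * q ^ Suc N' / l ^ Suc N'"
      using l0 by (intro divide_right_mono C(2)) auto
    also have "\<dots> = C * (q / l) ^ Suc N'" by (simp add: power_divide)
    also have "\<dots> < 1" by (rule n0) (simp add: N'_def)
    finally have g1: "growth (Suc N') / l ^ Suc N' \<le> 1" by simp
    have "apply_bcontfun (?s l N) x \<le> apply_bcontfun (?s l N') x"
      unfolding partial_resolvent_apply by (rule sum_mono2) (use nn[OF l0] in \<open>auto simp: N'_def\<close>)
    also have "\<dots> \<le> norm (?s l N')" using norm_bounded[of "?s l N'" x] by simp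
    also have "\<dots> \<le> 2 * K * (1 + growth (Suc N') / l ^ Suc N')" by (rule bound[OF l])
    also have "\<dots> \<le> 2 * K * (1 + 1)" using g1 K by (intro mult_left_mono add_left_mono) auto
    finally show ?thesis by simp
  qed
  define M where "M = 4 * K"
  have bound_r: "apply_bcontfun (?s ?r N) x \<le> M" for N x
  proof (rule tendsto_upperbound)
    show "((\<lambda>l. apply_bcontfun (?s l N) x) \<longlongrightarrow> apply_bcontfun (?s ?r N) x) (at_right ?r)"
      unfolding partial_resolvent_apply using r by (intro tendsto_intros) auto
    have "eventually (\<lambda>l. ?r < l \<and> l < ?r + 1 / (2 * K)) (at_right ?r)"
      using K(1) by (intro eventually_at_rightI[of ?r "?r + 1 / (2 * K)"]) auto
    then show "eventually (\<lambda>l. apply_bcontfun (?s l N) x \<le> M) (at_right ?r)"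
    proof (rule eventually_mono)
      fix l assume l: "?r < l \<and> l < ?r + 1 / (2 * K)"
      then have "l - ?r \<le> 1 / (2 * K)" by simp
      then have "(l - ?r) * K \<le> 1 / (2 * K) * K" using K by (intro mult_right_mono) auto
      then show "apply_bcontfun (?s l N) x \<le> M" unfolding M_def using l K by (intro bound_x) auto
    qed
  qed simp
  have M0: "M > 0" using K by (simp add: M_def)
  define w where "w n = (1 / ?r ^ n) *\<^sub>R (B ^^ n) one" for n
  have w_apply: "apply_bcontfun (w n) x = apply_bcontfun ((B ^^ n) one) x / ?r ^ n" for n x
    by (simp add: w_def)
  have w0: "0 \<le> apply_bcontfun (w n) x" for n x
    unfolding w_apply using pow_one_nonneg r by simp
  have sum_w: "(\<Sum>n\<le>N. apply_bcontfun (w n) x) \<le> M * ?r" for N x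
  proof -
    have "(\<Sum>n\<le>N. apply_bcontfun (w n) x) = apply_bcontfun (?s ?r N) x * ?r"
      unfolding partial_resolvent_apply w_apply sum_distrib_right using r by (intro sum.cong) auto
    then show ?thesis using bound_r[of N x] r by (simp add: mult_right_mono)
  qed
  have w_le: "apply_bcontfun (w n) x \<le> M * ?r" for n x
    using member_le_sum[of n "{..n}" "\<lambda>n. apply_bcontfun (w n) x"] w0 sum_w[of x n] by force
  \<comment> \<open>The remaining N - n iterates, normalized, stay below M r, and
    \<open>B ^^ n\<close> is monotone. So the last term is dominated by every earlier one; adding
    these N + 1 inequalities against the bounded sum \<open>sum_w\<close> gives the decay
    1/(N+1).\<close>
  have w_split: "apply_bcontfun (w N) x \<le> (M * ?r) * apply_bcontfun (w n) x" if "n \<le> N" for n N x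
  proof -
    have "w N = (1 / ?r ^ n) *\<^sub>R (B ^^ n) (w (N - n))"
    proof -
      have "(B ^^ N) one = (B ^^ n) ((B ^^ (N - n)) one)"
        using funpow_add[of n "N - n" B] that by (simp add: fun_eq_iff)
      moreover have "?r ^ N = ?r ^ n * ?r ^ (N - n)" using that by (simp add: power_add[symmetric])
      ultimately show ?thesis by (simp add: w_def linear_scale[OF linear_pow])
    qed
    then have "apply_bcontfun (w N) x = apply_bcontfun ((B ^^ n) (w (N - n))) x / ?r ^ n" by simp
    also have "\<dots> \<le> apply_bcontfun ((B ^^ n) ((M * ?r) *\<^sub>R one)) x / ?r ^ n"
      using w_le r by (intro divide_right_mono mono_pow) auto
    also have "\<dots> = (M * ?r) * apply_bcontfun (w n) x"
      by (simp add: linear_scale[OF linear_pow] w_apply)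
    finally show ?thesis .
  qed
  have "real (Suc N) * apply_bcontfun (w N) x \<le> (M * ?r) * (M * ?r)" for N x
  proof -
    have "real (Suc N) * apply_bcontfun (w N) x = (\<Sum>n\<le>N. apply_bcontfun (w N) x)" by simp
    also have "\<dots> \<le> (\<Sum>n\<le>N. (M * ?r) * apply_bcontfun (w n) x)" by (intro sum_mono w_split) auto
    also have "\<dots> \<le> (M * ?r) * (M * ?r)"
      unfolding sum_distrib_left[symmetric] using M0 r sum_w by (intro mult_left_mono) auto
    finally show ?thesis .
  qed
  then have wN: "apply_bcontfun (w N) x \<le> (M * ?r)\<^sup>2 / real (Suc N)" for N x
    by (simp add: field_simps power2_eq_square)
  obtain N :: nat where N: "(M * ?r)\<^sup>2 < real N" using reals_Archimedean2 by blast
  have "growth N / ?r ^ N \<le> (M * ?r)\<^sup>2 / real (Suc N)"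
  proof -
    have "norm (w N) \<le> (M * ?r)\<^sup>2 / real (Suc N)"
      by (rule norm_bound) (use wN w0 in simp)
    then show ?thesis using r by (simp add: w_def growth_def)
  qed
  also have "\<dots> < 1" using N by simp
  finally have "growth N < ?r ^ N" using r by (simp add: divide_less_eq)
  then show False using radius_power_le[of N] by simp
qed

text \<open>A separate case, because the normalization by powers of \<open>radius\<close> breaks
  down. If 0 were a resolvent point, B would expand norms by at least 1/K, so \<open>growth\<close>
  could not decay faster than (1/K)^n, whereas \<open>radius\<close> = 0 forces decay below every
  rate, in particular (1/(2K))^n.\<close>

lemma radius_in_spectrum_zero:
  assumes r: "radius = 0"
  shows "0 \<in> operator_spectrum B"
proof (rule ccontr)
  assume "0 \<notin> operator_spectrum B"
  then have ns: "complex_of_real 0 \<notin> operator_spectrum B" by simp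
  obtain R where R: "bounded_linear R" "\<And>u. R (0 *\<^sub>R u - B u) = u"
    by (rule real_resolvent[OF bounded_linear ns]) (rule that)
  obtain K where K: "K > 0" "\<And>u. norm (R u) \<le> norm u * K"
    using bounded_linear.pos_bounded[OF R(1)] by blast
  have step: "norm u \<le> K * norm (B u)" for u
    using K(2)[of "0 *\<^sub>R u - B u"] R(2)[of u] by (simp add: mult.commute)
  have low: "1 \<le> K ^ n * growth n" for n
  proof (induction n)
    case (Suc n)
    have "growth n \<le> K * growth (Suc n)" using step[of "(B ^^ n) one"] by (simp add: growth_def)
    then have "K ^ n * growth n \<le> K ^ n * (K * growth (Suc n))" using K by (intro mult_left_mono) auto
    then show ?case using Suc by (simp add: mult_ac)
  qed (simp add: growth_0)
  define q where "q = 1 / (2 * K)"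
  have q: "radius < q" using r K by (simp add: q_def)
  obtain C where C: "C > 0" "\<And>n. growth n \<le> C * q ^ n"
    by (rule growth_le_power[OF q]) (rule that)
  have "2 ^ n \<le> C" for n :: nat
  proof -
    have "1 \<le> K ^ n * (C * q ^ n)"
      using low[of n] mult_left_mono[OF C(2)[of n], of "K ^ n"] K by (simp add: order_trans)
    also have "\<dots> = C * (K * q) ^ n" by (simp add: power_mult_distrib)
    also have "K * q = 1 / 2" using K by (simp add: q_def)
    finally show ?thesis by (simp add: power_divide field_simps)
  qed
  moreover obtain n :: nat where "C < 2 ^ n" using real_arch_pow[of 2 C] by auto
  ultimately show False by (meson not_less)
qed

theorem operator_spectral_radius_eq: "operator_spectral_radius B = radius"
  unfolding operator_spectral_radius_def
proof (rule cSup_eq_maximum)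
  have "complex_of_real radius \<in> operator_spectrum B"
    using radius_in_spectrum_pos radius_in_spectrum_zero radius_nonneg by (cases "radius = 0") auto
  then show "radius \<in> cmod ` operator_spectrum B"
    using radius_nonneg by (intro image_eqI[of _ _ "complex_of_real radius"]) auto
qed (use spectrum_le_radius in auto)

end

section \<open>Sums over preimages\<close>

text \<open>The n-th iterate, at x, of the weighted transfer operator on K applied to 1. A sum over
  an infinite set would be 0 by default, hence the finiteness of fibres in the lemmas; at n = 0 this
  is the indicator of K.\<close>

definition preimage_sum :: "'a set \<Rightarrow> ('a \<Rightarrow> 'a) \<Rightarrow> ('a \<Rightarrow> real) \<Rightarrow> nat \<Rightarrow> 'a \<Rightarrow> real" where
  "preimage_sum K \<alpha> w n x = (\<Sum>y | y \<in> K \<and> (\<alpha> ^^ n) y = x. \<Prod>i<n. w ((\<alpha> ^^ i) y))"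

lemma funpow_in: "(\<And>y. y \<in> K \<Longrightarrow> \<alpha> y \<in> K) \<Longrightarrow> y \<in> K \<Longrightarrow> (\<alpha> ^^ n) y \<in> K"
  by (induction n) auto

lemma finite_preimages:
  assumes fin: "\<And>x. finite {y. y \<in> K \<and> \<alpha> y = x}" and K: "\<And>y. y \<in> K \<Longrightarrow> \<alpha> y \<in> K"
  shows "finite {y. y \<in> K \<and> (\<alpha> ^^ n) y = x}"
proof (induction n arbitrary: x)
  case 0
  have "{y. y \<in> K \<and> (\<alpha> ^^ 0) y = x} \<subseteq> {x}" by auto
  then show ?case by (rule finite_subset) simp
next
  case (Suc n)
  have "{y. y \<in> K \<and> (\<alpha> ^^ Suc n) y = x} \<subseteq> (\<Union>u\<in>{u. u \<in> K \<and> \<alpha> u = x}. {y. y \<in> K \<and> (\<alpha> ^^ n) y = u})"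
    using funpow_in[of K \<alpha>] K by auto
  then show ?case by (rule finite_subset) (intro finite_UN_I fin Suc)
qed

text \<open>Preimages are grouped by their last point before x, u = \<alpha>^n(y), and not by their
  first step. The recursion then has the form of one application of the operator to the previous
  iterate.\<close>

lemma preimage_sum_Suc:
  assumes fin: "\<And>x. finite {y. y \<in> K \<and> \<alpha> y = x}" and K: "\<And>y. y \<in> K \<Longrightarrow> \<alpha> y \<in> K"
  shows "preimage_sum K \<alpha> w (Suc n) x = (\<Sum>u | u \<in> K \<and> \<alpha> u = x. w u * preimage_sum K \<alpha> w n u)"
proof -
  have eq: "{y. y \<in> K \<and> (\<alpha> ^^ Suc n) y = x} = (\<Union>u\<in>{u. u \<in> K \<and> \<alpha> u = x}. {y. y \<in> K \<and> (\<alpha> ^^ n) y = u})"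
    using funpow_in[of K \<alpha>] K by auto
  have "preimage_sum K \<alpha> w (Suc n) x =
      (\<Sum>u | u \<in> K \<and> \<alpha> u = x. \<Sum>y | y \<in> K \<and> (\<alpha> ^^ n) y = u. \<Prod>i<Suc n. w ((\<alpha> ^^ i) y))"
    unfolding preimage_sum_def eq
    by (rule sum.UNION_disjoint) (use fin finite_preimages[OF fin K] in auto)
  also have "\<dots> = (\<Sum>u | u \<in> K \<and> \<alpha> u = x. w u * preimage_sum K \<alpha> w n u)"
    unfolding preimage_sum_def sum_distrib_left by (intro sum.cong refl) (auto simp: mult.commute)
  finally show ?thesis .
qed

lemma preimage_sum_nonneg:
  "(\<And>y. y \<in> K \<Longrightarrow> 0 \<le> w y) \<Longrightarrow> (\<And>y. y \<in> K \<Longrightarrow> \<alpha> y \<in> K) \<Longrightarrow> 0 \<le> preimage_sum K \<alpha> w n x"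
  unfolding preimage_sum_def by (intro sum_nonneg prod_nonneg) (auto simp: funpow_in)

text \<open>Two points of K with the same image at distance at most r must coincide, so each ball of
  a finite r/2-cover contains at most one point of a fibre.\<close>

lemma non_contracting_fibers:
  fixes \<alpha> :: "'a::metric_space \<Rightarrow> 'a"
  assumes "compact K" "non_contracting_on K \<alpha>"
  obtains N :: nat where "\<And>x. finite {y. y \<in> K \<and> \<alpha> y = x}" "\<And>x. card {y. y \<in> K \<and> \<alpha> y = x} \<le> N"
proof -
  obtain r where r: "r > 0" "\<And>x y. x \<in> K \<Longrightarrow> y \<in> K \<Longrightarrow> dist x y \<le> r \<Longrightarrow> dist x y \<le> dist (\<alpha> x) (\<alpha> y)"
    using assms(2) unfolding non_contracting_on_def by blast
  have "\<exists>C. finite C \<and> K \<subseteq> (\<Union>x\<in>C. ball x (r / 2))"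
    using assms(1) r(1) unfolding compact_eq_totally_bounded by (meson half_gt_zero)
  then obtain C where C: "finite C" "K \<subseteq> (\<Union>x\<in>C. ball x (r / 2))" by blast
  then have "\<forall>y\<in>K. \<exists>c. c \<in> C \<and> dist c y < r / 2" by (auto dest!: subsetD)
  from bchoice[OF this] obtain c where c: "\<And>y. y \<in> K \<Longrightarrow> c y \<in> C" "\<And>y. y \<in> K \<Longrightarrow> dist (c y) y < r / 2" by blast
  have inj: "inj_on c {y. y \<in> K \<and> \<alpha> y = x}" for x
  proof (rule inj_onI)
    fix y z assume yz: "y \<in> {y. y \<in> K \<and> \<alpha> y = x}" "z \<in> {y. y \<in> K \<and> \<alpha> y = x}" "c y = c z"
    then have "dist y z \<le> r"
      using c(2)[of y] c(2)[of z] dist_triangle3[of y z "c y"] by auto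
    then have "dist y z \<le> dist (\<alpha> y) (\<alpha> z)" using r(2) yz by blast
    then show "y = z" using yz by simp
  qed
  have sub: "c ` {y. y \<in> K \<and> \<alpha> y = x} \<subseteq> C" for x using c(1) by auto
  show ?thesis
  proof (rule that)
    show "finite {y. y \<in> K \<and> \<alpha> y = x}" for x using inj_on_finite[OF inj sub C(1)] .
    show "card {y. y \<in> K \<and> \<alpha> y = x} \<le> card C" for x using card_inj_on_le[OF inj sub C(1)] .
  qed
qed

section \<open>Reduction of the spectral radius to the essential points\<close>

lemma le_of_power_le:
  fixes x y C :: real
  assumes "0 \<le> x" "0 < y" and ev: "eventually (\<lambda>n. x ^ n \<le> C * y ^ n) sequentially"
  shows "x \<le> y"
proof (rule ccontr)
  assume "\<not> x \<le> y"
  then have x: "x > 0" "y / x < 1" using assms by auto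
  have "(\<lambda>n. C * (y / x) ^ n) \<longlonglongrightarrow> C * 0"
    using x assms(2) by (intro tendsto_mult tendsto_const LIMSEQ_power_zero) auto
  then have "eventually (\<lambda>n. C * (y / x) ^ n < 1) sequentially"
    by (rule order_tendstoD(2)) simp
  with ev have "eventually (\<lambda>n. False) sequentially"
  proof eventually_elim
    case (elim n)
    then show ?case using x by (simp add: power_divide divide_less_eq)
  qed
  then show False by simp
qed

locale transfer_dynamics =
  fixes \<alpha> :: "'a::metric_space \<Rightarrow> 'a" and A :: "('a \<Rightarrow>\<^sub>C real) \<Rightarrow> ('a \<Rightarrow>\<^sub>C real)"
  assumes compact_space: "compact (UNIV :: 'a set)"
    and cont: "continuous_on UNIV \<alpha>"
    and transfer: "transfer_operator \<alpha> A"
begin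

abbreviation "K \<equiv> essential_points \<alpha>"
abbreviation "\<nu> \<equiv> transfer_measure A"

lemma apply_Bcontfun: "continuous_on UNIV f \<Longrightarrow> apply_bcontfun (Bcontfun f) = f" for f :: "'a \<Rightarrow> real"
  by (rule apply_Bcontfun_compact[OF compact_space])

lemma linear_A: "linear A" and A_nonneg: "(\<And>y. 0 \<le> apply_bcontfun f y) \<Longrightarrow> 0 \<le> apply_bcontfun (A f) x"
  using transfer unfolding transfer_operator_def by auto

lemma A_homological:
  "A (Bcontfun (\<lambda>x. apply_bcontfun f (\<alpha> x) * apply_bcontfun h x)) = Bcontfun (\<lambda>x. apply_bcontfun f x * apply_bcontfun (A h) x)"
  using transfer unfolding transfer_operator_def by blast

lemma transfer_measure:
  "sets (\<nu> x) = sets borel" "finite_measure (\<nu> x)" "integral\<^sup>L (\<nu> x) (apply_bcontfun f) = apply_bcontfun (A f) x"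
proof -
  define P where "P \<nu>' \<longleftrightarrow> sets \<nu>' = sets borel \<and> finite_measure \<nu>' \<and>
    (\<forall>f. (\<integral>y. apply_bcontfun f y \<partial>\<nu>') = apply_bcontfun (A f) x)" for \<nu>'
  interpret L: positive_functional "\<lambda>f. apply_bcontfun (A (Bcontfun f)) x"
  proof
    fix f h :: "'a \<Rightarrow> real" assume c: "continuous_on UNIV f" "continuous_on UNIV h"
    have "Bcontfun (\<lambda>x. f x + h x) = Bcontfun f + Bcontfun h"
      by (rule bcontfun_eqI) (use c in \<open>simp add: apply_Bcontfun continuous_on_add\<close>)
    then show "apply_bcontfun (A (Bcontfun (\<lambda>x. f x + h x))) x = apply_bcontfun (A (Bcontfun f)) x + apply_bcontfun (A (Bcontfun h)) x"
      by (simp add: linear_add[OF linear_A])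
  next
    fix c and f :: "'a \<Rightarrow> real" assume cf: "continuous_on UNIV f"
    have "Bcontfun (\<lambda>x. c * f x) = c *\<^sub>R Bcontfun f"
      by (rule bcontfun_eqI) (use cf in \<open>simp add: apply_Bcontfun continuous_on_mult_left\<close>)
    then show "apply_bcontfun (A (Bcontfun (\<lambda>x. c * f x))) x = c * apply_bcontfun (A (Bcontfun f)) x"
      by (simp add: linear_scale[OF linear_A])
  next
    fix f :: "'a \<Rightarrow> real" assume "continuous_on UNIV f" "\<And>x. 0 \<le> f x"
    then show "0 \<le> apply_bcontfun (A (Bcontfun f)) x" by (intro A_nonneg) (simp add: apply_Bcontfun)
  qed (rule compact_space)
  have "P L.riesz"
    unfolding P_def using L.finite_measure_riesz L.integral_riesz[OF continuous_on_apply_bcontfun]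
    by (simp add: apply_bcontfun_inverse)
  moreover have "\<nu>' = L.riesz" if "P \<nu>'" for \<nu>'
  proof (rule finite_borel_measure_eqI)
    fix f :: "'a \<Rightarrow> real" assume c: "continuous_on UNIV f"
    have "integral\<^sup>L \<nu>' (apply_bcontfun (Bcontfun f)) = apply_bcontfun (A (Bcontfun f)) x"
      using that unfolding P_def by blast
    then show "integral\<^sup>L \<nu>' f = integral\<^sup>L L.riesz f" using c L.integral_riesz[OF c] by (simp add: apply_Bcontfun)
  qed (use that L.finite_measure_riesz in \<open>simp_all add: P_def\<close>)
  ultimately have "P (THE \<nu>'. P \<nu>')" by (rule theI)
  then have "P (\<nu> x)" unfolding transfer_measure_def P_def by simp
  then show "sets (\<nu> x) = sets borel" "finite_measure (\<nu> x)" "integral\<^sup>L (\<nu> x) (apply_bcontfun f) = apply_bcontfun (A f) x"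
    unfolding P_def by blast+
qed

lemma measurable_nu: "f \<in> borel_measurable borel \<Longrightarrow> f \<in> borel_measurable (\<nu> x)"
  by (simp add: measurable_cong_sets[OF transfer_measure(1) refl])

lemma integrable_nu:
  fixes f :: "'a \<Rightarrow> real"
  assumes "continuous_on UNIV f"
  shows "integrable (\<nu> x) f"
proof -
  interpret finite_measure "\<nu> x" by (rule transfer_measure)
  obtain B where B: "\<And>x. \<bar>f x\<bar> \<le> B"
    by (rule bounded_range_of_compact[OF compact_space assms]) (rule that)
  show ?thesis
    using B measurable_nu[OF borel_measurable_continuous_onI[OF assms]]
    by (intro integrable_const_bound[of _ B]) auto
qed

text \<open>The homological identity is tested with the distance to x: at the point x it makes the
  integral of dist(\<alpha>(y), x) equal to dist(x, x) times A 1, that is 0.\<close>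

lemma AE_preimage: "AE y in \<nu> x. \<alpha> y = x"
proof -
  have c: "continuous_on UNIV (\<lambda>y. dist y x)" by (intro continuous_intros)
  have c': "continuous_on UNIV (\<lambda>y. dist (\<alpha> y) x)" using cont by (intro continuous_intros)
  have "integral\<^sup>L (\<nu> x) (\<lambda>y. dist (\<alpha> y) x) = 0"
  proof -
    have "integral\<^sup>L (\<nu> x) (\<lambda>y. dist (\<alpha> y) x) = apply_bcontfun (A (Bcontfun (\<lambda>y. dist (\<alpha> y) x))) x"
      using transfer_measure(3)[of x "Bcontfun (\<lambda>y. dist (\<alpha> y) x)"] c' by (simp add: apply_Bcontfun)
    also have "A (Bcontfun (\<lambda>y. dist (\<alpha> y) x)) = Bcontfun (\<lambda>y. dist y x * apply_bcontfun (A (const_bcontfun 1)) y)"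
      using A_homological[of "Bcontfun (\<lambda>y. dist y x)" "const_bcontfun 1"] c by (simp add: apply_Bcontfun)
    also have "apply_bcontfun \<dots> = (\<lambda>y. dist y x * apply_bcontfun (A (const_bcontfun 1)) y)"
      using c by (intro apply_Bcontfun continuous_intros) auto
    finally show ?thesis by simp
  qed
  then have "AE y in \<nu> x. dist (\<alpha> y) x = 0"
    by (subst integral_nonneg_eq_0_iff_AE[OF integrable_nu[OF c'], symmetric]) auto
  then show ?thesis by simp
qed

abbreviation "wop \<equiv> weighted_operator A"

lemma wop_apply: "apply_bcontfun (wop h f) x = (\<integral>y. apply_bcontfun h y * apply_bcontfun f y \<partial>\<nu> x)"
proof -
  have c: "continuous_on UNIV (\<lambda>y. apply_bcontfun h y * apply_bcontfun f y)" by (intro continuous_intros) auto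
  show ?thesis
    unfolding weighted_operator_def using transfer_measure(3)[of x "Bcontfun (\<lambda>y. apply_bcontfun h y * apply_bcontfun f y)"] c
    by (simp add: apply_Bcontfun)
qed

lemma integrable_wop: "integrable (\<nu> x) (\<lambda>y. apply_bcontfun h y * apply_bcontfun f y)" for h f :: "'a \<Rightarrow>\<^sub>C real"
  by (intro integrable_nu continuous_intros) auto

lemma positive_operator_wop:
  assumes "\<And>x. 0 \<le> apply_bcontfun h x"
  shows "positive_operator (wop h)"
proof
  show "wop h (f + k) = wop h f + wop h k" for f k
    by (rule bcontfun_eqI) (simp add: wop_apply distrib_left Bochner_Integration.integral_add[OF integrable_wop integrable_wop])
  show "wop h (c *\<^sub>R f) = c *\<^sub>R wop h f" for c f
    by (rule bcontfun_eqI) (simp add: wop_apply mult.left_commute[of _ c])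
  show "0 \<le> apply_bcontfun (wop h f) x" if "\<And>y. 0 \<le> apply_bcontfun f y" for f x
    unfolding wop_apply using that assms by (intro Bochner_Integration.integral_nonneg mult_nonneg_nonneg)
qed

text \<open>Each application of the operator strips one composition with \<alpha>, because the
  measure at x lives on the fibre over x. Here u is an arbitrary function; measurability is
  inherited from the continuous function h.\<close>

lemma wop_power_homological:
  assumes "\<And>x. apply_bcontfun h x = u ((\<alpha> ^^ n) x) * apply_bcontfun f x"
  shows "apply_bcontfun ((wop k ^^ n) h) x = u x * apply_bcontfun ((wop k ^^ n) f) x"
  using assms
proof (induction n arbitrary: u x)
  case (Suc n)
  have "apply_bcontfun ((wop k ^^ n) h) y = u (\<alpha> y) * apply_bcontfun ((wop k ^^ n) f) y" for y
    using Suc.IH[of "\<lambda>y. u (\<alpha> y)" y] Suc.prems by simp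
  then have "apply_bcontfun ((wop k ^^ Suc n) h) x =
      (\<integral>y. apply_bcontfun k y * (u (\<alpha> y) * apply_bcontfun ((wop k ^^ n) f) y) \<partial>\<nu> x)"
    by (simp add: wop_apply)
  also have "\<dots> = (\<integral>y. u x * (apply_bcontfun k y * apply_bcontfun ((wop k ^^ n) f) y) \<partial>\<nu> x)"
  proof -
    have m: "(\<lambda>y. u x * (apply_bcontfun k y * apply_bcontfun ((wop k ^^ n) f) y)) \<in> borel_measurable (\<nu> x)"
      by (intro borel_measurable_times borel_measurable_const measurable_nu borel_measurable_continuous_onI) auto
    have ae: "AE y in \<nu> x. apply_bcontfun k y * (u (\<alpha> y) * apply_bcontfun ((wop k ^^ n) f) y) =
        u x * (apply_bcontfun k y * apply_bcontfun ((wop k ^^ n) f) y)"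
      using AE_preimage[of x] by eventually_elim simp
    have eq: "(\<lambda>y. apply_bcontfun k y * (u (\<alpha> y) * apply_bcontfun ((wop k ^^ n) f) y)) =
       (\<lambda>y. apply_bcontfun k y * apply_bcontfun ((wop k ^^ n) h) y)"
      using \<open>\<And>y. apply_bcontfun ((wop k ^^ n) h) y = _\<close> by auto
    have m': "(\<lambda>y. apply_bcontfun k y * (u (\<alpha> y) * apply_bcontfun ((wop k ^^ n) f) y)) \<in> borel_measurable (\<nu> x)"
      unfolding eq by (intro borel_measurable_times measurable_nu borel_measurable_continuous_onI) auto
    show ?thesis by (rule integral_cong_AE[OF m' m ae])
  qed
  also have "\<dots> = u x * apply_bcontfun ((wop k ^^ Suc n) f) x" by (simp add: wop_apply)
  finally show ?case .
qed simp

lemma wop_power_mono: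
  assumes "\<And>x. 0 \<le> apply_bcontfun h x" "\<And>x. apply_bcontfun h x \<le> apply_bcontfun k x"
  shows "apply_bcontfun ((wop h ^^ n) (const_bcontfun 1)) x \<le> apply_bcontfun ((wop k ^^ n) (const_bcontfun 1)) x"
proof (induction n arbitrary: x)
  case (Suc n)
  have k: "0 \<le> apply_bcontfun k x" for x using assms order_trans by blast
  show ?case
    unfolding funpow.simps o_apply wop_apply
  proof (intro integral_mono integrable_wop mult_mono assms Suc k)
    show "0 \<le> apply_bcontfun ((wop h ^^ n) (const_bcontfun 1)) y" for y
      by (rule positive_operator.pow_one_nonneg[OF positive_operator_wop[OF assms(1)]])
  qed
qed simp

end

section \<open>Damping the weight away from the essential points\<close>

locale weighted_transfer = transfer_dynamics +
  fixes g :: "'a::metric_space \<Rightarrow>\<^sub>C real" and \<psi> :: "'a \<Rightarrow> real"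
  assumes g_nonneg: "\<And>x. 0 \<le> apply_bcontfun g x"
    and \<psi>: "continuous_on UNIV \<psi>" "\<And>x. 0 \<le> \<psi> x" "\<And>x. \<psi> x > 0 \<longleftrightarrow> x \<notin> essential_points \<alpha>"
    and fin: "\<And>x. finite {y. y \<in> essential_points \<alpha> \<and> \<alpha> y = x}"
begin

definition damped :: "nat \<Rightarrow> 'a \<Rightarrow>\<^sub>C real" where
  "damped t = Bcontfun (\<lambda>x. apply_bcontfun g x * exp (- (real t * \<psi> x)))"

lemma damped_apply: "apply_bcontfun (damped t) x = apply_bcontfun g x * exp (- (real t * \<psi> x))"
proof -
  have "continuous_on UNIV (\<lambda>x. apply_bcontfun g x * exp (- (real t * \<psi> x)))"
    using \<psi>(1) by (intro continuous_intros) auto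
  then show ?thesis by (simp add: damped_def apply_Bcontfun)
qed

lemma damped_nonneg: "0 \<le> apply_bcontfun (damped t) x"
  by (simp add: damped_apply g_nonneg)

lemma damped_le: "s \<le> t \<Longrightarrow> apply_bcontfun (damped t) x \<le> apply_bcontfun (damped s) x"
  unfolding damped_apply using \<psi>(2) by (intro mult_left_mono g_nonneg) (simp add: mult_right_mono)

lemma damped_le_g: "apply_bcontfun (damped t) x \<le> apply_bcontfun g x"
  using damped_le[of 0 t x] by (simp add: damped_apply)

sublocale Bg: positive_operator "wop g" by (rule positive_operator_wop[OF g_nonneg])
sublocale Bt: positive_operator "wop (damped t)" for t by (rule positive_operator_wop[OF damped_nonneg])

text \<open>Damping at each of n steps amounts to damping once by the Birkhoff sum of \<psi>. In the
  induction the term \<psi>(\<alpha>^n(x)) passes through the power by the homological identity and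
  becomes the damping of the outermost step.\<close>

lemma damped_power:
  assumes "\<And>x. apply_bcontfun h x = exp (- (real t * (\<Sum>i<n. \<psi> ((\<alpha> ^^ i) x)))) * apply_bcontfun f x"
  shows "apply_bcontfun ((wop (damped t) ^^ n) f) x = apply_bcontfun ((wop g ^^ n) h) x"
  using assms
proof (induction n arbitrary: h x)
  case 0
  then have "h = f" by (intro bcontfun_eqI) simp
  then show ?case by simp
next
  case (Suc n)
  define h' where "h' = Bcontfun (\<lambda>x. exp (- (real t * (\<Sum>i<n. \<psi> ((\<alpha> ^^ i) x)))) * apply_bcontfun f x)"
  have "continuous_on UNIV (\<lambda>x. exp (- (real t * (\<Sum>i<n. \<psi> ((\<alpha> ^^ i) x)))) * apply_bcontfun f x)"
    by (intro continuous_intros continuous_on_compose_funpow cont \<psi>) auto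
  then have h': "apply_bcontfun h' x = exp (- (real t * (\<Sum>i<n. \<psi> ((\<alpha> ^^ i) x)))) * apply_bcontfun f x" for x
    by (simp add: h'_def apply_Bcontfun)
  have "apply_bcontfun h x = exp (- (real t * \<psi> ((\<alpha> ^^ n) x))) * apply_bcontfun h' x" for x
    unfolding Suc.prems h' by (simp add: exp_add[symmetric] algebra_simps flip: mult.assoc)
  then have hn: "apply_bcontfun ((wop g ^^ n) h) y = exp (- (real t * \<psi> y)) * apply_bcontfun ((wop g ^^ n) h') y" for y
    by (rule wop_power_homological)
  show ?case
    unfolding funpow.simps o_apply wop_apply hn Suc.IH[OF h'] damped_apply by (simp add: mult.assoc)
qed

lemma growth_le_damped:
  assumes "\<And>x. (\<Sum>i<n. \<psi> ((\<alpha> ^^ i) x)) \<le> c"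
  shows "Bg.growth n \<le> exp (real t * c) * Bt.growth t n"
  unfolding Bg.growth_def
proof (rule norm_bound)
  fix x
  define h where "h = Bcontfun (\<lambda>x. exp (- (real t * (\<Sum>i<n. \<psi> ((\<alpha> ^^ i) x)))))"
  have "continuous_on UNIV (\<lambda>x. exp (- (real t * (\<Sum>i<n. \<psi> ((\<alpha> ^^ i) x)))))"
    by (intro continuous_intros continuous_on_compose_funpow cont \<psi>)
  then have h: "apply_bcontfun h x = exp (- (real t * (\<Sum>i<n. \<psi> ((\<alpha> ^^ i) x))))" for x
    by (simp add: h_def apply_Bcontfun)
  have "apply_bcontfun ((wop g ^^ n) (exp (- (real t * c)) *\<^sub>R const_bcontfun 1)) x \<le> apply_bcontfun ((wop g ^^ n) h) x"
    using assms by (intro Bg.mono_pow) (simp add: h mult_left_mono)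
  also have "\<dots> = apply_bcontfun ((wop (damped t) ^^ n) (const_bcontfun 1)) x"
    by (rule damped_power[symmetric]) (simp add: h)
  also have "\<dots> \<le> Bt.growth t n" by (rule Bt.pow_one_le_growth)
  finally have "exp (- (real t * c)) * apply_bcontfun ((wop g ^^ n) (const_bcontfun 1)) x \<le> Bt.growth t n"
    by (simp add: linear_scale[OF Bg.linear_pow])
  then have "exp (real t * c) * (exp (- (real t * c)) * apply_bcontfun ((wop g ^^ n) (const_bcontfun 1)) x)
     \<le> exp (real t * c) * Bt.growth t n"
    by (intro mult_left_mono) auto
  then have "apply_bcontfun ((wop g ^^ n) (const_bcontfun 1)) x \<le> exp (real t * c) * Bt.growth t n"
    by (simp add: mult.assoc[symmetric] exp_add[symmetric])
  then show "norm (apply_bcontfun ((wop g ^^ n) (const_bcontfun 1)) x) \<le> exp (real t * c) * Bt.growth t n"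
    using Bg.pow_one_nonneg[of n x] by simp
qed

text \<open>Orbits spend asymptotically all their time near the essential points, hence damping the
  weight away from them does not change the spectral radius.\<close>

lemma radius_le_damped: "Bg.radius \<le> Bt.radius t"
proof (rule field_le_epsilon)
  fix d :: real assume d: "d > 0"
  define q where "q = Bt.radius t + d / 2"
  have q: "Bt.radius t < q" "q > 0" using d Bt.radius_nonneg[of t] by (auto simp: q_def)
  \<comment> \<open>Since t is fixed, the loss exp(t e) per step can be brought as close to 1 as
    desired by shrinking e.\<close>
  have "((\<lambda>e. exp (real t * e) * q) \<longlongrightarrow> exp (real t * 0) * q) (at_right 0)"
    by (intro tendsto_intros)
  then have "eventually (\<lambda>e. exp (real t * e) * q < q + d / 2) (at_right 0)"
    by (rule order_tendstoD(2)) (use d in simp)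
  then have "eventually (\<lambda>e. exp (real t * e) * q < q + d / 2 \<and> e > 0) (at_right 0)"
    using eventually_at_right_less[of "0::real"] by (rule eventually_conj)
  then obtain e where e: "exp (real t * e) * q < q + d / 2" "e > 0"
    using eventually_happens'[OF trivial_limit_at_right_real] by blast
  obtain C where C: "C > 0" "\<And>n. Bt.growth t n \<le> C * q ^ n"
    by (rule Bt.growth_le_power[OF q(1)]) (rule that)
  have "eventually (\<lambda>n. \<forall>x. (\<Sum>i<n. \<psi> ((\<alpha> ^^ i) x)) \<le> e * real n) sequentially"
    using \<psi>(2,3) by (intro ergodic_sums_vanishing_on_essential compact_space cont \<psi>(1) e(2)) (metis less_le)
  then have "eventually (\<lambda>n. Bg.radius ^ n \<le> C * (exp (real t * e) * q) ^ n) sequentially"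
  proof (rule eventually_mono)
    fix n assume n: "\<forall>x. (\<Sum>i<n. \<psi> ((\<alpha> ^^ i) x)) \<le> e * real n"
    have "Bg.radius ^ n \<le> Bg.growth n" by (rule Bg.radius_power_le)
    also have "\<dots> \<le> exp (real t * (e * real n)) * Bt.growth t n" by (rule growth_le_damped) (use n in blast)
    also have "\<dots> \<le> exp (real t * (e * real n)) * (C * q ^ n)" by (intro mult_left_mono C) simp
    also have "\<dots> = C * (exp (real t * e) * q) ^ n"
      by (simp add: power_mult_distrib exp_of_nat_mult[symmetric] mult_ac)
    finally show "Bg.radius ^ n \<le> C * (exp (real t * e) * q) ^ n" .
  qed
  then have "Bg.radius \<le> exp (real t * e) * q"
    using q by (intro le_of_power_le[OF Bg.radius_nonneg]) auto
  then show "Bg.radius \<le> Bt.radius t + d" using e(1) by (simp add: q_def)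
qed

definition w :: "'a \<Rightarrow> real" where
  "w y = apply_bcontfun g y * cocycle \<alpha> A y"

text \<open>Dominated convergence, one operator application at a time: the damped weight tends to g
  on K and to 0 off K, so on a fibre only its finitely many points in K survive, each with its atom,
  the cocycle. Zero iterates apply no damping, which explains the condition: there the left side is
  1 even off K.\<close>

lemma damped_power_tendsto:
  assumes "x \<in> K \<or> n > 0"
  shows "(\<lambda>t. apply_bcontfun ((wop (damped t) ^^ n) (const_bcontfun 1)) x) \<longlonglongrightarrow> preimage_sum K \<alpha> w n x"
  using assms
proof (induction n arbitrary: x)
  case 0
  then have "{y. y \<in> K \<and> y = x} = {x}" by auto
  then show ?case by (simp add: preimage_sum_def)
next
  case (Suc n)
  let ?D = "\<lambda>t y. apply_bcontfun ((wop (damped t) ^^ n) (const_bcontfun 1)) y"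
  let ?S = "{u. u \<in> K \<and> \<alpha> u = x}"
  let ?Z = "preimage_sum K \<alpha> w n"
  have K: "\<And>y. y \<in> K \<Longrightarrow> \<alpha> y \<in> K" by (rule essential_points_forward[OF cont])
  \<comment> \<open>The pointwise limit of the integrands on the fibre over x, written as a finite
    sum of indicators so that its integral reads off the atoms.\<close>
  define F where "F y = (\<Sum>u\<in>?S. indicator {u} y * (apply_bcontfun g u * ?Z u))" for y
  interpret finite_measure "\<nu> x" by (rule transfer_measure)
  have D_le: "?D t y \<le> Bg.growth n" for t y
    using wop_power_mono[OF damped_nonneg damped_le_g, of n t y] Bg.pow_one_le_growth[of n y] by (rule order_trans)
  have D_nonneg: "0 \<le> ?D t y" for t y by (rule Bt.pow_one_nonneg)
  obtain Mg where Mg: "\<And>y. \<bar>apply_bcontfun g y\<bar> \<le> Mg"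
    by (rule bounded_range_of_compact[OF compact_space continuous_on_apply_bcontfun[of UNIV g]]) (rule that)
  have "(\<lambda>t. integral\<^sup>L (\<nu> x) (\<lambda>y. apply_bcontfun (damped t) y * ?D t y)) \<longlonglongrightarrow> integral\<^sup>L (\<nu> x) F"
  proof (rule integral_dominated_convergence[where w="\<lambda>_. Mg * Bg.growth n"])
    show "F \<in> borel_measurable (\<nu> x)"
      unfolding F_def
      by (intro borel_measurable_sum borel_measurable_times borel_measurable_const measurable_nu borel_measurable_indicator) auto
    show "(\<lambda>y. apply_bcontfun (damped t) y * ?D t y) \<in> borel_measurable (\<nu> x)" for t
      by (intro borel_measurable_times measurable_nu borel_measurable_continuous_onI) auto
    show "AE y in \<nu> x. (\<lambda>t. apply_bcontfun (damped t) y * ?D t y) \<longlonglongrightarrow> F y"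
      using AE_preimage[of x]
    proof eventually_elim
      case (elim y)
      show ?case
      proof (cases "y \<in> K")
        case True
        then have y: "y \<in> ?S" using elim by auto
        have "F y = (\<Sum>u\<in>?S. if u = y then apply_bcontfun g u * ?Z u else 0)"
          unfolding F_def by (intro sum.cong) (auto simp: indicator_def)
        also have "\<dots> = apply_bcontfun g y * ?Z y" using y fin by simp
        finally have F: "F y = apply_bcontfun g y * ?Z y" .
        have "\<psi> y = 0" using \<psi>(2,3)[of y] True by (simp add: less_le)
        then show ?thesis unfolding F damped_apply using Suc.IH[of y] True by (intro tendsto_intros) auto
      next
        case False
        then have F: "F y = 0" unfolding F_def by (intro sum.neutral) (auto simp: indicator_def)
        have p: "\<psi> y > 0" using \<psi>(3) False by blast
        have "(\<lambda>t. Mg * Bg.growth n * exp (- \<psi> y) ^ t) \<longlonglongrightarrow> Mg * Bg.growth n * 0"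
          using p by (intro tendsto_mult tendsto_const LIMSEQ_power_zero) simp
        then have lim0: "(\<lambda>t. Mg * Bg.growth n * exp (- \<psi> y) ^ t) \<longlonglongrightarrow> 0" by simp
        show ?thesis unfolding F
        proof (rule Lim_null_comparison[OF always_eventually lim0], rule allI)
          fix t :: nat
          have "norm (apply_bcontfun (damped t) y * ?D t y) = apply_bcontfun g y * ?D t y * exp (- (real t * \<psi> y))"
            using g_nonneg[of y] D_nonneg[of t y] by (simp add: damped_apply abs_mult)
          also have "\<dots> \<le> Mg * Bg.growth n * exp (- (real t * \<psi> y))"
            using Mg[of y] g_nonneg[of y] D_nonneg[of t y] D_le[of t y] by (intro mult_right_mono mult_mono) auto
          also have "exp (- (real t * \<psi> y)) = exp (- \<psi> y) ^ t" by (simp add: exp_of_nat_mult[symmetric])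
          finally show "norm (apply_bcontfun (damped t) y * ?D t y) \<le> Mg * Bg.growth n * exp (- \<psi> y) ^ t" .
        qed
      qed
    qed
    show "AE y in \<nu> x. norm (apply_bcontfun (damped t) y * ?D t y) \<le> Mg * Bg.growth n" for t
    proof (rule AE_I2)
      fix y
      have "apply_bcontfun (damped t) y \<le> Mg" using damped_le_g[of t y] Mg[of y] by simp
      then show "norm (apply_bcontfun (damped t) y * ?D t y) \<le> Mg * Bg.growth n"
        using damped_nonneg[of t y] D_nonneg[of t y] D_le[of t y] by (auto simp: abs_mult intro!: mult_mono)
    qed
  qed simp
  moreover have "integral\<^sup>L (\<nu> x) F = preimage_sum K \<alpha> w (Suc n) x"
  proof -
    have su: "{u} \<in> sets (\<nu> x)" for u by (simp add: transfer_measure(1))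
    have "integral\<^sup>L (\<nu> x) F = (\<Sum>u\<in>?S. \<integral>y. indicator {u} y * (apply_bcontfun g u * ?Z u) \<partial>\<nu> x)"
      unfolding F_def
      by (intro Bochner_Integration.integral_sum integrable_mult_left integrable_real_indicator su) (simp add: emeasure_eq_measure)
    also have "\<dots> = (\<Sum>u\<in>?S. measure (\<nu> x) {u} * (apply_bcontfun g u * ?Z u))"
      using su by simp
    also have "\<dots> = (\<Sum>u\<in>?S. w u * ?Z u)"
      by (intro sum.cong) (auto simp: w_def cocycle_def)
    also have "\<dots> = preimage_sum K \<alpha> w (Suc n) x" by (rule preimage_sum_Suc[OF fin K, symmetric])
    finally show ?thesis .
  qed
  ultimately show ?case by (simp add: wop_apply)
qed

lemma preimage_sum_le_growth: "preimage_sum K \<alpha> w n x \<le> Bg.growth n"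
proof (cases "x \<in> K \<or> n > 0")
  case True
  show ?thesis
  proof (rule LIMSEQ_le_const2[OF damped_power_tendsto[OF True]], intro exI allI impI)
    fix t
    show "apply_bcontfun ((wop (damped t) ^^ n) (const_bcontfun 1)) x \<le> Bg.growth n"
      using wop_power_mono[OF damped_nonneg damped_le_g, of n t x] Bg.pow_one_le_growth[of n x] by (rule order_trans)
  qed
next
  case False
  then have "{y. y \<in> K \<and> (\<alpha> ^^ n) y = x} = {}" by auto
  then show ?thesis using Bg.growth_nonneg[of n] unfolding preimage_sum_def by (simp only: sum.empty)
qed

text \<open>The Dini step. The closed sets C t, where the damped n-th iterate is still at least c,
  decrease in t and have empty intersection; compactness makes one of them empty, so some damped
  operator has n-th growth at most c.\<close>

lemma radius_le_preimage_sum: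
  assumes n: "n \<ge> 1" and c: "\<And>x. preimage_sum K \<alpha> w n x < c"
  shows "Bg.radius \<le> root n c"
proof -
  define C where "C t = {x. c \<le> apply_bcontfun ((wop (damped t) ^^ n) (const_bcontfun 1)) x}" for t
  have oC: "open (- C t)" for t
    unfolding C_def closed_def[symmetric] by (intro closed_Collect_le continuous_intros) auto
  have mC: "C t \<subseteq> C s" if "s \<le> t" for s t
    unfolding C_def using wop_power_mono[OF damped_nonneg damped_le[OF that], of n] by (auto intro: order_trans)
  have "\<exists>t. x \<notin> C t" for x
  proof (rule ccontr)
    assume "\<not> ?thesis"
    then have x: "\<And>t. x \<in> C t" by auto
    have "c \<le> preimage_sum K \<alpha> w n x"
      by (rule LIMSEQ_le_const[OF damped_power_tendsto]) (use n x in \<open>auto simp: C_def\<close>)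
    then show False using c[of x] by simp
  qed
  then have "UNIV \<subseteq> (\<Union>t. - C t)" by auto
  then obtain J where J: "finite J" "UNIV \<subseteq> (\<Union>t\<in>J. - C t)"
    using compactE_image[OF compact_space, of UNIV "\<lambda>t. - C t"] oC by auto
  obtain t where "J \<subseteq> {..t}" using finite_nat_iff_bounded_le J(1) by auto
  have "\<exists>t. C t = {}"
  proof (intro exI equals0I)
    fix x assume x: "x \<in> C t"
    obtain s where "s \<in> J" "x \<notin> C s" using J(2) by auto
    then show False using mC[of s t] \<open>J \<subseteq> {..t}\<close> x by auto
  qed
  then obtain t where t: "C t = {}" by blast
  have "Bt.growth t n \<le> c"
    unfolding Bt.growth_def
  proof (rule norm_bound)
    fix x
    have "x \<notin> C t" using t by simp
    then show "norm (apply_bcontfun ((wop (damped t) ^^ n) (const_bcontfun 1)) x) \<le> c"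
      using Bt.pow_one_nonneg[of n t x] by (simp add: C_def)
  qed
  then have "root n (Bt.growth t n) \<le> root n c" using n by simp
  then show ?thesis using radius_le_damped[of t] Bt.radius_le[OF n, of t] by linarith
qed

end

section \<open>Entropy of finite-valued maps\<close>

text \<open>Carries the sign of entropy. At t = 0 the factor t makes the value 0, the usual
  convention.\<close>

definition xlogx :: "real \<Rightarrow> real" where
  "xlogx t = - (t * ln t)"

text \<open>The bound ln s \<le> s - 1 at s = q/p, multiplied by p. Only the totals are compared, so
  neither family has to be normalized; concavity, subadditivity, the cardinality bound and the
  pressure estimate are all instances.\<close>

lemma gibbs:
  assumes "finite I" and p: "\<And>i. i \<in> I \<Longrightarrow> 0 \<le> p i" and q: "\<And>i. i \<in> I \<Longrightarrow> 0 \<le> q i"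
    and pq: "\<And>i. i \<in> I \<Longrightarrow> 0 < p i \<Longrightarrow> 0 < q i" and s: "(\<Sum>i\<in>I. q i) \<le> (\<Sum>i\<in>I. p i)"
  shows "(\<Sum>i\<in>I. xlogx (p i)) \<le> (\<Sum>i\<in>I. - (p i * ln (q i)))"
proof -
  have "xlogx (p i) \<le> - (p i * ln (q i)) + (q i - p i)" if i: "i \<in> I" for i
  proof (cases "p i = 0")
    case True
    then show ?thesis using q[OF i] by (simp add: xlogx_def)
  next
    case False
    then have pos: "p i > 0" "q i > 0" using p[OF i] pq[OF i] by auto
    have "p i * ln (q i / p i) \<le> p i * (q i / p i - 1)"
      using pos by (intro mult_left_mono ln_le_minus_one) auto
    moreover have "p i * ln (q i / p i) = p i * ln (q i) - p i * ln (p i)"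
      using pos by (simp add: ln_div algebra_simps)
    moreover have "p i * (q i / p i - 1) = q i - p i" using pos by (simp add: field_simps)
    ultimately show ?thesis by (simp add: xlogx_def)
  qed
  then have "(\<Sum>i\<in>I. xlogx (p i)) \<le> (\<Sum>i\<in>I. - (p i * ln (q i)) + (q i - p i))" by (rule sum_mono)
  also have "\<dots> = (\<Sum>i\<in>I. - (p i * ln (q i))) + ((\<Sum>i\<in>I. q i) - (\<Sum>i\<in>I. p i))"
    by (simp add: sum.distrib sum_subtractf sum_negf)
  finally show ?thesis using s by simp
qed

lemma xlogx_concave:
  assumes n: "n > 0" and t: "\<And>i. i < n \<Longrightarrow> 0 \<le> t i"
  shows "(\<Sum>i<n. xlogx (t i)) \<le> real n * xlogx ((\<Sum>i<n. t i) / real n)"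
proof (cases "(\<Sum>i<n. t i) = 0")
  case True
  then have "\<forall>i\<in>{..<n}. t i = 0" using t by (subst (asm) sum_nonneg_eq_0_iff) auto
  then show ?thesis by (simp add: xlogx_def)
next
  case False
  define a where "a = (\<Sum>i<n. t i) / real n"
  have "(\<Sum>i<n. t i) > 0" using False t by (metis lessThan_iff less_le sum_nonneg)
  then have a: "a > 0" using n by (simp add: a_def)
  have na: "(\<Sum>i<n. t i) = real n * a" using n by (simp add: a_def)
  have "(\<Sum>i<n. xlogx (t i)) \<le> (\<Sum>i<n. - (t i * ln a))"
    using t a na by (intro gibbs) auto
  also have "\<dots> = - ((\<Sum>i<n. t i) * ln a)" by (simp add: sum_negf sum_distrib_right)
  also have "\<dots> = real n * xlogx a" unfolding na by (simp add: xlogx_def)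
  finally show ?thesis by (simp add: a_def)
qed

lemma continuous_on_xlogx: "continuous_on {0..} xlogx"
  unfolding continuous_on_def
proof
  fix t :: real assume t: "t \<in> {0..}"
  show "(xlogx \<longlongrightarrow> xlogx t) (at t within {0..})"
  proof (cases "t = 0")
    case True
    have "((\<lambda>x::real. - (x * ln x)) \<longlongrightarrow> 0) (at_right 0)" by real_asymp
    then show ?thesis using True by (simp add: at_within_Ici_at_right xlogx_def[abs_def])
  next
    case False
    then have "isCont xlogx t" unfolding xlogx_def by (intro continuous_intros) auto
    then show ?thesis by (simp add: isCont_def Lim_at_imp_Lim_at_within)
  qed
qed

text \<open>Partitions are handled as finite-valued functions: joins become pairs, dynamical
  refinements become lists of labels, and empty cells cause no trouble.\<close>

definition finite_label :: "'a measure \<Rightarrow> ('a \<Rightarrow> 'l) \<Rightarrow> bool" where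
  "finite_label M X \<longleftrightarrow> finite (range X) \<and> (\<forall>l. X -` {l} \<in> sets M)"

definition label_entropy :: "'a measure \<Rightarrow> ('a \<Rightarrow> 'l) \<Rightarrow> real" where
  "label_entropy M X = (\<Sum>l\<in>range X. xlogx (measure M (X -` {l})))"

lemma finite_labelD:
  assumes "finite_label M X"
  shows "finite (range X)" "X -` {l} \<in> sets M"
  using assms by (auto simp: finite_label_def)

lemma label_entropy_superset:
  assumes "finite S" "range X \<subseteq> S"
  shows "label_entropy M X = (\<Sum>l\<in>S. xlogx (measure M (X -` {l})))"
  unfolding label_entropy_def
proof (rule sum.mono_neutral_left[OF assms], rule ballI)
  fix l assume "l \<in> S - range X"
  then have "X -` {l} = {}" by auto
  then show "xlogx (measure M (X -` {l})) = 0" by (simp add: xlogx_def)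
qed

lemma finite_label_compose:
  assumes "finite_label M X"
  shows "finite_label M (\<lambda>x. f (X x))"
proof -
  have "(\<lambda>x. f (X x)) -` {l} = (\<Union>k\<in>{k\<in>range X. f k = l}. X -` {k})" for l by auto
  moreover have "range (\<lambda>x. f (X x)) = f ` range X" by auto
  ultimately show ?thesis
    using finite_labelD[OF assms] by (auto simp: finite_label_def intro!: sets.finite_UN)
qed

lemma finite_label_Pair:
  assumes "finite_label M X" "finite_label M Y"
  shows "finite_label M (\<lambda>x. (X x, Y x))"
  unfolding finite_label_def
proof (intro conjI allI)
  show "finite (range (\<lambda>x. (X x, Y x)))"
    by (rule finite_subset[of _ "range X \<times> range Y"]) (use assms in \<open>auto simp: finite_label_def\<close>)
  fix l
  have "(\<lambda>x. (X x, Y x)) -` {l} = X -` {fst l} \<inter> Y -` {snd l}" by (cases l) auto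
  then show "(\<lambda>x. (X x, Y x)) -` {l} \<in> sets M" using finite_labelD[OF assms(1)] finite_labelD[OF assms(2)] by auto
qed

lemma finite_label_map:
  assumes "\<And>j. j \<in> set js \<Longrightarrow> finite_label M (Y j)" and "space M = UNIV"
  shows "finite_label M (\<lambda>x. map (\<lambda>j. Y j x) js)"
  using assms
proof (induction js)
  case Nil
  have "UNIV \<in> sets M" using sets.top[of M] Nil by simp
  moreover have "(\<lambda>x. []) -` {l} = (if l = [] then UNIV else {})" for l :: "'c list" by auto
  ultimately show ?case by (auto simp: finite_label_def)
next
  case (Cons j js)
  then have "finite_label M (\<lambda>x. (Y j x, map (\<lambda>j. Y j x) js))" by (intro finite_label_Pair) auto
  from finite_label_compose[OF this, of "\<lambda>(a, b). a # b"] show ?case by simp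
qed

text \<open>Fibres of labels are taken in the whole type, so the space must be \<open>UNIV\<close>.
  Both invariant Borel measures and measures of type \<open>pmf\<close> satisfy this.\<close>

locale full_prob_space = prob_space M for M :: "'a measure" +
  assumes space_UNIV: "space M = UNIV"
begin

lemma measure_split:
  assumes X: "finite_label M X" and B: "B \<in> sets M"
  shows "(\<Sum>l\<in>range X. measure M (B \<inter> X -` {l})) = measure M B"
proof -
  have "measure M (\<Union>l\<in>range X. B \<inter> X -` {l}) = (\<Sum>l\<in>range X. measure M (B \<inter> X -` {l}))"
    using finite_labelD[OF X] B by (intro finite_measure_finite_Union) (auto simp: disjoint_family_on_def)
  moreover have "(\<Union>l\<in>range X. B \<inter> X -` {l}) = B" by auto
  ultimately show ?thesis by simp
qed

lemma measure_label_sum: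
  assumes "finite_label M X"
  shows "(\<Sum>l\<in>range X. measure M (X -` {l})) = 1"
  using measure_split[OF assms, of UNIV] prob_space sets.top[of M] by (simp add: space_UNIV)

lemma label_entropy_nonneg: "0 \<le> label_entropy M X"
  unfolding label_entropy_def
proof (rule sum_nonneg)
  fix l
  show "0 \<le> xlogx (measure M (X -` {l}))"
    using prob_le_1[of "X -` {l}"] measure_nonneg[of M "X -` {l}"]
    by (cases "measure M (X -` {l}) = 0") (auto simp: xlogx_def mult_le_0_iff ln_le_zero_iff less_le)
qed

text \<open>Each cell of the finer label Y lies in a cell of X of at least the same mass, and the
  logarithm is monotone.\<close>

lemma label_entropy_mono:
  assumes Y: "finite_label M Y" and XY: "\<And>x y. Y x = Y y \<Longrightarrow> X x = X y"
  shows "finite_label M X" "label_entropy M X \<le> label_entropy M Y"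
proof -
  define f where "f l = X (SOME x. Y x = l)" for l
  have f: "X x = f (Y x)" for x unfolding f_def by (rule XY, rule sym, rule someI[of _ x]) simp
  then have Xf: "X = (\<lambda>x. f (Y x))" by auto
  show X: "finite_label M X" unfolding Xf by (rule finite_label_compose[OF Y])
  let ?p = "\<lambda>l. measure M (X -` {l})" and ?q = "\<lambda>m. measure M (Y -` {m})"
  have "label_entropy M X = (\<Sum>l\<in>range X. \<Sum>m\<in>range Y. - (measure M (X -` {l} \<inter> Y -` {m}) * ln (?p l)))"
    unfolding label_entropy_def xlogx_def
    by (simp add: sum_negf sum_distrib_right[symmetric] measure_split[OF Y finite_labelD(2)[OF X]])
  also have "\<dots> = (\<Sum>m\<in>range Y. \<Sum>l\<in>range X. - (measure M (X -` {l} \<inter> Y -` {m}) * ln (?p l)))"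
    by (rule sum.swap)
  also have "\<dots> = (\<Sum>m\<in>range Y. - (?q m * ln (?p (f m))))"
  proof (intro sum.cong refl)
    fix m assume m: "m \<in> range Y"
    have e: "X -` {l} \<inter> Y -` {m} = (if l = f m then Y -` {m} else {})" for l using f by auto
    have "f m \<in> range X" using m f by (metis rangeE rangeI)
    then show "(\<Sum>l\<in>range X. - (measure M (X -` {l} \<inter> Y -` {m}) * ln (?p l))) = - (?q m * ln (?p (f m)))"
      unfolding e using finite_labelD(1)[OF X]
      by (subst sum.remove[of _ "f m"]) (auto intro!: sum.neutral)
  qed
  also have "\<dots> \<le> label_entropy M Y"
    unfolding label_entropy_def xlogx_def
  proof (rule sum_mono)
    fix m
    show "- (?q m * ln (?p (f m))) \<le> - (?q m * ln (?q m))"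
    proof (cases "?q m = 0")
      case False
      then have q: "?q m > 0" using measure_nonneg[of M "Y -` {m}"] by linarith
      have "?q m \<le> ?p (f m)" by (rule finite_measure_mono) (use f finite_labelD(2)[OF X] in auto)
      then have "ln (?q m) \<le> ln (?p (f m))" using q by simp
      then show ?thesis using q by simp
    qed simp
  qed
  finally show "label_entropy M X \<le> label_entropy M Y" .
qed

lemma label_entropy_Pair:
  assumes X: "finite_label M X" and Y: "finite_label M Y"
  shows "label_entropy M (\<lambda>x. (X x, Y x)) \<le> label_entropy M X + label_entropy M Y"
proof -
  let ?p = "\<lambda>l. measure M (X -` {l})" and ?q = "\<lambda>m. measure M (Y -` {m})"
  let ?j = "\<lambda>(l, m). measure M (X -` {l} \<inter> Y -` {m})"
  note fX = finite_labelD[OF X] and fY = finite_labelD[OF Y]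
  let ?I = "range X \<times> range Y"
  have e: "(\<lambda>x. (X x, Y x)) -` {(l, m)} = X -` {l} \<inter> Y -` {m}" for l m by auto
  have jp: "?j (l, m) \<le> ?p l" and jq: "?j (l, m) \<le> ?q m" for l m
    using fX fY by (auto intro!: finite_measure_mono)
  have "label_entropy M (\<lambda>x. (X x, Y x)) = (\<Sum>i\<in>?I. xlogx (?j i))"
    using fX fY by (subst label_entropy_superset[of ?I]) (auto simp: e intro!: sum.cong)
  also have "\<dots> \<le> (\<Sum>i\<in>?I. - (?j i * ln (?p (fst i) * ?q (snd i))))"
  proof (rule gibbs)
    show "0 < ?p (fst i) * ?q (snd i)" if "0 < ?j i" for i
      using that jp[of "fst i" "snd i"] jq[of "fst i" "snd i"] by (cases i) (auto intro!: mult_pos_pos)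
    have "(\<Sum>i\<in>?I. ?p (fst i) * ?q (snd i)) = (\<Sum>l\<in>range X. ?p l) * (\<Sum>m\<in>range Y. ?q m)"
      by (simp add: sum_product sum.cartesian_product split_def)
    moreover have "(\<Sum>i\<in>?I. ?j i) = 1"
      using measure_label_sum[OF X] measure_split[OF Y fX(2)] by (simp add: sum.cartesian_product[symmetric])
    ultimately show "(\<Sum>i\<in>?I. ?p (fst i) * ?q (snd i)) \<le> (\<Sum>i\<in>?I. ?j i)"
      using measure_label_sum[OF X] measure_label_sum[OF Y] by simp
  qed (use fX fY in auto)
  also have "\<dots> = (\<Sum>i\<in>?I. - (?j i * ln (?p (fst i)))) + (\<Sum>i\<in>?I. - (?j i * ln (?q (snd i))))"
    unfolding sum.distrib[symmetric]
  proof (intro sum.cong refl)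
    fix i assume "i \<in> ?I"
    show "- (?j i * ln (?p (fst i) * ?q (snd i))) = - (?j i * ln (?p (fst i))) + - (?j i * ln (?q (snd i)))"
    proof (cases "?j i = 0")
      case False
      then have "?j i > 0" by (cases i) (auto simp: less_le)
      then have "?p (fst i) > 0" "?q (snd i) > 0"
        using jp[of "fst i" "snd i"] jq[of "fst i" "snd i"] by (cases i; auto)+
      then show ?thesis by (simp add: ln_mult algebra_simps)
    qed simp
  qed
  also have "(\<Sum>i\<in>?I. - (?j i * ln (?p (fst i)))) = label_entropy M X"
  proof -
    have "(\<Sum>i\<in>?I. - (?j i * ln (?p (fst i)))) = (\<Sum>l\<in>range X. \<Sum>m\<in>range Y. - (measure M (X -` {l} \<inter> Y -` {m}) * ln (?p l)))"
      by (subst sum.cartesian_product) (simp add: split_def)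
    then show ?thesis
      unfolding label_entropy_def xlogx_def
      by (simp add: sum_negf sum_distrib_right[symmetric] measure_split[OF Y fX(2)])
  qed
  also have "(\<Sum>i\<in>?I. - (?j i * ln (?q (snd i)))) = label_entropy M Y"
  proof -
    have "(\<Sum>i\<in>?I. - (?j i * ln (?q (snd i)))) = (\<Sum>l\<in>range X. \<Sum>m\<in>range Y. - (measure M (X -` {l} \<inter> Y -` {m}) * ln (?q m)))"
      by (subst sum.cartesian_product) (simp add: split_def)
    also have "\<dots> = (\<Sum>m\<in>range Y. \<Sum>l\<in>range X. - (measure M (Y -` {m} \<inter> X -` {l}) * ln (?q m)))"
      by (subst sum.swap) (simp add: Int_commute)
    finally show ?thesis
      unfolding label_entropy_def xlogx_def
      by (simp add: sum_negf sum_distrib_right[symmetric] measure_split[OF X fY(2)])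
  qed
  finally show ?thesis .
qed

lemma label_entropy_map:
  assumes "\<And>j. j \<in> set js \<Longrightarrow> finite_label M (Y j)"
  shows "label_entropy M (\<lambda>x. map (\<lambda>j. Y j x) js) \<le> (\<Sum>j\<leftarrow>js. label_entropy M (Y j))"
  using assms
proof (induction js)
  case Nil
  have "(\<lambda>x::'a. ([] :: 'c list)) -` {[]} = UNIV" by auto
  then show ?case using prob_space by (simp add: label_entropy_def xlogx_def space_UNIV)
next
  case (Cons j js)
  have fj: "finite_label M (Y j)" "finite_label M (\<lambda>x. map (\<lambda>j. Y j x) js)"
    by (simp_all add: Cons.prems finite_label_map space_UNIV)
  have "label_entropy M (\<lambda>x. map (\<lambda>j. Y j x) (j # js)) \<le> label_entropy M (\<lambda>x. (Y j x, map (\<lambda>j. Y j x) js))"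
    by (rule label_entropy_mono(2)[OF finite_label_Pair[OF fj]]) simp
  also have "\<dots> \<le> label_entropy M (Y j) + label_entropy M (\<lambda>x. map (\<lambda>j. Y j x) js)"
    by (rule label_entropy_Pair[OF fj])
  also have "\<dots> \<le> label_entropy M (Y j) + (\<Sum>j\<leftarrow>js. label_entropy M (Y j))"
    using Cons by simp
  finally show ?case by simp
qed

lemma label_entropy_le_ln_card:
  assumes X: "finite_label M X" and S: "finite S" "range X \<subseteq> S"
  shows "label_entropy M X \<le> ln (real (card S))"
proof -
  have c: "card S > 0" using S by (auto simp: card_gt_0_iff)
  have one: "(\<Sum>l\<in>S. measure M (X -` {l})) = 1"
  proof -
    have "(\<Sum>l\<in>range X. measure M (X -` {l})) = (\<Sum>l\<in>S. measure M (X -` {l}))"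
    proof (rule sum.mono_neutral_left[OF S], rule ballI)
      fix l assume "l \<in> S - range X"
      then have "X -` {l} = {}" by auto
      then show "measure M (X -` {l}) = 0" by simp
    qed
    then show ?thesis using measure_label_sum[OF X] by simp
  qed
  have "label_entropy M X = (\<Sum>l\<in>S. xlogx (measure M (X -` {l})))" by (rule label_entropy_superset[OF S])
  also have "\<dots> \<le> (\<Sum>l\<in>S. - (measure M (X -` {l}) * ln (1 / real (card S))))"
    using S c one by (intro gibbs) auto
  also have "\<dots> = ln (real (card S)) * (\<Sum>l\<in>S. measure M (X -` {l}))"
    using c by (simp add: ln_div sum_distrib_left mult.commute)
  finally show ?thesis using one by simp
qed

end

section \<open>Itineraries and block decomposition\<close>

definition itinerary :: "('a \<Rightarrow> 'a) \<Rightarrow> ('a \<Rightarrow> 'l) \<Rightarrow> nat \<Rightarrow> 'a \<Rightarrow> 'l list" where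
  "itinerary T X n x = map (\<lambda>i. X ((T ^^ i) x)) [0..<n]"

lemma itinerary_eq_iff: "itinerary T X n x = itinerary T X n y \<longleftrightarrow> (\<forall>i<n. X ((T ^^ i) x) = X ((T ^^ i) y))"
  by (auto simp: itinerary_def)

text \<open>Misiurewicz's counting argument: for every offset \<open>s < m\<close> the times \<open>s, \<dots>, n - 1\<close> are covered by
  blocks of length \<open>m\<close> that start at the times congruent to \<open>s\<close> modulo \<open>m\<close>.\<close>

lemma (in full_prob_space) misiurewicz:
  assumes fl: "\<And>j. finite_label M (\<lambda>x. X ((T ^^ j) x))" and S: "finite S" "range X \<subseteq> S" and m: "m \<ge> 1"
  shows "real m * label_entropy M (itinerary T X n) \<le>
    real m * (real m * ln (real (card S))) + (\<Sum>j<n. label_entropy M (\<lambda>x. itinerary T X m ((T ^^ j) x)))"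
proof -
  let ?N = "\<lambda>j x. itinerary T X m ((T ^^ j) x)"
  have flN: "finite_label M (?N j)" for j
  proof -
    have "finite_label M (\<lambda>x. map (\<lambda>i. X ((T ^^ (i + j)) x)) [0..<m])" by (intro finite_label_map fl space_UNIV)
    then show ?thesis by (simp add: itinerary_def funpow_add)
  qed
  have fli: "finite_label M (itinerary T X k)" for k
    unfolding itinerary_def by (intro finite_label_map fl space_UNIV)
  have cS: "0 \<le> ln (real (card S))"
    using S by (cases "card S") (auto simp: card_gt_0_iff)
  have one: "label_entropy M (itinerary T X n) \<le> real m * ln (real (card S)) +
      (\<Sum>j<n. if j mod m = s then label_entropy M (?N j) else 0)" if s: "s < m" for s
  proof -
    \<comment> \<open>The last block may run past time n - 1, which only refines the label. The
      fewer than m times before s are recorded separately, at a cost of at most m ln(card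
      S).\<close>
    define js where "js = filter (\<lambda>j. j mod m = s) [0..<n]"
    define Y where "Y x = (itinerary T X s x, map (\<lambda>j. ?N j x) js)" for x
    have flm: "finite_label M (\<lambda>x. map (\<lambda>j. ?N j x) js)" by (intro finite_label_map flN space_UNIV)
    have "label_entropy M (itinerary T X n) \<le> label_entropy M Y"
    proof (rule label_entropy_mono(2))
      show "finite_label M Y" unfolding Y_def by (rule finite_label_Pair[OF fli flm])
      fix x y assume "Y x = Y y"
      then have a: "\<And>i. i < s \<Longrightarrow> X ((T ^^ i) x) = X ((T ^^ i) y)"
        and b: "\<And>j. j < n \<Longrightarrow> j mod m = s \<Longrightarrow> ?N j x = ?N j y"
        by (auto simp: Y_def itinerary_eq_iff js_def)
      have "X ((T ^^ i) x) = X ((T ^^ i) y)" if i: "i < n" for i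
      proof (cases "i < s")
        case False
        define k where "k = (i - s) mod m"
        have k: "k < m" "k \<le> i - s" using m by (auto simp: k_def)
        define j where "j = i - k"
        have "j = s + m * ((i - s) div m)"
          using False mod_mult_div_eq[of "i - s" m] unfolding j_def k_def by linarith
        then have j: "j < n" "j mod m = s" "i = k + j" using s i k False by (auto simp: j_def)
        from b[OF j(1,2)] k(1) have "X ((T ^^ k) ((T ^^ j) x)) = X ((T ^^ k) ((T ^^ j) y))"
          unfolding itinerary_eq_iff by blast
        then show ?thesis unfolding j(3) by (simp add: funpow_add)
      qed (rule a)
      then show "itinerary T X n x = itinerary T X n y" unfolding itinerary_eq_iff by blast
    qed
    also have "\<dots> \<le> label_entropy M (itinerary T X s) + label_entropy M (\<lambda>x. map (\<lambda>j. ?N j x) js)"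
      unfolding Y_def by (rule label_entropy_Pair[OF fli flm])
    also have "\<dots> \<le> (\<Sum>i\<leftarrow>[0..<s]. label_entropy M (\<lambda>x. X ((T ^^ i) x))) + (\<Sum>j\<leftarrow>js. label_entropy M (?N j))"
      unfolding itinerary_def[of T X s] by (intro add_mono label_entropy_map fl flN)
    also have "(\<Sum>i\<leftarrow>[0..<s]. label_entropy M (\<lambda>x. X ((T ^^ i) x))) \<le> real m * ln (real (card S))"
    proof -
      have "(\<Sum>i\<leftarrow>[0..<s]. label_entropy M (\<lambda>x. X ((T ^^ i) x))) \<le> (\<Sum>i\<leftarrow>[0..<s]. ln (real (card S)))"
        using S by (intro sum_list_mono label_entropy_le_ln_card fl) auto
      also have "\<dots> = real s * ln (real (card S))" by (simp add: sum_list_triv)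
      also have "\<dots> \<le> real m * ln (real (card S))" using s cS by (intro mult_right_mono) auto
      finally show ?thesis .
    qed
    also have "(\<Sum>j\<leftarrow>js. label_entropy M (?N j)) = (\<Sum>j<n. if j mod m = s then label_entropy M (?N j) else 0)"
    proof -
      have "(\<Sum>j\<leftarrow>js. label_entropy M (?N j)) = (\<Sum>j\<in>set js. label_entropy M (?N j))"
        by (rule sum_list_distinct_conv_sum_set) (simp add: js_def)
      also have "set js = {j \<in> {..<n}. j mod m = s}" by (auto simp: js_def)
      also have "(\<Sum>j\<in>{j \<in> {..<n}. j mod m = s}. label_entropy M (?N j)) = (\<Sum>j<n. if j mod m = s then label_entropy M (?N j) else 0)"
        by (rule sum.inter_filter) simp
      finally show ?thesis .
    qed
    finally show ?thesis by simp
  qed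
  have "real m * label_entropy M (itinerary T X n) = (\<Sum>s<m. label_entropy M (itinerary T X n))" by simp
  also have "\<dots> \<le> (\<Sum>s<m. real m * ln (real (card S)) + (\<Sum>j<n. if j mod m = s then label_entropy M (?N j) else 0))"
    by (intro sum_mono one) simp
  also have "\<dots> = real m * (real m * ln (real (card S))) + (\<Sum>s<m. \<Sum>j<n. if j mod m = s then label_entropy M (?N j) else 0)"
    by (simp add: sum.distrib)
  also have "(\<Sum>s<m. \<Sum>j<n. if j mod m = s then label_entropy M (?N j) else 0) = (\<Sum>j<n. label_entropy M (?N j))"
    using m by (subst sum.swap) (auto simp: sum.delta' intro!: sum.cong)
  finally show ?thesis .
qed

section \<open>The entropy rate of a partition\<close>

text \<open>Fekete's lemma; nonnegativity keeps the infimum of the quotients finite.\<close>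

lemma subadditive_limit:
  fixes a :: "nat \<Rightarrow> real"
  assumes sub: "\<And>m n. a (m + n) \<le> a m + a n" and nn: "\<And>n. 0 \<le> a n"
  obtains L where "(\<lambda>n. a n / real n) \<longlonglongrightarrow> L"
proof -
  define L where "L = (INF n\<in>{1..}. a n / real n)"
  have bdd: "bdd_below ((\<lambda>n. a n / real n) ` {1..})" using nn by (intro bdd_belowI[of _ 0]) auto
  have L_le: "L \<le> a n / real n" if "n \<ge> 1" for n unfolding L_def by (rule cINF_lower[OF bdd]) (use that in auto)
  have mult: "a (m * k) \<le> real k * a m" if "k \<ge> 1" for m k
    using that
  proof (induction k rule: dec_induct)
    case (step k)
    have "a (m * Suc k) \<le> a m + a (m * k)" using sub[of m "m * k"] by simp
    then show ?case using step by (simp add: algebra_simps)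
  qed simp
  have "(\<lambda>n. a n / real n) \<longlonglongrightarrow> L"
  proof (rule LIMSEQ_I)
    fix e :: real assume e: "e > 0"
    have "\<exists>n\<in>{1..}. a n / real n < L + e / 2"
    proof -
      have "(INF n\<in>{1..}. a n / real n) < L + e / 2" using e by (simp add: L_def)
      then show ?thesis using bdd by (subst (asm) cINF_less_iff) auto
    qed
    then obtain m where m: "m \<ge> 1" "a m / real m < L + e / 2" by auto
    define B where "B = (\<Sum>j<m. a j)"
    have B: "a j \<le> B" if "j < m" for j
      unfolding B_def using member_le_sum[of j "{..<m}" a] nn that by auto
    have B0: "0 \<le> B" unfolding B_def using nn by (simp add: sum_nonneg)
    obtain N :: nat where N: "2 * B / e < real N" using reals_Archimedean2 by blast
    show "\<exists>no. \<forall>n\<ge>no. norm (a n / real n - L) < e"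
    proof (intro exI allI impI)
      fix n assume n: "n \<ge> max m (Suc N)"
      then have n0: "real n > 0" "n \<ge> 1" using m by auto
      have k1: "n div m \<ge> 1" using n m by (simp add: div_greater_zero_iff Suc_le_eq)
      have "a n = a (m * (n div m) + n mod m)" by simp
      also have "\<dots> \<le> a (m * (n div m)) + a (n mod m)" by (rule sub)
      also have "\<dots> \<le> real (n div m) * a m + B" using mult[OF k1, of m] B[of "n mod m"] m by simp
      also have "real (n div m) * a m \<le> real n / real m * a m"
      proof (rule mult_right_mono[OF _ nn])
        have "real (n div m * m) \<le> real n" by (intro of_nat_mono) simp
        then show "real (n div m) \<le> real n / real m" using m by (simp add: le_divide_eq)
      qed
      finally have "a n \<le> real n * (a m / real m) + B" by simp
      then have "a n / real n \<le> (real n * (a m / real m) + B) / real n" using n0 by (intro divide_right_mono) auto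
      also have "\<dots> = a m / real m + B / real n" using n0 by (simp add: add_divide_distrib)
      also have "B / real n < e / 2"
      proof -
        have "2 * B / e < real n" using N n by linarith
        then show ?thesis using e n0 by (simp add: field_simps)
      qed
      finally have "a n / real n < L + e" using m(2) by simp
      then show "norm (a n / real n - L) < e" using L_le[OF n0(2)] by simp
    qed
  qed
  then show ?thesis by (rule that)
qed

definition cell :: "'a set set \<Rightarrow> 'a \<Rightarrow> 'a set" where
  "cell P x = (THE C. C \<in> P \<and> x \<in> C)"

lemma cell_eq:
  assumes "partition_on UNIV P" "C \<in> P" "x \<in> C"
  shows "cell P x = C"
  unfolding cell_def
proof (rule the_equality)
  show "C' = C" if "C' \<in> P \<and> x \<in> C'" for C'
    using partition_onD2[OF assms(1)] that assms(2,3) by (auto simp: disjoint_def)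
qed (use assms in simp)

lemma cell_in:
  assumes "partition_on UNIV P"
  shows "cell P x \<in> P" "x \<in> cell P x"
proof -
  obtain C where "C \<in> P" "x \<in> C" using partition_onD1[OF assms] by blast
  then show "cell P x \<in> P" "x \<in> cell P x" using cell_eq[OF assms] by auto
qed

text \<open>A nonempty cell of the join determines one itinerary, that of any of its points. This
  ties the set-based definition of entropy to labels.\<close>

lemma iterated_join_eq:
  assumes "space \<mu> = UNIV" "partition_on UNIV P"
  shows "iterated_join \<mu> T P n = (\<lambda>l. itinerary T (cell P) n -` {l}) ` range (itinerary T (cell P) n)"
proof
  let ?N = "itinerary T (cell P) n"
  show "iterated_join \<mu> T P n \<subseteq> (\<lambda>l. ?N -` {l}) ` range ?N"
  proof
    fix E assume "E \<in> iterated_join \<mu> T P n"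
    then obtain w where w: "E = {x. \<forall>i<n. (T ^^ i) x \<in> w i}" "\<forall>i<n. w i \<in> P" "E \<noteq> {}"
      using assms(1) by (auto simp: iterated_join_def)
    then obtain x0 where x0: "x0 \<in> E" by blast
    have c: "(T ^^ i) x \<in> w i \<longleftrightarrow> cell P ((T ^^ i) x) = w i" if "i < n" for i x
      using cell_eq[OF assms(2) w(2)[rule_format, OF that], of "(T ^^ i) x"] cell_in(2)[OF assms(2), of "(T ^^ i) x"] by auto
    have "E = {x. \<forall>i<n. cell P ((T ^^ i) x) = w i}" unfolding w(1) using c by auto
    moreover have "\<forall>i<n. cell P ((T ^^ i) x0) = w i" using x0 unfolding calculation by simp
    ultimately have "E = ?N -` {?N x0}" by (auto simp: itinerary_eq_iff)
    then show "E \<in> (\<lambda>l. ?N -` {l}) ` range ?N" by auto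
  qed
  show "(\<lambda>l. ?N -` {l}) ` range ?N \<subseteq> iterated_join \<mu> T P n"
  proof (clarify)
    fix x0
    have c: "cell P y = cell P z \<longleftrightarrow> y \<in> cell P z" for y z
      using cell_eq[OF assms(2) cell_in(1)[OF assms(2), of z], of y] cell_in(2)[OF assms(2), of y] by auto
    have "?N -` {?N x0} = {x \<in> space \<mu>. \<forall>i<n. (T ^^ i) x \<in> cell P ((T ^^ i) x0)}"
      unfolding vimage_def singleton_iff itinerary_eq_iff c assms(1) by simp
    then have "\<exists>w. ?N -` {?N x0} = {x \<in> space \<mu>. \<forall>i<n. (T ^^ i) x \<in> w i} \<and> (\<forall>i<n. w i \<in> P)"
      by (intro exI[of _ "\<lambda>i. cell P ((T ^^ i) x0)"] conjI allI impI cell_in(1)[OF assms(2)])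
    moreover have "?N -` {?N x0} \<noteq> {}" by auto
    ultimately show "?N -` {?N x0} \<in> iterated_join \<mu> T P n"
      unfolding iterated_join_def by simp
  qed
qed

lemma partition_entropy_join:
  assumes "space \<mu> = UNIV" "partition_on UNIV P"
  shows "partition_entropy \<mu> (iterated_join \<mu> T P n) = label_entropy \<mu> (itinerary T (cell P) n)"
  unfolding partition_entropy_def iterated_join_eq[OF assms] label_entropy_def xlogx_def
proof (rule sum.reindex[unfolded o_def], rule inj_onI)
  fix l k assume "l \<in> range (itinerary T (cell P) n)" "itinerary T (cell P) n -` {l} = itinerary T (cell P) n -` {k}"
  then show "l = k" by blast
qed

lemma full_prob_space_invariant: "\<mu> \<in> invariant_measures \<alpha> \<Longrightarrow> full_prob_space \<mu>"
  by (simp add: full_prob_space_def full_prob_space_axioms_def invariant_measuresD)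

lemma measure_vimage_funpow:
  assumes "\<mu> \<in> invariant_measures \<alpha>" "continuous_on UNIV \<alpha>" "E \<in> sets borel"
  shows "measure \<mu> ((\<alpha> ^^ n) -` E) = measure \<mu> E"
proof (induction n)
  case (Suc n)
  have m: "(\<alpha> ^^ n) -` E \<in> sets borel"
    using measurable_sets[OF borel_measurable_continuous_onI[OF continuous_on_funpow[OF assms(2), of n]] assms(3)] by simp
  have eq: "(\<alpha> ^^ Suc n) -` E = \<alpha> -` ((\<alpha> ^^ n) -` E)" by (auto simp: funpow_swap1)
  show ?case unfolding eq using measure_vimage_invariant[OF assms(1,2) m] Suc by (rule trans)
qed simp

lemma finite_label_shift:
  assumes "sets \<mu> = sets borel" "continuous_on UNIV \<alpha>" "finite_label \<mu> X"
  shows "finite_label \<mu> (\<lambda>x. X ((\<alpha> ^^ n) x))"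
  unfolding finite_label_def
proof (intro conjI allI)
  show "finite (range (\<lambda>x. X ((\<alpha> ^^ n) x)))" using finite_labelD(1)[OF assms(3)] by (rule finite_subset[rotated]) auto
  fix l
  have "(\<lambda>x. X ((\<alpha> ^^ n) x)) -` {l} = (\<alpha> ^^ n) -` (X -` {l})" by auto
  moreover have "(\<alpha> ^^ n) -` (X -` {l}) \<in> sets borel"
    using measurable_sets[OF borel_measurable_continuous_onI[OF continuous_on_funpow[OF assms(2), of n]], of "X -` {l}"]
      finite_labelD(2)[OF assms(3)] assms(1) by simp
  ultimately show "(\<lambda>x. X ((\<alpha> ^^ n) x)) -` {l} \<in> sets \<mu>" using assms(1) by simp
qed

lemma label_entropy_shift:
  assumes m: "\<mu> \<in> invariant_measures \<alpha>" and c: "continuous_on UNIV \<alpha>" and X: "finite_label \<mu> X"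
  shows "label_entropy \<mu> (\<lambda>x. X ((\<alpha> ^^ n) x)) = label_entropy \<mu> X"
proof -
  have "label_entropy \<mu> (\<lambda>x. X ((\<alpha> ^^ n) x)) = (\<Sum>l\<in>range X. xlogx (measure \<mu> ((\<lambda>x. X ((\<alpha> ^^ n) x)) -` {l})))"
    by (rule label_entropy_superset[OF finite_labelD(1)[OF X]]) auto
  also have "\<dots> = label_entropy \<mu> X"
    unfolding label_entropy_def
  proof (intro sum.cong refl)
    fix l
    have "(\<lambda>x. X ((\<alpha> ^^ n) x)) -` {l} = (\<alpha> ^^ n) -` (X -` {l})" by auto
    then show "xlogx (measure \<mu> ((\<lambda>x. X ((\<alpha> ^^ n) x)) -` {l})) = xlogx (measure \<mu> (X -` {l}))"
      using measure_vimage_funpow[OF m c, of "X -` {l}"] finite_labelD(2)[OF X, of l] invariant_measuresD(3)[OF m] by simp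
  qed
  finally show ?thesis .
qed

lemma finite_label_itinerary:
  assumes "\<mu> \<in> invariant_measures \<alpha>" "continuous_on UNIV \<alpha>" "finite_label \<mu> X"
  shows "finite_label \<mu> (itinerary \<alpha> X n)"
  unfolding itinerary_def
  using assms by (intro finite_label_map finite_label_shift invariant_measuresD)

lemma finite_label_cell:
  assumes m: "\<mu> \<in> invariant_measures \<alpha>" and P: "P \<in> finite_measurable_partitions \<mu>"
  shows "finite_label \<mu> (cell P)" "range (cell P) \<subseteq> P" "finite P" "partition_on UNIV P"
proof -
  show pt: "partition_on UNIV P" and fin: "finite P"
    using P invariant_measuresD(4)[OF m] by (auto simp: finite_measurable_partitions_def)
  show r: "range (cell P) \<subseteq> P" using cell_in(1)[OF pt] by auto
  have "cell P -` {C} \<in> sets \<mu>" for C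
  proof (cases "C \<in> P")
    case True
    then have "cell P -` {C} = C" using cell_eq[OF pt] cell_in(2)[OF pt] by auto
    then show ?thesis using P True by (auto simp: finite_measurable_partitions_def)
  next
    case False
    then have "cell P -` {C} = {}" using r by auto
    then show ?thesis by simp
  qed
  then show "finite_label \<mu> (cell P)" using finite_subset[OF r fin] by (auto simp: finite_label_def)
qed

text \<open>The rate is defined by \<open>lim\<close>, so convergence must be established before it
  says anything. Invariance gives the shifted itinerary the entropy of the unshifted one, which
  yields subadditivity.\<close>

lemma partition_entropy_rate_tendsto:
  assumes m: "\<mu> \<in> invariant_measures \<alpha>" and c: "continuous_on UNIV \<alpha>" and P: "P \<in> finite_measurable_partitions \<mu>"
  shows "(\<lambda>n. label_entropy \<mu> (itinerary \<alpha> (cell P) n) / real n) \<longlonglongrightarrow> partition_entropy_rate \<mu> \<alpha> P"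
proof -
  note fc = finite_label_cell[OF m P]
  interpret full_prob_space \<mu> by (rule full_prob_space_invariant[OF m])
  note fi = finite_label_itinerary[OF m c fc(1)]
  have sub: "label_entropy \<mu> (itinerary \<alpha> (cell P) (k + n)) \<le>
      label_entropy \<mu> (itinerary \<alpha> (cell P) k) + label_entropy \<mu> (itinerary \<alpha> (cell P) n)" for k n
  proof -
    have fs: "finite_label \<mu> (\<lambda>x. itinerary \<alpha> (cell P) n ((\<alpha> ^^ k) x))"
      by (rule finite_label_shift[OF invariant_measuresD(3)[OF m] c fi])
    have "label_entropy \<mu> (itinerary \<alpha> (cell P) (k + n)) \<le>
        label_entropy \<mu> (\<lambda>x. (itinerary \<alpha> (cell P) k x, itinerary \<alpha> (cell P) n ((\<alpha> ^^ k) x)))"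
    proof (rule label_entropy_mono(2)[OF finite_label_Pair[OF fi fs]])
      fix x y assume "(itinerary \<alpha> (cell P) k x, itinerary \<alpha> (cell P) n ((\<alpha> ^^ k) x)) =
        (itinerary \<alpha> (cell P) k y, itinerary \<alpha> (cell P) n ((\<alpha> ^^ k) y))"
      then have a: "\<And>i. i < k \<Longrightarrow> cell P ((\<alpha> ^^ i) x) = cell P ((\<alpha> ^^ i) y)"
        and b: "\<And>i. i < n \<Longrightarrow> cell P ((\<alpha> ^^ i) ((\<alpha> ^^ k) x)) = cell P ((\<alpha> ^^ i) ((\<alpha> ^^ k) y))"
        by (auto simp: itinerary_eq_iff)
      show "itinerary \<alpha> (cell P) (k + n) x = itinerary \<alpha> (cell P) (k + n) y"
        unfolding itinerary_eq_iff
      proof (intro allI impI)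
        fix i assume i: "i < k + n"
        show "cell P ((\<alpha> ^^ i) x) = cell P ((\<alpha> ^^ i) y)"
        proof (cases "i < k")
          case False
          then have "(\<alpha> ^^ i) z = (\<alpha> ^^ (i - k)) ((\<alpha> ^^ k) z)" for z
            using funpow_add[of "i - k" k \<alpha>] by simp
          then show ?thesis using b[of "i - k"] i False by simp
        qed (rule a)
      qed
    qed
    also have "\<dots> \<le> label_entropy \<mu> (itinerary \<alpha> (cell P) k) + label_entropy \<mu> (\<lambda>x. itinerary \<alpha> (cell P) n ((\<alpha> ^^ k) x))"
      by (rule label_entropy_Pair[OF fi fs])
    finally show ?thesis unfolding label_entropy_shift[OF m c fi] .
  qed
  obtain L where L: "(\<lambda>n. label_entropy \<mu> (itinerary \<alpha> (cell P) n) / real n) \<longlonglongrightarrow> L"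
    by (rule subadditive_limit[OF sub label_entropy_nonneg])
  then have "partition_entropy_rate \<mu> \<alpha> P = L"
    unfolding partition_entropy_rate_def partition_entropy_join[OF invariant_measuresD(4)[OF m] fc(4)] by (rule limI)
  then show ?thesis using L by simp
qed

lemma (in full_prob_space) label_entropy_cong_AE:
  assumes "finite_label M X" "finite_label M Y" "AE x in M. X x = Y x"
  shows "label_entropy M X = label_entropy M Y"
proof -
  have fin: "finite (range X \<union> range Y)" using assms by (simp add: finite_label_def)
  have "measure M (X -` {l}) = measure M (Y -` {l})" for l
    using finite_labelD(2)[OF assms(1)] finite_labelD(2)[OF assms(2)]
    by (intro finite_measure_eq_AE) (use assms(3) in \<open>auto elim: eventually_mono\<close>)
  then show ?thesis
    unfolding label_entropy_superset[OF fin Un_upper1] label_entropy_superset[OF fin Un_upper2] by simp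
qed

section \<open>Shadowing of preimages\<close>

lemma preimage_sum_outside:
  assumes "\<And>y. y \<in> K \<Longrightarrow> \<alpha> y \<in> K" "x \<notin> K"
  shows "preimage_sum K \<alpha> w n x = 0"
proof -
  have "{y. y \<in> K \<and> (\<alpha> ^^ n) y = x} = {}" using funpow_in[of K \<alpha>] assms by auto
  then show ?thesis unfolding preimage_sum_def by (simp only: sum.empty)
qed

lemma preimage_sum_zero: "preimage_sum K \<alpha> w 0 x = (if x \<in> K then 1 else 0)"
proof -
  have "{y. y \<in> K \<and> y = x} = (if x \<in> K then {x} else {})" by auto
  then show ?thesis by (simp add: preimage_sum_def)
qed

text \<open>Submultiplicativity: the n steps nearest to x are peeled off one by one, and the sum
  over the remaining m-th preimages is bounded by c. At n = 0 both sides vanish off K.\<close>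

lemma preimage_sum_add_le:
  assumes fin: "\<And>x. finite {y. y \<in> K \<and> \<alpha> y = x}" and K: "\<And>y. y \<in> K \<Longrightarrow> \<alpha> y \<in> K"
    and w: "\<And>y. y \<in> K \<Longrightarrow> 0 \<le> w y" and c: "\<And>x. preimage_sum K \<alpha> w m x \<le> c"
  shows "preimage_sum K \<alpha> w (n + m) x \<le> c * preimage_sum K \<alpha> w n x"
proof -
  have rec: "preimage_sum K \<alpha> w (Suc n) x = (\<Sum>u | u \<in> K \<and> \<alpha> u = x. w u * preimage_sum K \<alpha> w n u)" for n x
    by (rule preimage_sum_Suc[OF fin K])
  show ?thesis
  proof (induction n arbitrary: x)
    case 0
    then show ?case using c[of x] preimage_sum_outside[of K \<alpha> x w m] K by (simp add: preimage_sum_zero)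
  next
    case (Suc n)
    have "preimage_sum K \<alpha> w (Suc n + m) x = (\<Sum>u | u \<in> K \<and> \<alpha> u = x. w u * preimage_sum K \<alpha> w (n + m) u)"
      using preimage_sum_Suc[OF fin K, of w "n + m" x] by simp
    also have "\<dots> \<le> (\<Sum>u | u \<in> K \<and> \<alpha> u = x. w u * (c * preimage_sum K \<alpha> w n u))"
      by (intro sum_mono mult_left_mono Suc w) auto
    also have "\<dots> = c * preimage_sum K \<alpha> w (Suc n) x"
      unfolding rec sum_distrib_left by (intro sum.cong) auto
    finally show ?case .
  qed
qed

lemma preimage_sum_le_power:
  assumes fin: "\<And>x. finite {y. y \<in> K \<and> \<alpha> y = x}" and K: "\<And>y. y \<in> K \<Longrightarrow> \<alpha> y \<in> K"
    and N: "\<And>x. card {y. y \<in> K \<and> \<alpha> y = x} \<le> N"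
    and w: "\<And>y. y \<in> K \<Longrightarrow> 0 \<le> w y" "\<And>y. y \<in> K \<Longrightarrow> w y \<le> V" and V: "0 \<le> V"
  shows "preimage_sum K \<alpha> w n x \<le> (real N * V) ^ n"
proof -
  have rec: "preimage_sum K \<alpha> w (Suc n) x = (\<Sum>u | u \<in> K \<and> \<alpha> u = x. w u * preimage_sum K \<alpha> w n u)" for n x
    by (rule preimage_sum_Suc[OF fin K])
  show ?thesis
  proof (induction n arbitrary: x)
    case 0
    then show ?case by (simp add: preimage_sum_zero)
  next
    case (Suc n)
    have "preimage_sum K \<alpha> w (Suc n) x \<le> (\<Sum>u | u \<in> K \<and> \<alpha> u = x. V * (real N * V) ^ n)"
      unfolding rec using V w K
      by (intro sum_mono mult_mono Suc preimage_sum_nonneg) auto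
    also have "\<dots> = real (card {u. u \<in> K \<and> \<alpha> u = x}) * (V * (real N * V) ^ n)" by simp
    also have "\<dots> \<le> real N * (V * (real N * V) ^ n)" using N V by (intro mult_right_mono) auto
    finally show ?case by (simp add: mult_ac)
  qed
qed

locale non_contracting_system =
  fixes \<alpha> :: "'a::metric_space \<Rightarrow> 'a"
  assumes compact_space: "compact (UNIV :: 'a set)"
    and cont: "continuous_on UNIV \<alpha>"
    and non_contracting: "non_contracting_on (essential_points \<alpha>) \<alpha>"
    and local_homeo: "local_homeomorphism_on (essential_points \<alpha>) (essential_points \<alpha>) \<alpha>"
begin

abbreviation "K \<equiv> essential_points \<alpha>"

lemma compact_K: "compact K"
  using compact_space closed_essential_points[of \<alpha>] by (metis compact_Int_closed inf_top_left)

lemma K_forward: "y \<in> K \<Longrightarrow> \<alpha> y \<in> K"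
  by (rule essential_points_forward[OF cont])

lemma fibers: obtains N :: nat
  where "\<And>x. finite {y. y \<in> K \<and> \<alpha> y = x}" "\<And>x. card {y. y \<in> K \<and> \<alpha> y = x} \<le> N"
  by (rule non_contracting_fibers[OF compact_K non_contracting]) (rule that)

lemma finite_fiber: "finite {y. y \<in> K \<and> \<alpha> y = x}"
  by (rule fibers)

text \<open>Each point has a local inverse branch, but the size of its domain depends on the point.
  A failing sequence would cluster at some p by compactness; the open map near p provides the
  missing preimage, and non-contraction bounds its distance, a contradiction.\<close>

lemma lift_point:
  obtains d where "d > 0"
    "\<And>y x. y \<in> K \<Longrightarrow> x \<in> K \<Longrightarrow> dist (\<alpha> y) x < d \<Longrightarrow> \<exists>y'\<in>K. \<alpha> y' = x \<and> dist y y' \<le> dist (\<alpha> y) x"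
proof -
  obtain r where r: "r > 0" "\<And>x y. x \<in> K \<Longrightarrow> y \<in> K \<Longrightarrow> dist x y \<le> r \<Longrightarrow> dist x y \<le> dist (\<alpha> x) (\<alpha> y)"
    using non_contracting unfolding non_contracting_on_def by blast
  let ?P = "\<lambda>d y x. y \<in> K \<and> x \<in> K \<and> dist (\<alpha> y) x < d \<and> \<not> (\<exists>y'\<in>K. \<alpha> y' = x \<and> dist y y' \<le> dist (\<alpha> y) x)"
  have "\<exists>d>0. \<forall>y x. \<not> ?P d y x"
  proof (rule ccontr)
    assume "\<not> ?thesis"
    then have ex: "\<exists>y x. ?P d y x" if "d > 0" for d using that by blast
    have "\<forall>n. \<exists>z. ?P (inverse (real (Suc n))) (fst z) (snd z)"
    proof
      fix n
      have "inverse (real (Suc n)) > 0" by simp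
      from ex[OF this] obtain y x where "?P (inverse (real (Suc n))) y x" by (elim exE)
      then show "\<exists>z. ?P (inverse (real (Suc n))) (fst z) (snd z)" by (intro exI[of _ "(y, x)"]) simp
    qed
    from choice[OF this] obtain z where z: "\<And>n. ?P (inverse (real (Suc n))) (fst (z n)) (snd (z n))" by blast
    define y where "y n = fst (z n)" for n
    define x where "x n = snd (z n)" for n
    have P: "?P (inverse (real (Suc n))) (y n) (x n)" for n using z[of n] by (simp add: y_def x_def)
    have "\<forall>n. y n \<in> K" using P by blast
    then obtain p s where p: "p \<in> K" "strict_mono s" "(y \<circ> s) \<longlonglongrightarrow> p"
      using compact_K unfolding compact_def by blast
    obtain U h where U: "openin (top_of_set K) U" "p \<in> U" "openin (top_of_set K) (\<alpha> ` U)" "homeomorphism U (\<alpha> ` U) \<alpha> h"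
      using local_homeo p(1) unfolding local_homeomorphism_on_def by blast
    \<comment> \<open>Radius r/2 puts y and the lifted point within r of each other, where
      non-contraction applies.\<close>
    define V where "V = U \<inter> ball p (r / 2)"
    have "openin (top_of_set U) V" unfolding V_def by (rule openin_open_Int) simp
    then have "openin (top_of_set (\<alpha> ` U)) (\<alpha> ` V)" by (rule homeomorphism_imp_open_map[OF U(4)])
    then have "openin (top_of_set K) (\<alpha> ` V)" by (rule openin_trans[OF _ U(3)])
    then obtain W where W: "open W" "\<alpha> ` V = K \<inter> W" unfolding openin_open by blast
    have "p \<in> V" using U(2) r(1) by (simp add: V_def)
    then have apW: "\<alpha> p \<in> W" using W(2) by blast
    have lim_ay: "(\<lambda>n. \<alpha> (y (s n))) \<longlonglongrightarrow> \<alpha> p"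
      using continuous_on_tendsto_compose[OF cont p(3)] by (simp add: o_def)
    have dist0: "(\<lambda>n. dist (\<alpha> (y (s n))) (x (s n))) \<longlonglongrightarrow> 0"
    proof (rule tendsto_sandwich[of "\<lambda>_. 0"])
      show "eventually (\<lambda>n. dist (\<alpha> (y (s n))) (x (s n)) \<le> inverse (real (Suc (s n)))) sequentially"
        using P by (intro always_eventually) (auto simp: less_imp_le)
      show "(\<lambda>n. inverse (real (Suc (s n)))) \<longlonglongrightarrow> 0"
        using LIMSEQ_subseq_LIMSEQ[OF LIMSEQ_inverse_real_of_nat p(2)] by (simp add: o_def)
    qed auto
    have lim_x: "(\<lambda>n. x (s n)) \<longlonglongrightarrow> \<alpha> p"
      unfolding tendsto_dist_iff[of _ "\<alpha> p"]
    proof (rule tendsto_sandwich[of "\<lambda>_. 0"])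
      show "eventually (\<lambda>n. dist (x (s n)) (\<alpha> p) \<le> dist (\<alpha> (y (s n))) (x (s n)) + dist (\<alpha> (y (s n))) (\<alpha> p)) sequentially"
        by (intro always_eventually allI dist_triangle3)
      show "(\<lambda>n. dist (\<alpha> (y (s n))) (x (s n)) + dist (\<alpha> (y (s n))) (\<alpha> p)) \<longlonglongrightarrow> 0"
        using tendsto_add[OF dist0 lim_ay[unfolded tendsto_dist_iff[of _ "\<alpha> p"]]] by simp
    qed auto
    have "eventually (\<lambda>n. x (s n) \<in> W) sequentially" using topological_tendstoD[OF lim_x W(1) apW] .
    moreover have "eventually (\<lambda>n. y (s n) \<in> ball p (r / 2)) sequentially"
      using topological_tendstoD[OF p(3), of "ball p (r / 2)"] r(1) by simp
    ultimately have "eventually (\<lambda>n. x (s n) \<in> W \<and> y (s n) \<in> ball p (r / 2)) sequentially" by (rule eventually_conj)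
    then obtain n where n: "x (s n) \<in> W" "y (s n) \<in> ball p (r / 2)"
      using eventually_happens'[OF sequentially_bot] by blast
    have "x (s n) \<in> \<alpha> ` V" unfolding W(2) using n(1) P[of "s n", THEN conjunct2, THEN conjunct1] by (rule IntI[rotated])
    then obtain y' where y': "y' \<in> V" "\<alpha> y' = x (s n)" by (rule imageE) (rule that, assumption, rule sym)
    have y'K: "y' \<in> K" using y'(1) openin_subset[OF U(1)] by (auto simp: V_def)
    have "dist (y (s n)) y' \<le> r"
      using n(2) y'(1) dist_triangle3[of "y (s n)" y' p] by (simp add: V_def)
    then have "dist (y (s n)) y' \<le> dist (\<alpha> (y (s n))) (x (s n))"
      using r(2)[of "y (s n)" y'] P[of "s n"] y'K y'(2) by simp
    then show False using P[of "s n"] y'K y'(2) by blast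
  qed
  then obtain d where "d > 0" "\<forall>y x. \<not> ?P d y x" by blast
  then show ?thesis by (intro that[of d]) auto
qed

text \<open>The endpoint is moved to x and lifted back step by step. Lifting never increases the
  distance, so the same d serves at every step and for every n.\<close>

lemma shadow_point:
  assumes d: "\<And>y x. y \<in> K \<Longrightarrow> x \<in> K \<Longrightarrow> dist (\<alpha> y) x < d \<Longrightarrow> \<exists>y'\<in>K. \<alpha> y' = x \<and> dist y y' \<le> dist (\<alpha> y) x"
    and "y \<in> K" "x \<in> K" "dist ((\<alpha> ^^ n) y) x < d"
  shows "\<exists>y'\<in>K. (\<alpha> ^^ n) y' = x \<and> (\<forall>i\<le>n. dist ((\<alpha> ^^ i) y) ((\<alpha> ^^ i) y') \<le> dist ((\<alpha> ^^ n) y) x)"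
  using assms(3,4)
proof (induction n arbitrary: x)
  case 0
  then show ?case by (intro bexI[of _ x]) auto
next
  case (Suc n)
  have yn: "(\<alpha> ^^ n) y \<in> K" by (rule funpow_in[of K \<alpha>, OF K_forward assms(2)])
  obtain z where z: "z \<in> K" "\<alpha> z = x" "dist ((\<alpha> ^^ n) y) z \<le> dist ((\<alpha> ^^ Suc n) y) x"
    using d[OF yn Suc.prems(1)] Suc.prems(2) by auto
  then have "dist ((\<alpha> ^^ n) y) z < d" using Suc.prems(2) by simp
  from Suc.IH[OF z(1) this] obtain y' where y': "y' \<in> K" "(\<alpha> ^^ n) y' = z"
    "\<forall>i\<le>n. dist ((\<alpha> ^^ i) y) ((\<alpha> ^^ i) y') \<le> dist ((\<alpha> ^^ n) y) z" by blast
  show ?case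
  proof (intro bexI conjI allI impI)
    show "(\<alpha> ^^ Suc n) y' = x" using y' z by simp
    fix i assume "i \<le> Suc n"
    then consider "i \<le> n" | "i = Suc n" by linarith
    then show "dist ((\<alpha> ^^ i) y) ((\<alpha> ^^ i) y') \<le> dist ((\<alpha> ^^ Suc n) y) x"
    proof cases
      case 1
      then show ?thesis using y'(3) z(3) order_trans by blast
    next
      case 2
      then show ?thesis using y'(2) z(2) by simp
    qed
  qed (rule y')
qed

lemma K_net:
  assumes "e > 0"
  obtains C where "finite C" "C \<subseteq> K" "K \<subseteq> (\<Union>c\<in>C. ball c e)"
proof -
  have "K \<subseteq> (\<Union>c\<in>K. ball c e)" using assms by auto
  then obtain C where "C \<subseteq> K" "finite C" "K \<subseteq> (\<Union>c\<in>C. ball c e)"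
    using compactE_image[OF compact_K, of K "\<lambda>c. ball c e"] by auto
  then show ?thesis by (intro that[of C])
qed

end

text \<open>Choosing the first set in a list that contains the point turns an overlapping cover into
  a measurable label, with \<open>None\<close> for uncovered points.\<close>

lemma finite_label_find:
  assumes "space M = UNIV" "\<And>z. z \<in> set zs \<Longrightarrow> G z \<in> sets M"
  shows "finite_label M (\<lambda>y. find (\<lambda>z. y \<in> G z) zs)"
  using assms(2)
proof (induction zs)
  case Nil
  have "UNIV \<in> sets M" using sets.top[of M] assms(1) by simp
  moreover have "(\<lambda>y. None) -` {l} = (if l = None then UNIV else {})" for l :: "'b option" by auto
  ultimately show ?case by (auto simp: finite_label_def)
next
  case (Cons z zs)
  have "finite_label M (\<lambda>y. y \<in> G z)"
    unfolding finite_label_def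
  proof (intro conjI allI)
    fix l
    have "(\<lambda>y. y \<in> G z) -` {l} = (if l then G z else space M - G z)" using assms(1) by auto
    then show "(\<lambda>y. y \<in> G z) -` {l} \<in> sets M" using Cons.prems[of z] by auto
  qed simp
  from finite_label_compose[OF finite_label_Pair[OF this Cons.IH[OF Cons.prems]], of "\<lambda>(b, l). if b then Some z else l"]
  show ?case by simp
qed

section \<open>The upper bound for entropy plus integral\<close>

text \<open>At the cost of a label of small entropy, the cells of an arbitrary measurable partition can be treated
  as separated closed sets, so that no condition on the boundaries of the cells is needed.\<close>

lemma closed_core_partition:
  fixes \<mu> :: "'a::metric_space measure"
  assumes m: "\<mu> \<in> invariant_measures \<alpha>" and P: "P \<in> finite_measurable_partitions \<mu>" and e: "e > 0"
  obtains F :: "'a set \<Rightarrow> 'a set"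
  where "\<And>C. C \<in> P \<Longrightarrow> closed (F C)" "\<And>C. C \<in> P \<Longrightarrow> F C \<subseteq> C"
    "finite_label \<mu> (\<lambda>x. if x \<in> F (cell P x) then None else Some (cell P x))"
    "label_entropy \<mu> (\<lambda>x. if x \<in> F (cell P x) then None else Some (cell P x)) \<le> e"
proof -
  note fc = finite_label_cell[OF m P]
  interpret full_prob_space \<mu> by (rule full_prob_space_invariant[OF m])
  note st = invariant_measuresD(3)[OF m]
  define k where "k = card P"
  \<comment> \<open>The label has k + 1 possible values, \<open>None\<close> and one per cell, and
    each may contribute e'.\<close>
  define e' where "e' = e / (real k + 1)"
  have e': "e' > 0" using e by (simp add: e'_def)
  obtain d0 where d0: "d0 > 0" "\<And>t. 0 \<le> t \<Longrightarrow> t < d0 \<Longrightarrow> xlogx t \<le> e'"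
  proof -
    obtain d where "d > 0" "\<forall>t\<in>{0..}. dist t 0 < d \<longrightarrow> dist (xlogx t) (xlogx 0) < e'"
      using continuous_on_xlogx e' unfolding continuous_on_iff by (meson atLeast_iff order_refl)
    then show ?thesis by (intro that[of d]) (auto simp: dist_real_def xlogx_def[of 0])
  qed
  obtain d1 where d1: "d1 > 0" "\<And>t. 0 \<le> t \<Longrightarrow> \<bar>t - 1\<bar> < d1 \<Longrightarrow> xlogx t \<le> e'"
  proof -
    obtain d where "d > 0" "\<forall>t\<in>{0..}. dist t 1 < d \<longrightarrow> dist (xlogx t) (xlogx 1) < e'"
      using continuous_on_xlogx e' unfolding continuous_on_iff by (meson atLeast_iff zero_le_one)
    then show ?thesis by (intro that[of d]) (auto simp: dist_real_def xlogx_def[of 1])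
  qed
  \<comment> \<open>Each remainder below d0 makes its own term small; k remainders below d1/(k+1)
    together stay below d1, which keeps the mass of \<open>None\<close> near 1, where the entropy
    term is small too.\<close>
  define \<eta> where "\<eta> = min d0 (d1 / (real k + 1))"
  have \<eta>: "\<eta> > 0" "\<eta> \<le> d0" "\<eta> \<le> d1 / (real k + 1)" using d0(1) d1(1) by (auto simp: \<eta>_def)
  have "\<exists>F. C \<in> P \<longrightarrow> closed F \<and> F \<subseteq> C \<and> measure \<mu> (C - F) < \<eta>" for C
  proof (cases "C \<in> P")
    case True
    then have C: "C \<in> sets borel" using P st by (auto simp: finite_measurable_partitions_def)
    from borel_closed_open_regular[OF invariant_measuresD(2)[OF m] st C, rule_format, OF \<eta>(1)]
    obtain F U where FU: "closed F" "open U" "F \<subseteq> C" "C \<subseteq> U" "measure \<mu> (U - F) < \<eta>"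
      by (elim exE conjE)
    have "measure \<mu> (C - F) \<le> measure \<mu> (U - F)"
      using FU st by (intro finite_measure_mono) auto
    then show ?thesis using FU by (intro exI[of _ F]) auto
  qed simp
  then obtain F where F: "\<And>C. C \<in> P \<Longrightarrow> closed (F C)" "\<And>C. C \<in> P \<Longrightarrow> F C \<subseteq> C" "\<And>C. C \<in> P \<Longrightarrow> measure \<mu> (C - F C) < \<eta>"
    by metis
  define R where "R x = (if x \<in> F (cell P x) then None else Some (cell P x))" for x
  let ?S = "insert None (Some ` P)"
  have rng: "range R \<subseteq> ?S" using fc(2) by (auto simp: R_def)
  have finS: "finite ?S" using fc(3) by simp
  have RSome: "R -` {Some C} = C - F C" if "C \<in> P" for C
  proof -
    have cc: "cell P x = C \<longleftrightarrow> x \<in> C" for x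
      using cell_eq[OF fc(4) that, of x] cell_in(2)[OF fc(4), of x] by auto
    have "R x = Some C \<longleftrightarrow> cell P x = C \<and> x \<notin> F C" for x by (auto simp: R_def)
    then show ?thesis by (auto simp: cc)
  qed
  have RNone: "R -` {None} = (\<Union>C\<in>P. F C)"
  proof -
    have "R x = None \<longleftrightarrow> x \<in> F (cell P x)" for x by (simp add: R_def)
    moreover have "x \<in> F (cell P x) \<longleftrightarrow> (\<exists>C\<in>P. x \<in> F C)" for x
    proof
      show "x \<in> F (cell P x) \<Longrightarrow> \<exists>C\<in>P. x \<in> F C" using cell_in(1)[OF fc(4), of x] by blast
      assume "\<exists>C\<in>P. x \<in> F C"
      then obtain C where C: "C \<in> P" "x \<in> F C" by blast
      then show "x \<in> F (cell P x)" using cell_eq[OF fc(4) C(1), of x] F(2)[OF C(1)] by auto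
    qed
    ultimately show ?thesis by auto
  qed
  have sC: "C - F C \<in> sets \<mu>" if "C \<in> P" for C
    using that F(1) P st by (auto simp: finite_measurable_partitions_def)
  have sR: "R -` {l} \<in> sets \<mu>" for l
  proof (cases "l \<in> ?S")
    case True
    then show ?thesis
    proof
      assume "l = None"
      then show ?thesis using RNone F(1) fc(3) st by (auto intro!: sets.finite_UN)
    next
      assume "l \<in> Some ` P"
      then show ?thesis using RSome sC by auto
    qed
  next
    case False
    then have "l \<notin> range R" using subsetD[OF rng] by (rule contrapos_nn)
    then have "R -` {l} = {}" by (intro equals0I) (metis rangeI vimage_singleton_eq)
    then show ?thesis by simp
  qed
  have fR: "finite_label \<mu> R" unfolding finite_label_def using sR finite_subset[OF rng finS] by blast
  have pS: "measure \<mu> (R -` {Some C}) < \<eta>" if "C \<in> P" for C using F(3) RSome that by simp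
  have pN: "\<bar>measure \<mu> (R -` {None}) - 1\<bar> < d1"
  proof -
    have "(\<Sum>l\<in>?S. measure \<mu> (R -` {l})) = 1"
    proof -
      have "(\<Sum>l\<in>range R. measure \<mu> (R -` {l})) = (\<Sum>l\<in>?S. measure \<mu> (R -` {l}))"
      proof (rule sum.mono_neutral_left[OF finS rng], rule ballI)
        fix l assume "l \<in> ?S - range R"
        then have "R -` {l} = {}" by auto
        then show "measure \<mu> (R -` {l}) = 0" by simp
      qed
      then show ?thesis using measure_label_sum[OF fR] by simp
    qed
    moreover have "(\<Sum>l\<in>?S. measure \<mu> (R -` {l})) = measure \<mu> (R -` {None}) + (\<Sum>C\<in>P. measure \<mu> (R -` {Some C}))"
      using fc(3) by (subst sum.insert) (auto simp: sum.reindex)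
    moreover have "(\<Sum>C\<in>P. measure \<mu> (R -` {Some C})) \<le> (\<Sum>C\<in>P. \<eta>)"
      using pS by (intro sum_mono) (auto simp: less_imp_le)
    moreover have "(\<Sum>C\<in>P. \<eta>) < d1"
    proof -
      have "(\<Sum>C\<in>P. \<eta>) = real k * \<eta>" by (simp add: k_def)
      also have "\<dots> < (real k + 1) * \<eta>" using \<eta>(1) by simp
      also have "\<dots> \<le> (real k + 1) * (d1 / (real k + 1))" using \<eta>(3) by (intro mult_left_mono) auto
      also have "\<dots> = d1" by simp
      finally show ?thesis .
    qed
    moreover have "measure \<mu> (R -` {None}) \<le> 1" by (rule prob_le_1)
    ultimately show ?thesis by linarith
  qed
  have "label_entropy \<mu> R = (\<Sum>l\<in>?S. xlogx (measure \<mu> (R -` {l})))" by (rule label_entropy_superset[OF finS rng])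
  also have "\<dots> \<le> (\<Sum>l\<in>?S. e')"
  proof (rule sum_mono)
    fix l assume "l \<in> ?S"
    then show "xlogx (measure \<mu> (R -` {l})) \<le> e'"
    proof
      assume "l = None"
      then show ?thesis using d1(2)[OF measure_nonneg pN] by simp
    next
      assume "l \<in> Some ` P"
      then obtain C where "l = Some C" "C \<in> P" by auto
      then show ?thesis using d0(2)[OF measure_nonneg, of \<mu> "R -` {l}"] pS[of C] \<eta>(2) by simp
    qed
  qed
  also have "\<dots> = (real k + 1) * e'"
    using fc(3) by (simp add: k_def card_image)
  also have "\<dots> = e" by (simp add: e'_def)
  finally have "label_entropy \<mu> R \<le> e" .
  then show ?thesis using that[of F] F(1,2) fR unfolding R_def by blast
qed

lemma closed_family_separated:
  fixes F :: "'i \<Rightarrow> 'a::metric_space set"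
  assumes "compact (UNIV :: 'a set)" "finite P" "\<And>C. C \<in> P \<Longrightarrow> closed (F C)"
    "\<And>C D. C \<in> P \<Longrightarrow> D \<in> P \<Longrightarrow> C \<noteq> D \<Longrightarrow> F C \<inter> F D = {}"
  obtains d where "d > 0" "\<And>C D x y. C \<in> P \<Longrightarrow> D \<in> P \<Longrightarrow> x \<in> F C \<Longrightarrow> y \<in> F D \<Longrightarrow> dist x y < d \<Longrightarrow> C = D"
proof -
  have "\<exists>d>0. p \<in> P \<times> P \<longrightarrow> fst p \<noteq> snd p \<longrightarrow> (\<forall>x\<in>F (fst p). \<forall>y\<in>F (snd p). d \<le> dist x y)" for p
  proof (cases "p \<in> P \<times> P \<and> fst p \<noteq> snd p")
    case True
    then have p: "fst p \<in> P" "snd p \<in> P" "fst p \<noteq> snd p" by auto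
    have "compact (F (fst p))" using compact_Int_closed[OF assms(1) assms(3)[OF p(1)]] by simp
    moreover have cl: "closed (F (snd p))" by (rule assms(3)[OF p(2)])
    moreover have disj: "F (fst p) \<inter> F (snd p) = {}" by (rule assms(4)[OF p])
    ultimately have "\<exists>d>0. \<forall>x\<in>F (fst p). \<forall>y\<in>F (snd p). d \<le> dist x y"
    proof (cases "F (fst p) = {} \<or> F (snd p) = {}")
      case False
      have "continuous_on (F (fst p)) (\<lambda>x. infdist x (F (snd p)))" by (intro continuous_intros)
      then obtain z where z: "z \<in> F (fst p)" "\<forall>x\<in>F (fst p). infdist z (F (snd p)) \<le> infdist x (F (snd p))"
        using continuous_attains_inf[OF \<open>compact (F (fst p))\<close>] False by blast
      have "z \<notin> F (snd p)" using z(1) disj by blast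
      then have "infdist z (F (snd p)) > 0"
        using in_closed_iff_infdist_zero[OF cl, of z] False infdist_nonneg[of z "F (snd p)"] by (auto simp: less_le)
      moreover have "infdist z (F (snd p)) \<le> dist x y" if "x \<in> F (fst p)" "y \<in> F (snd p)" for x y
        using z(2) that infdist_le[of y "F (snd p)" x] by force
      ultimately show ?thesis by blast
    qed (auto intro: exI[of _ 1])
    then show ?thesis by blast
  qed (auto intro: exI[of _ 1])
  then obtain d where d: "\<And>p. d p > 0"
    "\<And>p. p \<in> P \<times> P \<Longrightarrow> fst p \<noteq> snd p \<Longrightarrow> \<forall>x\<in>F (fst p). \<forall>y\<in>F (snd p). d p \<le> dist x y" by metis
  define d' where "d' = Min (insert 1 (d ` (P \<times> P)))"
  have fin: "finite (insert 1 (d ` (P \<times> P)))" using assms(2) by simp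
  show ?thesis
  proof (rule that[of d'])
    show "d' > 0" unfolding d'_def using fin d(1) by (subst Min_gr_iff) auto
    fix C D x y assume CD: "C \<in> P" "D \<in> P" "x \<in> F C" "y \<in> F D" "dist x y < d'"
    show "C = D"
    proof (rule ccontr)
      assume "C \<noteq> D"
      then have "d (C, D) \<le> dist x y" using d(2)[of "(C, D)"] CD by auto
      moreover have "d' \<le> d (C, D)" unfolding d'_def using fin CD by (intro Min_le) auto
      ultimately show False using CD(5) by simp
    qed
  qed
qed

lemma integrable_invariant:
  fixes f :: "'a::metric_space \<Rightarrow> real"
  assumes "compact (UNIV :: 'a set)" "\<mu> \<in> invariant_measures \<alpha>" "continuous_on UNIV f"
  shows "integrable \<mu> f"
proof -
  interpret finite_measure \<mu> by (rule invariant_measuresD(2)[OF assms(2)])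
  obtain B where B: "\<And>x. \<bar>f x\<bar> \<le> B"
    by (rule bounded_range_of_compact[OF assms(1,3)]) (rule that)
  show ?thesis
    using B borel_measurable_continuous_onI[OF assms(3)]
    by (intro integrable_const_bound[of _ B])
      (auto simp: measurable_cong_sets[OF invariant_measuresD(3)[OF assms(2)] refl])
qed

lemma integral_funpow_invariant:
  fixes f :: "'a::metric_space \<Rightarrow> real"
  assumes "compact (UNIV :: 'a set)" "\<mu> \<in> invariant_measures \<alpha>" "continuous_on UNIV \<alpha>" "continuous_on UNIV f"
  shows "(\<integral>x. f ((\<alpha> ^^ n) x) \<partial>\<mu>) = integral\<^sup>L \<mu> f"
proof (induction n)
  case (Suc n)
  have c: "continuous_on UNIV (\<lambda>x. f ((\<alpha> ^^ n) x))" by (rule continuous_on_compose_funpow[OF assms(3,4)])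
  have ma: "\<alpha> \<in> measurable \<mu> borel"
    using borel_measurable_continuous_onI[OF assms(3)]
    by (simp add: measurable_cong_sets[OF invariant_measuresD(3)[OF assms(2)] refl])
  have "(\<integral>x. f ((\<alpha> ^^ Suc n) x) \<partial>\<mu>) = (\<integral>x. f ((\<alpha> ^^ n) (\<alpha> x)) \<partial>\<mu>)" by (simp add: funpow_swap1)
  also have "\<dots> = integral\<^sup>L (distr \<mu> borel \<alpha>) (\<lambda>x. f ((\<alpha> ^^ n) x))"
    by (rule integral_distr[OF ma borel_measurable_continuous_onI[OF c], symmetric])
  also have "\<dots> = (\<integral>x. f ((\<alpha> ^^ n) x) \<partial>\<mu>)" unfolding invariant_measuresD(5)[OF assms(2)] ..
  finally show ?case using Suc by simp
qed simp

context non_contracting_system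
begin

text \<open>A point is coded by an n-th preimage z of a net point whose orbit shadows its own. The
  Gibbs inequality is used with weights proportional to the product q(z) of v along z; these total
  at most card C times R. Within a code cell ln q varies by at most n \<kappa>, so the integral of
  the Birkhoff sum cancels the Gibbs term up to this error. The value \<open>None\<close> occurs
  only off K, on a null set.\<close>

lemma entropy_of_code_le:
  assumes m: "\<mu> \<in> invariant_measures \<alpha>" and v: "continuous_on UNIV v" "\<And>x. 0 < v x"
    and \<delta>: "\<And>y z. dist y z < \<delta> \<Longrightarrow> \<bar>ln (v y) - ln (v z)\<bar> \<le> \<kappa>"
    and C: "finite C" "C \<subseteq> K" and R: "\<And>x. preimage_sum K \<alpha> v n x \<le> R"
    and zs: "set zs = {z \<in> K. (\<alpha> ^^ n) z \<in> C}"
    and f: "\<And>y. y \<in> K \<Longrightarrow> \<exists>z\<in>set zs. \<forall>i\<le>n. dist ((\<alpha> ^^ i) y) ((\<alpha> ^^ i) z) < \<delta>"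
    and code: "code = (\<lambda>y. find (\<lambda>z. y \<in> {y. \<forall>i\<le>n. dist ((\<alpha> ^^ i) y) ((\<alpha> ^^ i) z) < \<delta>}) zs)"
  shows "finite_label \<mu> code"
    "label_entropy \<mu> code + real n * integral\<^sup>L \<mu> (\<lambda>x. ln (v x)) \<le> ln (real (card C) * R) + real n * \<kappa>"
proof -
  interpret full_prob_space \<mu> by (rule full_prob_space_invariant[OF m])
  note st = invariant_measuresD(3)[OF m]
  have "{y. \<forall>i\<le>n. dist ((\<alpha> ^^ i) y) ((\<alpha> ^^ i) z) < \<delta>} \<in> sets \<mu>" for z
  proof -
    have "open (\<Inter>i\<in>{..n}. {y. dist ((\<alpha> ^^ i) y) ((\<alpha> ^^ i) z) < \<delta>})"
      by (intro open_INT ballI open_Collect_less continuous_intros continuous_on_funpow cont) auto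
    moreover have "{y. \<forall>i\<le>n. dist ((\<alpha> ^^ i) y) ((\<alpha> ^^ i) z) < \<delta>} = (\<Inter>i\<in>{..n}. {y. dist ((\<alpha> ^^ i) y) ((\<alpha> ^^ i) z) < \<delta>})" by auto
    ultimately show ?thesis using st by simp
  qed
  then show fl: "finite_label \<mu> code" unfolding code by (intro finite_label_find space_UNIV)
  define S where "S = set zs"
  have finS: "finite S" by (simp add: S_def)
  have SK: "S \<subseteq> K" using zs by (auto simp: S_def)
  have code_Some: "z \<in> S \<and> (\<forall>i\<le>n. dist ((\<alpha> ^^ i) y) ((\<alpha> ^^ i) z) < \<delta>)" if "code y = Some z" for y z
    using that unfolding code S_def by (auto simp: find_Some_iff)
  have code_K: "code y \<noteq> None" if "y \<in> K" for y
    using f[OF that] unfolding code by (auto simp: find_None_iff)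
  let ?S = "insert None (Some ` S)"
  have rng: "range code \<subseteq> ?S"
  proof clarify
    fix y assume "code y \<notin> Some ` S"
    then show "code y = None" using code_Some[of y] by (cases "code y") auto
  qed
  let ?p = "\<lambda>z. measure \<mu> (code -` {Some z})"
  have pN: "measure \<mu> (code -` {None}) = 0"
  proof -
    have "AE x in \<mu>. x \<notin> code -` {None}"
      using AE_essential[OF compact_space m] by (rule eventually_mono) (use code_K in auto)
    then have "emeasure \<mu> (code -` {None}) = 0"
      using finite_labelD(2)[OF fl, of None] by (subst (asm) AE_iff_measurable[of "code -` {None}"]) (auto simp: space_UNIV)
    then show ?thesis by (simp add: measure_def)
  qed
  have sum_insert: "(\<Sum>l\<in>?S. h l) = h None + (\<Sum>z\<in>S. h (Some z))" for h :: "_ \<Rightarrow> real"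
    using finS by (subst sum.insert) (auto simp: sum.reindex)
  have p1: "(\<Sum>z\<in>S. ?p z) = 1"
  proof -
    have "(\<Sum>l\<in>range code. measure \<mu> (code -` {l})) = (\<Sum>l\<in>?S. measure \<mu> (code -` {l}))"
    proof (rule sum.mono_neutral_left[OF _ rng], use finS in simp, rule ballI)
      fix l assume "l \<in> ?S - range code"
      then have "code -` {l} = {}" by auto
      then show "measure \<mu> (code -` {l}) = 0" by simp
    qed
    then show ?thesis using measure_label_sum[OF fl] pN unfolding sum_insert by simp
  qed
  define q where "q z = (\<Prod>i<n. v ((\<alpha> ^^ i) z))" for z
  have q0: "q z > 0" for z unfolding q_def using v(2) by (intro prod_pos) auto
  have ln_q: "ln (q z) = (\<Sum>i<n. ln (v ((\<alpha> ^^ i) z)))" for z unfolding q_def using v(2) by (subst ln_prod) (auto simp: less_le)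
  define T where "T = (\<Sum>z\<in>S. q z)"
  have "S \<noteq> {}" using p1 by auto
  then have T0: "T > 0" unfolding T_def using finS q0 by (intro sum_pos) auto
  have "T \<le> real (card C) * R"
  proof -
    have "S = (\<Union>c\<in>C. {z. z \<in> K \<and> (\<alpha> ^^ n) z = c})" using zs by (auto simp: S_def)
    then have "T = (\<Sum>c\<in>C. preimage_sum K \<alpha> v n c)"
      unfolding T_def preimage_sum_def q_def
      by (simp only:) (rule sum.UNION_disjoint, use C(1) finite_preimages[of K \<alpha>, OF finite_fiber K_forward] in auto)
    also have "\<dots> \<le> (\<Sum>c\<in>C. R)" by (intro sum_mono R)
    finally show ?thesis by simp
  qed
  then have lnT: "ln T \<le> ln (real (card C) * R)" using T0 by simp
  have "label_entropy \<mu> code = (\<Sum>z\<in>S. xlogx (?p z))"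
    using pN by (subst label_entropy_superset[OF _ rng]) (use finS in \<open>auto simp: sum_insert xlogx_def\<close>)
  also have "\<dots> \<le> (\<Sum>z\<in>S. - (?p z * ln (q z / T)))"
  proof (rule gibbs[OF finS])
    have "(\<Sum>z\<in>S. q z / T) = 1" using T0 by (simp add: sum_divide_distrib[symmetric] T_def)
    then show "(\<Sum>z\<in>S. q z / T) \<le> (\<Sum>z\<in>S. ?p z)" using p1 by simp
  qed (use q0 T0 in \<open>auto simp: less_imp_le\<close>)
  also have "\<dots> = (\<Sum>z\<in>S. ?p z * ln T) - (\<Sum>z\<in>S. ?p z * ln (q z))"
    unfolding sum_subtractf[symmetric]
  proof (intro sum.cong refl)
    fix z
    have "ln (q z / T) = ln (q z) - ln T" using q0[of z] T0 by (simp add: ln_div)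
    then show "- (?p z * ln (q z / T)) = ?p z * ln T - ?p z * ln (q z)"
      by (simp only:) (simp add: algebra_simps)
  qed
  also have "(\<Sum>z\<in>S. ?p z * ln T) = ln T" using p1 by (simp add: sum_distrib_right[symmetric])
  finally have 1: "label_entropy \<mu> code \<le> ln T - (\<Sum>z\<in>S. ?p z * ln (q z))" .
  have clnv: "continuous_on UNIV (\<lambda>x. ln (v x))" using v by (intro continuous_intros) (auto simp: less_le)
  have clnq: "continuous_on UNIV (\<lambda>x. ln (q x))"
    unfolding ln_q by (intro continuous_on_sum continuous_on_compose_funpow[OF cont clnv])
  have "real n * integral\<^sup>L \<mu> (\<lambda>x. ln (v x)) = (\<Sum>i<n. \<integral>x. ln (v ((\<alpha> ^^ i) x)) \<partial>\<mu>)"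
    using integral_funpow_invariant[OF compact_space m cont clnv] by simp
  also have "\<dots> = (\<integral>x. ln (q x) \<partial>\<mu>)"
    unfolding ln_q
    by (rule Bochner_Integration.integral_sum[symmetric])
      (rule integrable_invariant[OF compact_space m continuous_on_compose_funpow[OF cont clnv]])
  \<comment> \<open>The Birkhoff sum is replaced by a step function taking on each code cell the
    value at the shadowing orbit; its integral contains exactly the sum of p(z) ln q(z) left over by
    the Gibbs inequality.\<close>
  also have "\<dots> \<le> (\<integral>x. (\<Sum>z\<in>S. indicator (code -` {Some z}) x * (ln (q z) + real n * \<kappa>)) \<partial>\<mu>)"
  proof (rule integral_mono_AE)
    show "integrable \<mu> (\<lambda>x. ln (q x))" by (rule integrable_invariant[OF compact_space m clnq])
    show "integrable \<mu> (\<lambda>x. \<Sum>z\<in>S. indicator (code -` {Some z}) x * (ln (q z) + real n * \<kappa>))"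
      using finite_labelD(2)[OF fl]
      by (intro Bochner_Integration.integrable_sum integrable_mult_left integrable_real_indicator) (auto simp: emeasure_eq_measure)
    show "AE x in \<mu>. ln (q x) \<le> (\<Sum>z\<in>S. indicator (code -` {Some z}) x * (ln (q z) + real n * \<kappa>))"
      using AE_essential[OF compact_space m]
    proof (rule eventually_mono)
      fix x assume "x \<in> K"
      then obtain z where z: "code x = Some z" using code_K by blast
      then have zS: "z \<in> S" and d: "\<And>i. i \<le> n \<Longrightarrow> dist ((\<alpha> ^^ i) x) ((\<alpha> ^^ i) z) < \<delta>" using code_Some by blast+
      have "ln (q x) - ln (q z) = (\<Sum>i<n. ln (v ((\<alpha> ^^ i) x)) - ln (v ((\<alpha> ^^ i) z)))"
        unfolding ln_q by (simp add: sum_subtractf)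
      also have "\<dots> \<le> (\<Sum>i<n. \<kappa>)"
      proof (rule sum_mono)
        fix i assume "i \<in> {..<n}"
        then show "ln (v ((\<alpha> ^^ i) x)) - ln (v ((\<alpha> ^^ i) z)) \<le> \<kappa>" using \<delta>[OF d[of i]] by simp
      qed
      finally have "ln (q x) \<le> ln (q z) + real n * \<kappa>" by simp
      also have "\<dots> = (\<Sum>u\<in>S. if u = z then ln (q u) + real n * \<kappa> else 0)" using finS zS by simp
      also have "\<dots> = (\<Sum>u\<in>S. indicator (code -` {Some u}) x * (ln (q u) + real n * \<kappa>))"
        using z by (intro sum.cong) (auto simp: indicator_def)
      finally show "ln (q x) \<le> (\<Sum>z\<in>S. indicator (code -` {Some z}) x * (ln (q z) + real n * \<kappa>))" .
    qed
  qed
  also have "\<dots> = (\<Sum>z\<in>S. \<integral>x. indicator (code -` {Some z}) x * (ln (q z) + real n * \<kappa>) \<partial>\<mu>)"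
    using finite_labelD(2)[OF fl]
    by (intro Bochner_Integration.integral_sum integrable_mult_left integrable_real_indicator) (auto simp: emeasure_eq_measure)
  also have "\<dots> = (\<Sum>z\<in>S. ?p z * (ln (q z) + real n * \<kappa>))"
    using finite_labelD(2)[OF fl] by simp
  also have "\<dots> = (\<Sum>z\<in>S. ?p z * ln (q z)) + (\<Sum>z\<in>S. ?p z) * (real n * \<kappa>)"
    by (simp add: distrib_left sum.distrib sum_distrib_right)
  finally show "label_entropy \<mu> code + real n * integral\<^sup>L \<mu> (\<lambda>x. ln (v x)) \<le> ln (real (card C) * R) + real n * \<kappa>"
    using 1 lnT p1 by simp
qed

text \<open>Almost everywhere the code and the itinerary of R determine the itinerary of P: at each
  time R either names the cell, or both points lie in closed cores less than d1 apart, hence in the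
  same core. The itinerary of R costs at most e/2 per step, and so does the oscillation of ln
  v.\<close>

theorem entropy_rate_upper_bound:
  assumes m: "\<mu> \<in> invariant_measures \<alpha>" and P: "P \<in> finite_measurable_partitions \<mu>"
    and v: "continuous_on UNIV v" "\<And>x. 0 < v x"
    and B: "0 < B" "0 < q" "\<And>n x. preimage_sum K \<alpha> v n x \<le> B * q ^ n"
  shows "partition_entropy_rate \<mu> \<alpha> P + integral\<^sup>L \<mu> (\<lambda>x. ln (v x)) \<le> ln q"
proof (rule field_le_epsilon)
  fix e :: real assume e: "e > 0"
  interpret full_prob_space \<mu> by (rule full_prob_space_invariant[OF m])
  note st = invariant_measuresD(3)[OF m]
  note fc = finite_label_cell[OF m P]
  let ?I = "integral\<^sup>L \<mu> (\<lambda>x. ln (v x))"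
  obtain F where F: "\<And>C. C \<in> P \<Longrightarrow> closed (F C)" "\<And>C. C \<in> P \<Longrightarrow> F C \<subseteq> C"
    "finite_label \<mu> (\<lambda>x. if x \<in> F (cell P x) then None else Some (cell P x))"
    "label_entropy \<mu> (\<lambda>x. if x \<in> F (cell P x) then None else Some (cell P x)) \<le> e / 2"
    by (rule closed_core_partition[OF m P half_gt_zero[OF e]]) (rule that)
  define R where "R x = (if x \<in> F (cell P x) then None else Some (cell P x))" for x
  have R: "finite_label \<mu> R" "label_entropy \<mu> R \<le> e / 2" using F(3,4) unfolding R_def by auto
  have disj: "F C \<inter> F D = {}" if "C \<in> P" "D \<in> P" "C \<noteq> D" for C D
  proof -
    have "C \<inter> D = {}" using partition_onD2[OF fc(4)] that by (auto simp: disjoint_def)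
    then show ?thesis using F(2)[OF that(1)] F(2)[OF that(2)] by blast
  qed
  obtain d1 where d1: "d1 > 0" "\<And>C D x y. C \<in> P \<Longrightarrow> D \<in> P \<Longrightarrow> x \<in> F C \<Longrightarrow> y \<in> F D \<Longrightarrow> dist x y < d1 \<Longrightarrow> C = D"
    by (rule closed_family_separated[OF compact_space fc(3) F(1) disj]) (assumption | rule that)+
  have clnv: "continuous_on UNIV (\<lambda>x. ln (v x))" using v by (intro continuous_intros) (auto simp: less_le)
  have "uniformly_continuous_on UNIV (\<lambda>x. ln (v x))" by (rule compact_uniformly_continuous[OF clnv compact_space])
  then obtain d2 where d2: "d2 > 0" "\<And>y z. dist y z < d2 \<Longrightarrow> dist (ln (v y)) (ln (v z)) < e / 2"
    using half_gt_zero[OF e] unfolding uniformly_continuous_on_def by (metis UNIV_I dist_commute)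
  obtain d0 where d0: "d0 > 0"
    "\<And>y x. y \<in> K \<Longrightarrow> x \<in> K \<Longrightarrow> dist (\<alpha> y) x < d0 \<Longrightarrow> \<exists>y'\<in>K. \<alpha> y' = x \<and> dist y y' \<le> dist (\<alpha> y) x"
    by (rule lift_point) (rule that)
  \<comment> \<open>d0 permits lifting, d2 controls the oscillation of ln v, and d1 is halved
    because two points with the same code are each within \<delta> of the same orbit.\<close>
  define \<delta> where "\<delta> = min d0 (min (d1 / 2) d2)"
  have \<delta>: "\<delta> > 0" "\<delta> \<le> d0" "\<delta> \<le> d1 / 2" "\<delta> \<le> d2" using d0(1) d1(1) d2(1) by (auto simp: \<delta>_def)
  have \<delta>v: "\<bar>ln (v y) - ln (v z)\<bar> \<le> e / 2" if "dist y z < \<delta>" for y z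
    using d2(2)[of y z] that \<delta>(4) by (simp add: dist_real_def)
  obtain C where C: "finite C" "C \<subseteq> K" "K \<subseteq> (\<Union>c\<in>C. ball c \<delta>)"
    by (rule K_net[OF \<delta>(1)]) (rule that)
  have bound: "label_entropy \<mu> (itinerary \<alpha> (cell P) n) + real n * ?I \<le> ln (real (card C) * (B * q ^ n)) + real n * e" for n
  proof -
    have "{z \<in> K. (\<alpha> ^^ n) z \<in> C} = (\<Union>c\<in>C. {z. z \<in> K \<and> (\<alpha> ^^ n) z = c})" by auto
    then have "finite {z \<in> K. (\<alpha> ^^ n) z \<in> C}"
      using C(1) finite_preimages[of K \<alpha>, OF finite_fiber K_forward] by simp
    then obtain zs where zs: "set zs = {z \<in> K. (\<alpha> ^^ n) z \<in> C}" using finite_list by blast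
    define code where "code = (\<lambda>y. find (\<lambda>z. y \<in> {y. \<forall>i\<le>n. dist ((\<alpha> ^^ i) y) ((\<alpha> ^^ i) z) < \<delta>}) zs)"
    have shadow: "\<exists>z\<in>set zs. \<forall>i\<le>n. dist ((\<alpha> ^^ i) y) ((\<alpha> ^^ i) z) < \<delta>" if y: "y \<in> K" for y
    proof -
      have "(\<alpha> ^^ n) y \<in> K" by (rule funpow_in[of K \<alpha>, OF K_forward y])
      then obtain c where c: "c \<in> C" "dist ((\<alpha> ^^ n) y) c < \<delta>" using C(3) by (auto simp: dist_commute dest!: subsetD)
      have cK: "c \<in> K" "dist ((\<alpha> ^^ n) y) c < d0" using c C(2) \<delta>(2) by auto
      obtain y' where "y' \<in> K" "(\<alpha> ^^ n) y' = c" "\<forall>i\<le>n. dist ((\<alpha> ^^ i) y) ((\<alpha> ^^ i) y') \<le> dist ((\<alpha> ^^ n) y) c"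
        using shadow_point[OF d0(2) y cK] by blast
      then show ?thesis using c unfolding zs by (intro bexI[of _ y']) (auto intro: le_less_trans)
    qed
    note code = entropy_of_code_le[OF m v \<delta>v C(1,2) B(3) zs shadow code_def]
    have flR: "finite_label \<mu> (itinerary \<alpha> R n)" by (rule finite_label_itinerary[OF m cont R(1)])
    have code_near: "dist ((\<alpha> ^^ i) y) ((\<alpha> ^^ i) z) < \<delta>" if "code y = Some z" "i \<le> n" for y z i
      using that unfolding code_def by (auto simp: find_Some_iff)
    have code_K: "code y \<noteq> None" if "y \<in> K" for y
      using shadow[OF that] unfolding code_def by (auto simp: find_None_iff)
    \<comment> \<open>The code \<open>None\<close> does not determine an itinerary. On this null set
      the label is made constant, which leaves the entropy unchanged.\<close>
    define X where "X x = (if code x = None then [] else itinerary \<alpha> (cell P) n x)" for x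
    have flcR: "finite_label \<mu> (\<lambda>x. (code x, itinerary \<alpha> R n x))" by (rule finite_label_Pair[OF code(1) flR])
    have det: "X x = X y" if eq: "(code x, itinerary \<alpha> R n x) = (code y, itinerary \<alpha> R n y)" for x y
    proof (cases "code x")
      case None
      then show ?thesis using eq by (simp add: X_def)
    next
      case (Some z)
      have "itinerary \<alpha> (cell P) n x = itinerary \<alpha> (cell P) n y"
        unfolding itinerary_eq_iff
      proof (intro allI impI)
        fix i assume i: "i < n"
        let ?x = "(\<alpha> ^^ i) x" and ?y = "(\<alpha> ^^ i) y"
        have Req: "R ?x = R ?y" using eq i by (simp add: itinerary_eq_iff)
        have "dist ?x ((\<alpha> ^^ i) z) < \<delta>" "dist ?y ((\<alpha> ^^ i) z) < \<delta>"
          using code_near[of x z i] code_near[of y z i] Some eq i by auto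
        then have "dist ?x ?y < d1" using dist_triangle2[of ?x ?y "(\<alpha> ^^ i) z"] \<delta>(3) by linarith
        then show "cell P ?x = cell P ?y"
          using Req d1(2)[OF cell_in(1)[OF fc(4)] cell_in(1)[OF fc(4)], of ?x ?x ?y ?y]
          by (simp add: R_def split: if_splits)
      qed
      then show ?thesis using eq Some by (simp add: X_def)
    qed
    have "label_entropy \<mu> (itinerary \<alpha> (cell P) n) = label_entropy \<mu> X"
    proof (rule label_entropy_cong_AE)
      show "AE x in \<mu>. itinerary \<alpha> (cell P) n x = X x"
        using AE_essential[OF compact_space m] by (rule eventually_mono) (simp add: X_def code_K)
    qed (rule finite_label_itinerary[OF m cont fc(1)], rule label_entropy_mono(1)[OF flcR det])
    also have "\<dots> \<le> label_entropy \<mu> (\<lambda>x. (code x, itinerary \<alpha> R n x))"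
      by (rule label_entropy_mono(2)[OF flcR det])
    also have "\<dots> \<le> label_entropy \<mu> code + label_entropy \<mu> (itinerary \<alpha> R n)"
      by (rule label_entropy_Pair[OF code(1) flR])
    also have "label_entropy \<mu> (itinerary \<alpha> R n) \<le> (\<Sum>i\<leftarrow>[0..<n]. label_entropy \<mu> (\<lambda>x. R ((\<alpha> ^^ i) x)))"
      unfolding itinerary_def by (intro label_entropy_map finite_label_shift st cont R)
    also have "\<dots> = real n * label_entropy \<mu> R"
      unfolding label_entropy_shift[OF m cont R(1)] by (simp add: sum_list_triv)
    also have "\<dots> \<le> real n * (e / 2)" using R(2) by (intro mult_left_mono) auto
    finally show ?thesis using code(2) by (simp add: algebra_simps)
  qed
  have cardC: "card C > 0"
  proof (rule ccontr)
    assume "\<not> ?thesis"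
    then have "K = {}" using C by (auto simp: card_gt_0_iff)
    then have "AE x in \<mu>. False" using AE_essential[OF compact_space m] by simp
    then show False using prob_space by (auto simp: AE_iff_measurable[of UNIV] space_UNIV emeasure_eq_measure)
  qed
  have ev: "label_entropy \<mu> (itinerary \<alpha> (cell P) n) / real n + ?I \<le> ln (real (card C) * B) / real n + (ln q + e)"
    if n: "n \<ge> 1" for n
  proof -
    have "ln (real (card C) * (B * q ^ n)) = ln (real (card C) * B) + real n * ln q"
      using cardC B(1,2) by (simp add: ln_mult ln_realpow)
    then have "label_entropy \<mu> (itinerary \<alpha> (cell P) n) + real n * ?I \<le> ln (real (card C) * B) + real n * (ln q + e)"
      using bound[of n] by (simp add: algebra_simps)
    then have "(label_entropy \<mu> (itinerary \<alpha> (cell P) n) + real n * ?I) / real n \<le> (ln (real (card C) * B) + real n * (ln q + e)) / real n"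
      by (intro divide_right_mono) auto
    then show ?thesis using n by (simp add: add_divide_distrib)
  qed
  have "(\<lambda>n. label_entropy \<mu> (itinerary \<alpha> (cell P) n) / real n + ?I) \<longlonglongrightarrow> partition_entropy_rate \<mu> \<alpha> P + ?I"
    by (intro tendsto_add partition_entropy_rate_tendsto[OF m cont P] tendsto_const)
  moreover have "(\<lambda>n. ln (real (card C) * B) / real n + (ln q + e)) \<longlonglongrightarrow> 0 + (ln q + e)"
    by (intro tendsto_add lim_const_over_n tendsto_const)
  ultimately have "partition_entropy_rate \<mu> \<alpha> P + ?I \<le> 0 + (ln q + e)"
    by (rule LIMSEQ_le) (use ev in blast)
  then show "partition_entropy_rate \<mu> \<alpha> P + ?I \<le> ln q + e" by simp
qed

end

section \<open>Logarithmic integrals\<close>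

lemma ereal_integral_eq:
  fixes f :: "'a \<Rightarrow> real"
  assumes "integrable M f"
  shows "ereal (integral\<^sup>L M f) = enn2ereal (\<integral>\<^sup>+x. ennreal (f x) \<partial>M) - enn2ereal (\<integral>\<^sup>+x. ennreal (- f x) \<partial>M)"
proof -
  have fin: "(\<integral>\<^sup>+x. ennreal (f x) \<partial>M) < top" "(\<integral>\<^sup>+x. ennreal (- f x) \<partial>M) < top"
    using assms by (auto simp: real_integrable_def less_top)
  have r: "enn2ereal p = ereal (enn2real p)" if "p < top" for p
    using that by (metis enn2ereal_ennreal enn2real_nonneg ennreal_enn2real)
  show ?thesis unfolding r[OF fin(1)] r[OF fin(2)] real_lebesgue_integral_def[OF assms] by simp
qed

lemma e2ennreal_ln_ereal:
  "a > 0 \<Longrightarrow> e2ennreal (ln_ereal a) = ennreal (ln a)" "a > 0 \<Longrightarrow> e2ennreal (- ln_ereal a) = ennreal (- ln a)"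
  "\<not> a > 0 \<Longrightarrow> e2ennreal (ln_ereal a) = 0" "\<not> a > 0 \<Longrightarrow> e2ennreal (- ln_ereal a) = top"
  by (simp_all add: ln_ereal_def e2ennreal_ereal e2ennreal_neg e2ennreal_infty)

lemma continuous_on_ln_max:
  fixes a :: "'a::topological_space \<Rightarrow> real"
  assumes "continuous_on UNIV a" "\<epsilon> > 0"
  shows "continuous_on UNIV (\<lambda>x. ln (max (a x) \<epsilon>))"
  using assms by (intro continuous_intros) (auto simp: max_def)

lemma ln_integral_le_regularized:
  fixes a :: "'a::metric_space \<Rightarrow> real"
  assumes cX: "compact (UNIV :: 'a set)" and m: "\<mu> \<in> invariant_measures \<alpha>" and a: "continuous_on UNIV a" and e: "\<epsilon> > 0"
  shows "ln_integral \<mu> a \<le> ereal (\<integral>x. ln (max (a x) \<epsilon>) \<partial>\<mu>)"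
proof -
  have int: "integrable \<mu> (\<lambda>x. ln (max (a x) \<epsilon>))"
    by (rule integrable_invariant[OF cX m continuous_on_ln_max[OF a e]])
  have 1: "e2ennreal (ln_ereal (a x)) \<le> ennreal (ln (max (a x) \<epsilon>))" for x
    by (cases "a x > 0") (auto simp: e2ennreal_ln_ereal intro!: ennreal_leI)
  have 2: "ennreal (- ln (max (a x) \<epsilon>)) \<le> e2ennreal (- ln_ereal (a x))" for x
    by (cases "a x > 0") (auto simp: e2ennreal_ln_ereal intro!: ennreal_leI)
  show ?thesis
    unfolding ln_integral_def ereal_integral_eq[OF int]
    by (intro ereal_minus_mono) (auto simp: less_eq_ennreal.rep_eq[symmetric] intro!: nn_integral_mono 1 2)
qed

text \<open>For \<epsilon> \<le> 1 the regularization leaves the positive part of the logarithm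
  untouched. The negative parts increase along \<epsilon> = 1/(k+1), so monotone convergence carries
  the uniform bound to the limit; in particular the integral is not -\<infinity>.\<close>

lemma ln_integral_ge_regularized:
  fixes a :: "'a::metric_space \<Rightarrow> real"
  assumes cX: "compact (UNIV :: 'a set)" and m: "\<mu> \<in> invariant_measures \<alpha>" and a: "continuous_on UNIV a"
    and c: "\<And>\<epsilon>. 0 < \<epsilon> \<Longrightarrow> \<epsilon> \<le> 1 \<Longrightarrow> c \<le> (\<integral>x. ln (max (a x) \<epsilon>) \<partial>\<mu>)"
  shows "ereal c \<le> ln_integral \<mu> a"
proof -
  define \<epsilon> where "\<epsilon> k = 1 / real (Suc k)" for k
  have e: "0 < \<epsilon> k" "\<epsilon> k \<le> 1" for k by (auto simp: \<epsilon>_def)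
  define f where "f k x = ln (max (a x) (\<epsilon> k))" for k x
  have int: "integrable \<mu> (f k)" for k
    unfolding f_def by (rule integrable_invariant[OF cX m continuous_on_ln_max[OF a e(1)]])
  define p where "p = (\<integral>\<^sup>+x. e2ennreal (ln_ereal (a x)) \<partial>\<mu>)"
  have pk: "(\<integral>\<^sup>+x. ennreal (f k x) \<partial>\<mu>) = p" for k
    unfolding p_def
  proof (intro nn_integral_cong)
    fix x
    show "ennreal (f k x) = e2ennreal (ln_ereal (a x))"
    proof (cases "a x > \<epsilon> k")
      case True
      then have "a x > 0" using e(1)[of k] by linarith
      then show ?thesis using True by (simp add: f_def e2ennreal_ln_ereal)
    next
      case False
      then have "f k x \<le> 0" using e[of k] by (simp add: f_def max_def)
      moreover have "e2ennreal (ln_ereal (a x)) = 0"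
      proof (cases "a x > 0")
        case True
        then have "ln (a x) \<le> 0" using False e(2)[of k] by simp
        then show ?thesis using True by (simp add: e2ennreal_ln_ereal ennreal_neg)
      qed (simp add: e2ennreal_ln_ereal)
      ultimately show ?thesis by (simp add: ennreal_neg)
    qed
  qed
  have pfin: "p < top" using int[of 0] unfolding real_integrable_def pk by (simp add: less_top)
  define P where "P = enn2real p"
  have P: "p = ennreal P" "P \<ge> 0" using pfin by (auto simp: P_def)
  have nk: "(\<integral>\<^sup>+x. ennreal (- f k x) \<partial>\<mu>) \<le> ennreal (P - c)" for k
  proof -
    have fin: "(\<integral>\<^sup>+x. ennreal (- f k x) \<partial>\<mu>) < top" using int[of k] unfolding real_integrable_def by (simp add: less_top)
    define n where "n = enn2real (\<integral>\<^sup>+x. ennreal (- f k x) \<partial>\<mu>)"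
    have n: "(\<integral>\<^sup>+x. ennreal (- f k x) \<partial>\<mu>) = ennreal n" "n \<ge> 0" using fin by (auto simp: n_def)
    have "c \<le> integral\<^sup>L \<mu> (f k)" unfolding f_def by (rule c[OF e])
    also have "integral\<^sup>L \<mu> (f k) = P - n" unfolding real_lebesgue_integral_def[OF int] pk P_def n_def ..
    finally show ?thesis unfolding n(1) by (intro ennreal_leI) simp
  qed
  have sup: "e2ennreal (- ln_ereal (a x)) = (SUP k. ennreal (- f k x))" for x
  proof (cases "a x > 0")
    case True
    then obtain k where k: "inverse (real (Suc k)) < a x" using reals_Archimedean by blast
    have le: "ennreal (- f j x) \<le> ennreal (- ln (a x))" for j
      using True by (intro ennreal_leI) (simp add: f_def)
    have eq: "ennreal (- f k x) = ennreal (- ln (a x))" using k by (simp add: f_def \<epsilon>_def inverse_eq_divide max_def)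
    have "(SUP k. ennreal (- f k x)) = ennreal (- ln (a x))"
      by (rule antisym) (auto intro!: SUP_least le SUP_upper2[of k] simp: eq)
    then show ?thesis using True by (simp add: e2ennreal_ln_ereal)
  next
    case False
    have f: "- f k x = ln (real (Suc k))" for k
    proof -
      have "max (a x) (\<epsilon> k) = \<epsilon> k" using False e(1)[of k] by simp
      then show ?thesis by (simp add: f_def \<epsilon>_def ln_div)
    qed
    have sup_top: "(SUP k. ennreal (- f k x)) = top"
    proof (rule ennreal_SUP_eq_top)
      fix n :: nat
      obtain N :: nat where "exp (real n) < real N" using reals_Archimedean2 by blast
      then have "exp (real n) \<le> real (Suc N)" by simp
      then have "real n \<le> ln (real (Suc N))" by (subst ln_ge_iff) auto
      then show "\<exists>i\<in>UNIV. of_nat n \<le> ennreal (- f i x)"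
        unfolding f by (intro bexI[of _ N]) (auto simp: ennreal_of_nat_eq_real_of_nat intro!: ennreal_leI)
    qed
    show ?thesis by (simp only: e2ennreal_ln_ereal(4)[OF False] sup_top)
  qed
  have "(\<integral>\<^sup>+x. e2ennreal (- ln_ereal (a x)) \<partial>\<mu>) = (SUP k. \<integral>\<^sup>+x. ennreal (- f k x) \<partial>\<mu>)"
    unfolding sup
  proof (rule nn_integral_monotone_convergence_SUP)
    show "incseq (\<lambda>k x. ennreal (- f k x))"
    proof (intro incseq_SucI le_funI ennreal_leI)
      fix k x
      have "\<epsilon> (Suc k) \<le> \<epsilon> k" by (simp add: \<epsilon>_def frac_le)
      then show "- f k x \<le> - f (Suc k) x" using e(1)[of "Suc k"] e(1)[of k] by (auto simp: f_def max_def)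
    qed
    show "(\<lambda>x. ennreal (- f k x)) \<in> borel_measurable \<mu>" for k
      using borel_measurable_integrable[OF int[of k]] by measurable
  qed
  also have "\<dots> \<le> ennreal (P - c)" by (intro SUP_least nk)
  finally have nle: "(\<integral>\<^sup>+x. e2ennreal (- ln_ereal (a x)) \<partial>\<mu>) \<le> ennreal (P - c)" .
  have "0 \<le> P - c"
  proof -
    have "c \<le> integral\<^sup>L \<mu> (f 0)" unfolding f_def by (rule c[OF e])
    also have "\<dots> \<le> P" unfolding real_lebesgue_integral_def[OF int] pk P_def by simp
    finally show ?thesis by simp
  qed
  then have "enn2ereal (\<integral>\<^sup>+x. e2ennreal (- ln_ereal (a x)) \<partial>\<mu>) \<le> ereal (P - c)"
    using nle by (metis enn2ereal_ennreal less_eq_ennreal.rep_eq)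
  then have "ereal P - ereal (P - c) \<le> ereal P - enn2ereal (\<integral>\<^sup>+x. e2ennreal (- ln_ereal (a x)) \<partial>\<mu>)"
    by (intro ereal_minus_mono) auto
  moreover have "enn2ereal p = ereal P" using P by (simp add: enn2ereal_ennreal)
  ultimately show ?thesis unfolding ln_integral_def p_def[symmetric] by simp
qed

section \<open>Regularized weights\<close>

text \<open>The error term is the one of the extreme case in which every factor equals W; for fixed
  m it tends to 0 with \<epsilon>, uniformly over orbits.\<close>

lemma prod_add_le:
  fixes a :: "nat \<Rightarrow> real"
  assumes "\<And>i. 0 \<le> a i" "\<And>i. a i \<le> W" "0 \<le> \<epsilon>"
  shows "(\<Prod>i<m. a i + \<epsilon>) \<le> (\<Prod>i<m. a i) + ((W + \<epsilon>) ^ m - W ^ m)"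
proof (induction m)
  case (Suc m)
  let ?D = "(W + \<epsilon>) ^ m - W ^ m"
  have W0: "0 \<le> W" using assms(1,2) order_trans by blast
  have D0: "0 \<le> ?D" using W0 assms(3) by (simp add: power_mono)
  have pW: "(\<Prod>i<m. a i) \<le> W ^ m"
    using prod_mono[of "{..<m}" a "\<lambda>_. W"] assms(1,2) by simp
  have "(\<Prod>i<Suc m. a i + \<epsilon>) = (\<Prod>i<m. a i + \<epsilon>) * (a m + \<epsilon>)" by simp
  also have "\<dots> \<le> ((\<Prod>i<m. a i) + ?D) * (a m + \<epsilon>)" using assms by (intro mult_right_mono Suc) auto
  also have "\<dots> = (\<Prod>i<Suc m. a i) + (\<Prod>i<m. a i) * \<epsilon> + ?D * (a m + \<epsilon>)" by (simp add: algebra_simps)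
  also have "\<dots> \<le> (\<Prod>i<Suc m. a i) + W ^ m * \<epsilon> + ?D * (W + \<epsilon>)"
    using pW D0 assms by (intro add_mono mult_right_mono mult_left_mono) auto
  also have "\<dots> = (\<Prod>i<Suc m. a i) + ((W + \<epsilon>) ^ Suc m - W ^ Suc m)" by (simp add: algebra_simps)
  finally show ?case .
qed simp

context non_contracting_system
begin

text \<open>The strict gap between c and q^m at a single m leaves room for the perturbation, which
  is at most N^m times the error of one product. Submultiplicativity then gives the rate q for all
  n, and B absorbs the remainders modulo m.\<close>

lemma preimage_sum_regularized:
  assumes w: "continuous_on UNIV w" "\<And>x. 0 \<le> w x" and m: "m \<ge> 1" and q: "q > 0"
    and c: "\<And>x. preimage_sum K \<alpha> w m x \<le> c" "c < q ^ m"
  obtains \<epsilon> B where "\<epsilon> > 0" "B > 0" "\<And>n x. preimage_sum K \<alpha> (\<lambda>x. max (w x) \<epsilon>) n x \<le> B * q ^ n"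
proof -
  obtain W where W: "W > 0" "\<And>x. \<bar>w x\<bar> \<le> W"
    by (rule bounded_range_of_compact[OF compact_space w(1)]) (rule that)
  obtain N :: nat where N: "\<And>x. finite {y. y \<in> K \<and> \<alpha> y = x}" "\<And>x. card {y. y \<in> K \<and> \<alpha> y = x} \<le> N"
    by (rule fibers) (rule that)
  have "((\<lambda>e. real N ^ m * ((W + e) ^ m - W ^ m)) \<longlongrightarrow> real N ^ m * ((W + 0) ^ m - W ^ m)) (at_right 0)"
    by (intro tendsto_intros)
  then have "eventually (\<lambda>e. real N ^ m * ((W + e) ^ m - W ^ m) < q ^ m - c) (at_right 0)"
    by (rule order_tendstoD(2)) (use c(2) in simp)
  then have "eventually (\<lambda>e. real N ^ m * ((W + e) ^ m - W ^ m) < q ^ m - c \<and> 0 < e \<and> e < 1) (at_right (0::real))"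
    by (intro eventually_conj eventually_at_right_less) (auto intro!: eventually_at_rightI[of 0 1])
  then obtain \<epsilon> where e: "real N ^ m * ((W + \<epsilon>) ^ m - W ^ m) < q ^ m - c" "0 < \<epsilon>" "\<epsilon> < 1"
    using eventually_happens'[OF trivial_limit_at_right_real] by blast
  define v where "v x = max (w x) \<epsilon>" for x
  have v: "0 \<le> v x" "v x \<le> w x + \<epsilon>" "v x \<le> W + 1" for x
    using w(2)[of x] W(2)[of x] W(1) e by (auto simp: v_def max_def)
  have Zm: "preimage_sum K \<alpha> v m x \<le> q ^ m" for x
  proof -
    let ?D = "(W + \<epsilon>) ^ m - W ^ m"
    have D0: "0 \<le> ?D" using W(1) e by (simp add: power_mono)
    have "preimage_sum K \<alpha> v m x \<le> (\<Sum>y | y \<in> K \<and> (\<alpha> ^^ m) y = x. (\<Prod>i<m. w ((\<alpha> ^^ i) y)) + ?D)"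
      unfolding preimage_sum_def
    proof (rule sum_mono)
      fix y
      have "(\<Prod>i<m. v ((\<alpha> ^^ i) y)) \<le> (\<Prod>i<m. w ((\<alpha> ^^ i) y) + \<epsilon>)" by (intro prod_mono conjI v)
      also have "\<dots> \<le> (\<Prod>i<m. w ((\<alpha> ^^ i) y)) + ?D"
        using W(2) w(2) e by (intro prod_add_le) (auto simp: abs_le_iff)
      finally show "(\<Prod>i<m. v ((\<alpha> ^^ i) y)) \<le> (\<Prod>i<m. w ((\<alpha> ^^ i) y)) + ?D" .
    qed
    also have "\<dots> = preimage_sum K \<alpha> w m x + preimage_sum K \<alpha> (\<lambda>_. 1) m x * ?D"
      by (simp add: preimage_sum_def sum.distrib)
    also have "\<dots> \<le> c + (real N * 1) ^ m * ?D"
      using D0 by (intro add_mono c mult_right_mono preimage_sum_le_power[OF N(1) K_forward N(2)]) auto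
    also have "\<dots> \<le> q ^ m" using e(1) by simp
    finally show ?thesis .
  qed
  define V where "V = real N * (W + 1)"
  have Zj: "preimage_sum K \<alpha> v j x \<le> V ^ j" for j x
    unfolding V_def using v W(1) by (intro preimage_sum_le_power[OF N(1) K_forward N(2)]) auto
  have V0: "V \<ge> 0" using W(1) by (simp add: V_def)
  define B where "B = 1 + (\<Sum>j<m. V ^ j / q ^ j)"
  have B0: "B > 0" unfolding B_def using V0 q by (intro add_pos_nonneg sum_nonneg) auto
  have Bj: "V ^ j \<le> B * q ^ j" if "j < m" for j
  proof -
    have "V ^ j / q ^ j \<le> (\<Sum>j<m. V ^ j / q ^ j)"
      using member_le_sum[of j "{..<m}" "\<lambda>j. V ^ j / q ^ j"] that V0 q by auto
    then have "V ^ j / q ^ j \<le> B" by (simp add: B_def)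
    then show ?thesis using q by (simp add: divide_le_eq)
  qed
  have step: "preimage_sum K \<alpha> v (j + k * m) x \<le> (q ^ m) ^ k * preimage_sum K \<alpha> v j x" for j k x
  proof (induction k)
    case (Suc k)
    have "preimage_sum K \<alpha> v ((j + k * m) + m) x \<le> q ^ m * preimage_sum K \<alpha> v (j + k * m) x"
      by (rule preimage_sum_add_le[OF N(1) K_forward v(1) Zm])
    also have "\<dots> \<le> q ^ m * ((q ^ m) ^ k * preimage_sum K \<alpha> v j x)" using q Suc by (intro mult_left_mono) auto
    finally show ?case by (simp add: algebra_simps)
  qed simp
  have "preimage_sum K \<alpha> v n x \<le> B * q ^ n" for n x
  proof -
    have "preimage_sum K \<alpha> v n x = preimage_sum K \<alpha> v (n mod m + n div m * m) x" by simp
    also have "\<dots> \<le> (q ^ m) ^ (n div m) * preimage_sum K \<alpha> v (n mod m) x" by (rule step)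
    also have "\<dots> \<le> (q ^ m) ^ (n div m) * (B * q ^ (n mod m))"
      using m q by (intro mult_left_mono order_trans[OF Zj Bj]) auto
    also have "\<dots> = B * (q ^ (m * (n div m)) * q ^ (n mod m))" by (simp add: power_mult)
    also have "\<dots> = B * q ^ n" unfolding power_add[symmetric] by simp
    finally show ?thesis .
  qed
  then show ?thesis using e(2) B0 by (intro that[of \<epsilon> B]) (auto simp: v_def[abs_def])
qed

text \<open>The regularized integral appears with opposite signs in the bounds for entropy and for
  the integral, and it is finite. So the sum is controlled even if the logarithmic integral is
  -\<infinity>.\<close>

theorem pressure_le:
  assumes w: "continuous_on UNIV w" "\<And>x. 0 \<le> w x" and m: "m \<ge> 1" and q: "q > 0"
    and c: "\<And>x. preimage_sum K \<alpha> w m x \<le> c" "c < q ^ m" and \<mu>: "\<mu> \<in> invariant_measures \<alpha>"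
  shows "ln_integral \<mu> w + KS_entropy \<mu> \<alpha> \<le> ereal (ln q)"
proof -
  obtain \<epsilon> B where e: "\<epsilon> > 0" "B > 0" "\<And>n x. preimage_sum K \<alpha> (\<lambda>x. max (w x) \<epsilon>) n x \<le> B * q ^ n"
    by (rule preimage_sum_regularized[OF w m q c]) (rule that)
  let ?I = "\<integral>x. ln (max (w x) \<epsilon>) \<partial>\<mu>"
  have cv: "continuous_on UNIV (\<lambda>x. max (w x) \<epsilon>)" using w(1) by (intro continuous_intros)
  have "KS_entropy \<mu> \<alpha> \<le> ereal (ln q - ?I)"
    unfolding KS_entropy_def
  proof (rule SUP_least)
    fix P assume P: "P \<in> finite_measurable_partitions \<mu>"
    have "partition_entropy_rate \<mu> \<alpha> P + ?I \<le> ln q"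
      by (rule entropy_rate_upper_bound[OF \<mu> P cv _ e(2) q e(3)]) (use e(1) in \<open>simp add: less_max_iff_disj\<close>)
    then show "ereal (partition_entropy_rate \<mu> \<alpha> P) \<le> ereal (ln q - ?I)" by simp
  qed
  then have "ln_integral \<mu> w + KS_entropy \<mu> \<alpha> \<le> ereal ?I + ereal (ln q - ?I)"
    by (intro add_mono ln_integral_le_regularized[OF compact_space \<mu> w(1) e(1)])
  then show ?thesis by simp
qed

end

section \<open>Sets of continuity\<close>

text \<open>Plays the role of a set with \<mu>-null boundary. A sandwich between continuous
  functions fits limits known only on continuous functions, and it passes directly to intersections,
  complements and preimages under \<alpha>.\<close>

definition continuity_set :: "'a::metric_space measure \<Rightarrow> 'a set \<Rightarrow> bool" where
  "continuity_set \<mu> E \<longleftrightarrow> E \<in> sets borel \<and> (\<forall>e>0. \<exists>f h :: 'a \<Rightarrow> real. continuous_on UNIV f \<and> continuous_on UNIV h \<and>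
     (\<forall>x. 0 \<le> f x \<and> f x \<le> indicator E x \<and> indicator E x \<le> h x \<and> h x \<le> 1) \<and> (\<integral>x. h x - f x \<partial>\<mu>) < e)"

lemma continuity_setD:
  fixes \<mu> :: "'a::metric_space measure"
  assumes "continuity_set \<mu> E" "e > 0"
  obtains f h :: "'a \<Rightarrow> real" where "continuous_on UNIV f" "continuous_on UNIV h" "\<And>x. 0 \<le> f x"
    "\<And>x. f x \<le> indicator E x" "\<And>x. indicator E x \<le> h x" "\<And>x. h x \<le> 1" "(\<integral>x. h x - f x \<partial>\<mu>) < e"
proof -
  from assms(1)[unfolded continuity_set_def, THEN conjunct2, rule_format, OF assms(2)]
  obtain f h :: "'a \<Rightarrow> real" where "continuous_on UNIV f" "continuous_on UNIV h"
    "\<forall>x. 0 \<le> f x \<and> f x \<le> indicator E x \<and> indicator E x \<le> h x \<and> h x \<le> 1" "(\<integral>x. h x - f x \<partial>\<mu>) < e"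
    by (elim exE conjE)
  then show ?thesis by (intro that[of f h]) simp_all
qed

lemma continuity_setI:
  assumes "E \<in> sets borel"
    "\<And>e. e > 0 \<Longrightarrow> \<exists>f h :: 'a::metric_space \<Rightarrow> real. continuous_on UNIV f \<and> continuous_on UNIV h \<and>
     (\<forall>x. 0 \<le> f x \<and> f x \<le> indicator E x \<and> indicator E x \<le> h x \<and> h x \<le> 1) \<and> (\<integral>x. h x - f x \<partial>\<mu>) < e"
  shows "continuity_set \<mu> E"
  using assms by (simp add: continuity_set_def)

lemma continuity_set_UNIV: "continuity_set \<mu> UNIV"
  by (rule continuity_setI) (auto intro!: exI[of _ "\<lambda>_. 1"])

lemma continuity_set_Compl:
  assumes "continuity_set \<mu> E"
  shows "continuity_set \<mu> (- E)"
proof (rule continuity_setI)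
  show "- E \<in> sets borel" using assms by (auto simp: continuity_set_def)
  fix e :: real assume "e > 0"
  obtain f h where fh: "continuous_on UNIV f" "continuous_on UNIV h" "\<And>x. 0 \<le> f x"
    "\<And>x. f x \<le> indicator E x" "\<And>x. indicator E x \<le> h x" "\<And>x. h x \<le> 1" "(\<integral>x. h x - f x \<partial>\<mu>) < e"
    by (rule continuity_setD[OF assms \<open>e > 0\<close>]) (rule that)
  show "\<exists>f h. continuous_on UNIV f \<and> continuous_on UNIV h \<and>
     (\<forall>x. 0 \<le> f x \<and> f x \<le> indicator (- E) x \<and> indicator (- E) x \<le> h x \<and> h x \<le> 1) \<and> (\<integral>x. h x - f x \<partial>\<mu>) < e"
  proof (intro exI conjI allI)
    show "continuous_on UNIV (\<lambda>x. 1 - h x)" "continuous_on UNIV (\<lambda>x. 1 - f x)" using fh by (auto intro: continuous_intros)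
    have i: "indicator (- E) x = 1 - (indicator E x :: real)" for x by (simp add: indicator_def)
    fix x
    show "0 \<le> 1 - h x" "1 - h x \<le> indicator (- E) x" "indicator (- E) x \<le> 1 - f x" "1 - f x \<le> 1"
      unfolding i using fh(3-6)[of x] by auto
  qed (use fh(7) in simp)
qed

context
  fixes \<alpha> :: "'a::metric_space \<Rightarrow> 'a" and \<mu> :: "'a measure"
  assumes cX: "compact (UNIV :: 'a set)" and ca: "continuous_on UNIV \<alpha>" and m: "\<mu> \<in> invariant_measures \<alpha>"
begin

lemma continuity_set_Int:
  assumes "continuity_set \<mu> E" "continuity_set \<mu> F"
  shows "continuity_set \<mu> (E \<inter> F)"
proof (rule continuity_setI)
  show "E \<inter> F \<in> sets borel" using assms by (auto simp: continuity_set_def)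
  fix e :: real assume "e > 0"
  then have e: "e / 2 > 0" by simp
  obtain f h where fh: "continuous_on UNIV f" "continuous_on UNIV h" "\<And>x. 0 \<le> f x"
    "\<And>x. f x \<le> indicator E x" "\<And>x. indicator E x \<le> h x" "\<And>x. h x \<le> 1" "(\<integral>x. h x - f x \<partial>\<mu>) < e / 2"
    by (rule continuity_setD[OF assms(1) e]) (rule that)
  obtain f' h' where fh': "continuous_on UNIV f'" "continuous_on UNIV h'" "\<And>x. 0 \<le> f' x"
    "\<And>x. f' x \<le> indicator F x" "\<And>x. indicator F x \<le> h' x" "\<And>x. h' x \<le> 1" "(\<integral>x. h' x - f' x \<partial>\<mu>) < e / 2"
    by (rule continuity_setD[OF assms(2) e]) (rule that)
  have h01: "0 \<le> h x" "0 \<le> h' x" "f x \<le> 1" "f' x \<le> 1" "f x \<le> h x" "f' x \<le> h' x" for x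
    using fh(3-6)[of x] fh'(3-6)[of x] by auto
  show "\<exists>f h. continuous_on UNIV f \<and> continuous_on UNIV h \<and>
     (\<forall>x. 0 \<le> f x \<and> f x \<le> indicator (E \<inter> F) x \<and> indicator (E \<inter> F) x \<le> h x \<and> h x \<le> 1) \<and> (\<integral>x. h x - f x \<partial>\<mu>) < e"
  proof (intro exI conjI allI)
    show c: "continuous_on UNIV (\<lambda>x. f x * f' x)" "continuous_on UNIV (\<lambda>x. h x * h' x)"
      using fh fh' by (auto intro: continuous_intros)
    fix x
    show "0 \<le> f x * f' x" using fh(3) fh'(3) by simp
    show "f x * f' x \<le> indicator (E \<inter> F) x"
      unfolding indicator_inter_arith using fh(3,4) fh'(3,4) by (intro mult_mono) auto
    show "indicator (E \<inter> F) x \<le> h x * h' x"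
      unfolding indicator_inter_arith using fh(5) fh'(5) h01 by (intro mult_mono) auto
    show "h x * h' x \<le> 1" using fh(6)[of x] fh'(6)[of x] h01[of x] by (intro mult_le_one) auto
  next
    have "(\<integral>x. h x * h' x - f x * f' x \<partial>\<mu>) \<le> (\<integral>x. (h x - f x) + (h' x - f' x) \<partial>\<mu>)"
    proof (rule integral_mono)
      fix x
      have "h x * h' x - f x * f' x = (h x - f x) * h' x + f x * (h' x - f' x)" by (simp add: algebra_simps)
      also have "\<dots> \<le> (h x - f x) * 1 + 1 * (h' x - f' x)"
        using h01[of x] fh'(6)[of x] by (intro add_mono mult_left_mono mult_right_mono) auto
      finally show "h x * h' x - f x * f' x \<le> (h x - f x) + (h' x - f' x)" by simp
    qed (use fh fh' in \<open>auto intro!: integrable_invariant[OF cX m] continuous_intros\<close>)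
    also have "\<dots> = (\<integral>x. h x - f x \<partial>\<mu>) + (\<integral>x. h' x - f' x \<partial>\<mu>)"
      using fh fh' by (intro Bochner_Integration.integral_add integrable_invariant[OF cX m] continuous_intros)
    finally show "(\<integral>x. h x * h' x - f x * f' x \<partial>\<mu>) < e" using fh(7) fh'(7) by linarith
  qed
qed

lemma continuity_set_INT:
  assumes "finite I" "\<And>i. i \<in> I \<Longrightarrow> continuity_set \<mu> (E i)"
  shows "continuity_set \<mu> (\<Inter>i\<in>I. E i)"
  using assms
  by (induction I rule: finite_induct) (auto simp: continuity_set_UNIV intro: continuity_set_Int)

lemma continuity_set_vimage:
  assumes "continuity_set \<mu> E"
  shows "continuity_set \<mu> ((\<alpha> ^^ i) -` E)"
proof (rule continuity_setI)
  have E: "E \<in> sets borel" using assms by (simp add: continuity_set_def)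
  show "(\<alpha> ^^ i) -` E \<in> sets borel"
    using measurable_sets[OF borel_measurable_continuous_onI[OF continuous_on_funpow[OF ca, of i]] E] by simp
  fix e :: real assume e: "e > 0"
  obtain f h where fh: "continuous_on UNIV f" "continuous_on UNIV h" "\<And>x. 0 \<le> f x"
    "\<And>x. f x \<le> indicator E x" "\<And>x. indicator E x \<le> h x" "\<And>x. h x \<le> 1" "(\<integral>x. h x - f x \<partial>\<mu>) < e"
    by (rule continuity_setD[OF assms e]) (rule that)
  have c: "continuous_on UNIV (\<lambda>x. h x - f x)" using fh by (intro continuous_intros)
  show "\<exists>f h. continuous_on UNIV f \<and> continuous_on UNIV h \<and>
     (\<forall>x. 0 \<le> f x \<and> f x \<le> indicator ((\<alpha> ^^ i) -` E) x \<and> indicator ((\<alpha> ^^ i) -` E) x \<le> h x \<and> h x \<le> 1) \<and>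
     (\<integral>x. h x - f x \<partial>\<mu>) < e"
  proof (intro exI conjI allI)
    show "continuous_on UNIV (\<lambda>x. f ((\<alpha> ^^ i) x))" "continuous_on UNIV (\<lambda>x. h ((\<alpha> ^^ i) x))"
      by (intro continuous_on_compose_funpow ca fh)+
    have ind: "indicator ((\<alpha> ^^ i) -` E) x = (indicator E ((\<alpha> ^^ i) x) :: real)" for x by (simp add: indicator_def)
    fix x
    show "0 \<le> f ((\<alpha> ^^ i) x)" "f ((\<alpha> ^^ i) x) \<le> indicator ((\<alpha> ^^ i) -` E) x"
      "indicator ((\<alpha> ^^ i) -` E) x \<le> h ((\<alpha> ^^ i) x)" "h ((\<alpha> ^^ i) x) \<le> 1"
      unfolding ind by (rule fh)+
  next
    show "(\<integral>x. h ((\<alpha> ^^ i) x) - f ((\<alpha> ^^ i) x) \<partial>\<mu>) < e"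
      using integral_funpow_invariant[OF cX m ca c, of i] fh(7) by simp
  qed
qed

text \<open>The measure of closed balls about c is monotone in the radius, hence discontinuous at
  only countably many radii. At a radius of continuity, linear ramps on both sides of the sphere
  form the sandwich.\<close>

lemma continuity_ball:
  assumes "0 \<le> a" "a < b"
  obtains r where "a < r" "r < b" "continuity_set \<mu> (ball c r)"
proof -
  interpret finite_measure \<mu> by (rule invariant_measuresD(2)[OF m])
  note st = invariant_measuresD(3)[OF m]
  define F where "F t = measure \<mu> {x. dist c x \<le> t}" for t
  have ms: "{x. dist c x \<le> t} \<in> sets \<mu>" for t
    unfolding st by (intro borel_closed closed_Collect_le continuous_intros)
  have "mono F" unfolding F_def by (intro monoI finite_measure_mono ms) auto
  then have "countable {t. \<not> isCont F t}" by (rule mono_ctble_discont)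
  moreover have "uncountable {a<..<b}" using assms(2) by (rule uncountable_open_interval[THEN iffD2])
  ultimately have "\<not> {a<..<b} \<subseteq> {t. \<not> isCont F t}" using countable_subset by blast
  then obtain r where r: "a < r" "r < b" "isCont F r" by auto
  have "continuity_set \<mu> (ball c r)"
  proof (rule continuity_setI)
    fix e :: real assume e: "e > 0"
    then have e2: "e / 2 > 0" by simp
    from r(3)[unfolded continuous_at_eps_delta, rule_format, OF e2]
    obtain d where d: "d > 0" "\<forall>t. dist t r < d \<longrightarrow> dist (F t) (F r) < e / 2" by (elim exE conjE)
    define s where "s = d / 2"
    have s: "s > 0" "\<bar>F (r + s) - F r\<bar> < e / 2" "\<bar>F (r - s) - F r\<bar> < e / 2"
      using d(1) d(2)[rule_format, of "r + s"] d(2)[rule_format, of "r - s"] by (auto simp: s_def dist_real_def)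
    define f where "f x = min 1 (max 0 ((r - dist c x) / s))" for x
    define h where "h x = max 0 (min 1 (1 - (dist c x - r) / s))" for x
    have cf: "continuous_on UNIV f" "continuous_on UNIV h"
      unfolding f_def h_def using s(1) by (auto intro!: continuous_intros)
    have hf: "h x - f x \<le> indicator {x. dist c x \<le> r + s} x - indicator {x. dist c x \<le> r - s} x" for x
      using s(1) by (auto simp: f_def h_def indicator_def min_def max_def field_simps)
    show "\<exists>f h. continuous_on UNIV f \<and> continuous_on UNIV h \<and>
       (\<forall>x. 0 \<le> f x \<and> f x \<le> indicator (ball c r) x \<and> indicator (ball c r) x \<le> h x \<and> h x \<le> 1) \<and> (\<integral>x. h x - f x \<partial>\<mu>) < e"
    proof (intro exI conjI allI)
      show "continuous_on UNIV f" "continuous_on UNIV h" by (rule cf)+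
      fix x
      show "0 \<le> f x" by (simp add: f_def)
      show "f x \<le> indicator (ball c r) x" using s(1) by (auto simp: f_def indicator_def max_def divide_le_0_iff)
      show "indicator (ball c r) x \<le> h x" using s(1) by (auto simp: h_def indicator_def divide_le_0_iff)
      show "h x \<le> 1" by (simp add: h_def)
    next
      have "(\<integral>x. h x - f x \<partial>\<mu>) \<le> (\<integral>x. indicator {x. dist c x \<le> r + s} x - indicator {x. dist c x \<le> r - s} x \<partial>\<mu>)"
      proof (rule integral_mono[OF _ _ hf])
        show "integrable \<mu> (\<lambda>x. h x - f x)" using cf by (intro integrable_invariant[OF cX m] continuous_on_diff)
        show "integrable \<mu> (\<lambda>x. indicator {x. dist c x \<le> r + s} x - indicator {x. dist c x \<le> r - s} x :: real)"
          using ms by (intro Bochner_Integration.integrable_diff integrable_real_indicator) (auto simp: emeasure_eq_measure)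
      qed
      also have "\<dots> = F (r + s) - F (r - s)"
        unfolding F_def using ms by (subst Bochner_Integration.integral_diff) (auto simp: emeasure_eq_measure)
      also have "\<dots> < e" using s by linarith
      finally show "(\<integral>x. h x - f x \<partial>\<mu>) < e" .
    qed
  qed simp
  with r(1,2) show ?thesis by (rule that)
qed

lemma continuity_set_orbit_average:
  assumes E: "continuity_set \<mu> E" and G: "G \<noteq> bot" "G \<le> sequentially"
    and lim: "\<And>f. continuous_on UNIV f \<Longrightarrow> ((\<lambda>n. orbit_average \<alpha> \<eta> n f) \<longlongrightarrow> integral\<^sup>L \<mu> f) G"
  shows "((\<lambda>n. orbit_average \<alpha> \<eta> n (indicator E)) \<longlongrightarrow> measure \<mu> E) G"
proof (rule tendstoI)
  interpret finite_measure \<mu> by (rule invariant_measuresD(2)[OF m])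
  fix e :: real assume "e > 0"
  then have e: "e / 2 > 0" by simp
  obtain f h where fh: "continuous_on UNIV f" "continuous_on UNIV h" "\<And>x. 0 \<le> f x"
    "\<And>x. f x \<le> indicator E x" "\<And>x. indicator E x \<le> h x" "\<And>x. h x \<le> 1" "(\<integral>x. h x - f x \<partial>\<mu>) < e / 2"
    by (rule continuity_setD[OF E e]) (rule that)
  have b: "\<bar>f x\<bar> \<le> 1" "\<bar>h x\<bar> \<le> 1" "\<bar>indicator E x :: real\<bar> \<le> 1" for x
    using fh(3-6)[of x] by (auto simp: indicator_def split: if_splits)
  have sE: "E \<in> sets \<mu>" using E invariant_measuresD(3)[OF m] by (simp add: continuity_set_def)
  have intE: "integrable \<mu> (indicator E :: 'a \<Rightarrow> real)" using sE by (simp add: emeasure_eq_measure)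
  have "integral\<^sup>L \<mu> f \<le> measure \<mu> E" "measure \<mu> E \<le> integral\<^sup>L \<mu> h"
    using integral_mono[OF integrable_invariant[OF cX m fh(1)] intE fh(4)]
      integral_mono[OF intE integrable_invariant[OF cX m fh(2)] fh(5)] sE by auto
  moreover have "integral\<^sup>L \<mu> h - integral\<^sup>L \<mu> f < e / 2"
    using fh(7) integrable_invariant[OF cX m fh(1)] integrable_invariant[OF cX m fh(2)] by simp
  moreover have "eventually (\<lambda>n. dist (orbit_average \<alpha> \<eta> n f) (integral\<^sup>L \<mu> f) < e / 2 \<and> dist (orbit_average \<alpha> \<eta> n h) (integral\<^sup>L \<mu> h) < e / 2) G"
    by (intro eventually_conj tendstoD[OF lim] fh e)
  ultimately show "eventually (\<lambda>n. dist (orbit_average \<alpha> \<eta> n (indicator E)) (measure \<mu> E) < e) G"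
  proof (elim eventually_mono)
    fix n assume a: "integral\<^sup>L \<mu> f \<le> measure \<mu> E" "measure \<mu> E \<le> integral\<^sup>L \<mu> h" "integral\<^sup>L \<mu> h - integral\<^sup>L \<mu> f < e / 2"
      "dist (orbit_average \<alpha> \<eta> n f) (integral\<^sup>L \<mu> f) < e / 2 \<and> dist (orbit_average \<alpha> \<eta> n h) (integral\<^sup>L \<mu> h) < e / 2"
    have "orbit_average \<alpha> \<eta> n f \<le> orbit_average \<alpha> \<eta> n (indicator E)" "orbit_average \<alpha> \<eta> n (indicator E) \<le> orbit_average \<alpha> \<eta> n h"
      using b fh(4,5) by (auto intro!: orbit_average_mono[where B=1 and C=1])
    then show "dist (orbit_average \<alpha> \<eta> n (indicator E)) (measure \<mu> E) < e"
      using a unfolding dist_real_def by linarith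
  qed
qed

text \<open>The atoms of the finite algebra generated by covering balls of radius below r/2. Each
  atom lies in one of the balls, so its diameter is at most r; the lower limit r/4 only keeps the
  radii positive.\<close>

lemma continuity_partition:
  assumes "r > 0"
  obtains P where "P \<in> finite_measurable_partitions \<mu>" "\<And>C. C \<in> P \<Longrightarrow> continuity_set \<mu> C"
    "\<And>C x y. C \<in> P \<Longrightarrow> x \<in> C \<Longrightarrow> y \<in> C \<Longrightarrow> dist x y \<le> r"
proof -
  have "\<exists>s. r / 4 < s \<and> s < r / 2 \<and> continuity_set \<mu> (ball c s)" for c
    by (rule continuity_ball[of "r / 4" "r / 2" c]) (use assms in auto)
  then obtain s where s: "\<And>c. r / 4 < s c" "\<And>c. s c < r / 2" "\<And>c. continuity_set \<mu> (ball c (s c))" by metis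
  have "UNIV \<subseteq> (\<Union>c. ball c (s c))"
  proof
    fix x
    have "s x > 0" using s(1)[of x] assms by linarith
    then show "x \<in> (\<Union>c. ball c (s c))" by (intro UN_I[of x]) auto
  qed
  then obtain D where D: "finite D" "UNIV \<subseteq> (\<Union>c\<in>D. ball c (s c))"
    using compactE_image[OF cX, of UNIV "\<lambda>c. ball c (s c)"] by auto
  define lab where "lab x = {c \<in> D. x \<in> ball c (s c)}" for x
  have fib: "lab -` {lab x} = (\<Inter>c\<in>D. if c \<in> lab x then ball c (s c) else - ball c (s c))" for x
  proof -
    have 1: "lab y = lab x \<longleftrightarrow> (\<forall>c\<in>D. y \<in> ball c (s c) \<longleftrightarrow> x \<in> ball c (s c))" for y
      unfolding lab_def set_eq_iff mem_Collect_eq by (auto simp del: mem_ball)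
    have 2: "y \<in> (\<Inter>c\<in>D. if c \<in> lab x then ball c (s c) else - ball c (s c)) \<longleftrightarrow>
      (\<forall>c\<in>D. y \<in> ball c (s c) \<longleftrightarrow> x \<in> ball c (s c))" for y
      unfolding lab_def by (auto simp del: mem_ball split: if_splits)
    show ?thesis by (rule set_eqI) (simp only: vimage_singleton_eq 1 2)
  qed
  define P where "P = (\<lambda>x. lab -` {lab x}) ` UNIV"
  have csP: "continuity_set \<mu> C" if "C \<in> P" for C
  proof -
    obtain x where C: "C = lab -` {lab x}" using \<open>C \<in> P\<close> unfolding P_def by (rule imageE)
    show ?thesis
      unfolding C fib by (intro continuity_set_INT D(1)) (simp add: s(3) continuity_set_Compl)
  qed
  have "P \<in> finite_measurable_partitions \<mu>"
    unfolding finite_measurable_partitions_def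
  proof (intro CollectI conjI)
    have "P \<subseteq> (\<lambda>l. lab -` {l}) ` Pow D" by (auto simp: P_def lab_def)
    then show "finite P" using D(1) by (meson finite_Pow_iff finite_imageI finite_subset)
    show "P \<subseteq> sets \<mu>" using csP invariant_measuresD(3)[OF m] by (auto simp: continuity_set_def)
    show "partition_on (space \<mu>) P"
      unfolding invariant_measuresD(4)[OF m] partition_on_def by (auto simp: P_def disjoint_def)
  qed
  moreover have "dist x y \<le> r" if C: "C \<in> P" "x \<in> C" "y \<in> C" for C x y
  proof -
    have "lab x = lab y" using C by (auto simp: P_def)
    moreover obtain c where "c \<in> D" "x \<in> ball c (s c)" using subsetD[OF D(2) UNIV_I[of x]] by (rule UN_E)
    ultimately have "x \<in> ball c (s c)" "y \<in> ball c (s c)" by (auto simp: lab_def)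
    then show ?thesis using dist_triangle3[of x y c] s(2)[of c] by simp
  qed
  ultimately show ?thesis using csP by (intro that[of P])
qed

end

section \<open>The lower bound\<close>

lemma finite_support_pmf:
  fixes p :: "'a \<Rightarrow> real"
  assumes "finite S" "\<And>y. y \<in> S \<Longrightarrow> 0 \<le> p y" "(\<Sum>y\<in>S. p y) = 1"
  obtains \<eta> :: "'a pmf" where "\<And>y. pmf \<eta> y = (if y \<in> S then p y else 0)"
proof
  let ?f = "\<lambda>y. if y \<in> S then p y else 0"
  have "(\<integral>\<^sup>+y. ennreal (?f y) \<partial>count_space UNIV) = (\<Sum>y\<in>S. ennreal (?f y))"
    by (rule nn_integral_count_space'[OF assms(1)]) (auto split: if_splits)
  also have "\<dots> = ennreal (\<Sum>y\<in>S. p y)" using assms(2) by (simp add: sum_ennreal)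
  finally show "pmf (embed_pmf ?f) y = ?f y" for y
    using assms by (intro pmf_embed_pmf) auto
qed

lemma expectation_finite_support:
  fixes f :: "'a \<Rightarrow> real"
  assumes "finite S" "\<And>y. pmf \<eta> y = (if y \<in> S then p y else 0)"
  shows "measure_pmf.expectation \<eta> f = (\<Sum>y\<in>S. p y * f y)"
proof -
  have "measure_pmf.expectation \<eta> f = (\<Sum>y\<in>S. f y * pmf \<eta> y)"
    by (rule integral_measure_pmf_real[OF assms(1)]) (use assms(2) in \<open>auto simp: set_pmf_iff split: if_splits\<close>)
  then show ?thesis using assms(2) by (simp add: mult.commute)
qed

lemma full_prob_space_pmf: "full_prob_space (measure_pmf \<eta>)"
  by (simp add: full_prob_space_def full_prob_space_axioms_def measure_pmf.prob_space_axioms)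

lemma orbit_average_indicator:
  "orbit_average \<alpha> \<eta> n (indicator E) = (\<Sum>j<n. measure (measure_pmf (\<eta> n)) ((\<alpha> ^^ j) -` E)) / real n"
proof -
  have "(\<lambda>y. indicator E ((\<alpha> ^^ j) y) :: real) = indicator ((\<alpha> ^^ j) -` E)" for j by (auto simp: indicator_def)
  then show ?thesis by (simp add: orbit_average_def)
qed

text \<open>The probability with weights proportional to \<open>w\<close> along the preimages of a point attains equality
  in the Gibbs inequality, provided that the preimages are separated by the labels.\<close>

lemma label_entropy_gibbs_state:
  fixes w :: "'a \<Rightarrow> real" and \<alpha> :: "'a \<Rightarrow> 'a" and n :: nat
  defines "q \<equiv> \<lambda>y. \<Prod>i<n. w ((\<alpha> ^^ i) y)"
  assumes S: "finite S" and w: "\<And>y. 0 \<le> w y" and Z: "Z = (\<Sum>y\<in>S. q y)" "Z > 0"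
    and \<eta>: "\<And>y. pmf \<eta> y = (if y \<in> S then q y / Z else 0)"
    and X: "inj_on X S" "finite (range X)"
    and v: "\<And>y. w y \<le> v y" "\<And>y. 0 < v y"
  shows "ln Z - (\<Sum>i<n. measure_pmf.expectation \<eta> (\<lambda>y. ln (v ((\<alpha> ^^ i) y)))) \<le> label_entropy (measure_pmf \<eta>) X"
proof -
  have q0: "0 \<le> q y" for y unfolding q_def by (intro prod_nonneg) (use w in auto)
  note ex = expectation_finite_support[OF S \<eta>]
  have fiber: "measure (measure_pmf \<eta>) (X -` {l}) = (\<Sum>y\<in>S. if X y = l then q y / Z else 0)" for l
  proof -
    have "measure (measure_pmf \<eta>) (X -` {l}) = measure_pmf.expectation \<eta> (indicator (X -` {l}))" by simp
    also have "\<dots> = (\<Sum>y\<in>S. q y / Z * indicator (X -` {l}) y)" by (rule ex)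
    also have "\<dots> = (\<Sum>y\<in>S. if X y = l then q y / Z else 0)" by (intro sum.cong) (auto simp: indicator_def)
    finally show ?thesis .
  qed
  have fiberX: "measure (measure_pmf \<eta>) (X -` {X y}) = q y / Z" if y: "y \<in> S" for y
  proof -
    have "(\<Sum>u\<in>S. if X u = X y then q u / Z else 0) = (\<Sum>u\<in>S. if u = y then q u / Z else 0)"
      using X(1) y by (intro sum.cong) (auto dest: inj_onD)
    then show ?thesis unfolding fiber using S y by simp
  qed
  have "label_entropy (measure_pmf \<eta>) X = (\<Sum>l\<in>X ` S. xlogx (measure (measure_pmf \<eta>) (X -` {l})))"
    unfolding label_entropy_def
  proof (rule sum.mono_neutral_right[OF X(2)], blast, rule ballI)
    fix l assume "l \<in> range X - X ` S"
    then have "X y \<noteq> l" if "y \<in> S" for y using that by blast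
    then have "(\<Sum>y\<in>S. if X y = l then q y / Z else 0) = 0" by (intro sum.neutral) simp
    then show "xlogx (measure (measure_pmf \<eta>) (X -` {l})) = 0" unfolding fiber by (simp add: xlogx_def)
  qed
  also have "\<dots> = (\<Sum>y\<in>S. xlogx (q y / Z))"
    unfolding sum.reindex[OF X(1)] o_def by (intro sum.cong) (auto simp: fiberX)
  finally have 1: "label_entropy (measure_pmf \<eta>) X = (\<Sum>y\<in>S. xlogx (q y / Z))" .
  \<comment> \<open>The Gibbs equality holds for w itself, whose logarithm need not be finite.
    Passing to the larger positive v costs an inequality, and points of weight 0 contribute nothing
    on either side.\<close>
  have 2: "q y / Z * ln Z - q y / Z * (\<Sum>i<n. ln (v ((\<alpha> ^^ i) y))) \<le> xlogx (q y / Z)" for y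
  proof (cases "q y = 0")
    case True
    then show ?thesis by (simp add: xlogx_def)
  next
    case False
    then have qp: "q y > 0" using q0[of y] by simp
    have "ln (q y) \<le> ln (\<Prod>i<n. v ((\<alpha> ^^ i) y))"
    proof (subst ln_le_cancel_iff[OF qp])
      show "0 < (\<Prod>i<n. v ((\<alpha> ^^ i) y))" using v(2) by (intro prod_pos) auto
      show "q y \<le> (\<Prod>i<n. v ((\<alpha> ^^ i) y))" unfolding q_def using w v(1) by (intro prod_mono) auto
    qed
    also have "\<dots> = (\<Sum>i<n. ln (v ((\<alpha> ^^ i) y)))" using v(2) by (subst ln_prod) (auto simp: less_le)
    finally have "q y / Z * ln (q y) \<le> q y / Z * (\<Sum>i<n. ln (v ((\<alpha> ^^ i) y)))"
      using qp Z(2) by (intro mult_left_mono) auto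
    moreover have lnq: "ln (q y / Z) = ln (q y) - ln Z" using qp Z(2) by (simp add: ln_div)
    ultimately show ?thesis unfolding xlogx_def lnq by (simp add: right_diff_distrib)
  qed
  have swap: "(\<Sum>i<n. \<Sum>y\<in>S. q y / Z * ln (v ((\<alpha> ^^ i) y))) = (\<Sum>y\<in>S. q y / Z * (\<Sum>i<n. ln (v ((\<alpha> ^^ i) y))))"
    unfolding sum_distrib_left by (rule sum.swap)
  have "(\<Sum>y\<in>S. q y / Z * ln Z - q y / Z * (\<Sum>i<n. ln (v ((\<alpha> ^^ i) y)))) =
      (\<Sum>y\<in>S. q y / Z) * ln Z - (\<Sum>i<n. \<Sum>y\<in>S. q y / Z * ln (v ((\<alpha> ^^ i) y)))"
    unfolding swap sum_subtractf sum_distrib_right[symmetric] ..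
  also have "(\<Sum>y\<in>S. q y / Z) = 1" using Z by (simp add: sum_divide_distrib[symmetric])
  finally have "ln Z - (\<Sum>i<n. measure_pmf.expectation \<eta> (\<lambda>y. ln (v ((\<alpha> ^^ i) y)))) =
      (\<Sum>y\<in>S. q y / Z * ln Z - q y / Z * (\<Sum>i<n. ln (v ((\<alpha> ^^ i) y))))"
    unfolding ex by simp
  also have "\<dots> \<le> label_entropy (measure_pmf \<eta>) X" unfolding 1 by (intro sum_mono 2)
  finally show ?thesis .
qed

context non_contracting_system
begin

text \<open>Backward induction from time n, where the orbits meet: equal labels put the points
  within r one step earlier, and there non-contraction forces points with equal images to
  coincide.\<close>

lemma itinerary_inj_on_fiber:
  assumes r: "\<And>x y. x \<in> K \<Longrightarrow> y \<in> K \<Longrightarrow> dist x y \<le> r \<Longrightarrow> dist x y \<le> dist (\<alpha> x) (\<alpha> y)"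
    and P: "\<And>x y. X x = X y \<Longrightarrow> dist x y \<le> r"
  shows "inj_on (itinerary \<alpha> X n) {y. y \<in> K \<and> (\<alpha> ^^ n) y = x}"
proof (rule inj_onI)
  fix y z assume yz: "y \<in> {y. y \<in> K \<and> (\<alpha> ^^ n) y = x}" "z \<in> {y. y \<in> K \<and> (\<alpha> ^^ n) y = x}"
    "itinerary \<alpha> X n y = itinerary \<alpha> X n z"
  have in_K: "(\<alpha> ^^ i) y \<in> K" "(\<alpha> ^^ i) z \<in> K" for i
    using yz(1,2) by (auto intro!: funpow_in[of K \<alpha>, OF K_forward])
  have "(\<alpha> ^^ (n - k)) y = (\<alpha> ^^ (n - k)) z" if "k \<le> n" for k
    using that
  proof (induction k)
    case 0
    then show ?case using yz(1,2) by simp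
  next
    case (Suc k)
    let ?i = "n - Suc k"
    have i: "?i < n" "Suc ?i = n - k" using Suc.prems by auto
    have "dist ((\<alpha> ^^ ?i) y) ((\<alpha> ^^ ?i) z) \<le> r"
      using yz(3) i(1) unfolding itinerary_eq_iff by (intro P) blast
    then have "dist ((\<alpha> ^^ ?i) y) ((\<alpha> ^^ ?i) z) \<le> dist (\<alpha> ((\<alpha> ^^ ?i) y)) (\<alpha> ((\<alpha> ^^ ?i) z))"
      by (intro r in_K)
    moreover have step: "\<alpha> ((\<alpha> ^^ ?i) u) = (\<alpha> ^^ (n - k)) u" for u unfolding i(2)[symmetric] by simp
    moreover have "(\<alpha> ^^ (n - k)) y = (\<alpha> ^^ (n - k)) z" using Suc by simp
    ultimately show ?case by (simp only: step dist_self dist_le_zero_iff)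
  qed
  from this[of n] show "y = z" by simp
qed

theorem pressure_ge:
  assumes w: "continuous_on UNIV w" "\<And>x. 0 \<le> w x" and s: "s > 0"
    and ge: "\<And>n. n \<ge> 1 \<Longrightarrow> \<exists>x. s ^ n \<le> preimage_sum K \<alpha> w n x"
  shows "\<exists>\<mu>\<in>invariant_measures \<alpha>. ereal (ln s) \<le> ln_integral \<mu> w + KS_entropy \<mu> \<alpha>"
proof -
  obtain r where r: "r > 0" "\<And>x y. x \<in> K \<Longrightarrow> y \<in> K \<Longrightarrow> dist x y \<le> r \<Longrightarrow> dist x y \<le> dist (\<alpha> x) (\<alpha> y)"
    using non_contracting unfolding non_contracting_on_def by blast
  define S where "S n x = {y. y \<in> K \<and> (\<alpha> ^^ n) y = x}" for n x
  have finS: "finite (S n x)" for n x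
    unfolding S_def by (rule finite_preimages[of K \<alpha>, OF finite_fiber K_forward])
  define Q where "Q n y = (\<Prod>i<n. w ((\<alpha> ^^ i) y))" for n y
  have Z: "preimage_sum K \<alpha> w n x = (\<Sum>y\<in>S n x. Q n y)" for n x by (simp add: preimage_sum_def S_def Q_def)
  have Q0: "0 \<le> Q n y" for n y unfolding Q_def using w(2) by (intro prod_nonneg) auto
  have "\<forall>n. \<exists>x. n \<ge> 1 \<longrightarrow> s ^ n \<le> preimage_sum K \<alpha> w n x" using ge by blast
  from choice[OF this] obtain x where x: "\<And>n. n \<ge> 1 \<Longrightarrow> s ^ n \<le> preimage_sum K \<alpha> w n (x n)" by blast
  define Zn where "Zn n = preimage_sum K \<alpha> w n (x n)" for n
  have Zs: "s ^ n \<le> Zn n" "Zn n > 0" if "n \<ge> 1" for n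
    using x[OF that] s less_le_trans[OF zero_less_power[OF s, of n]] by (auto simp: Zn_def)
  have "\<exists>\<eta>. n \<ge> 1 \<longrightarrow> (\<forall>y. pmf \<eta> y = (if y \<in> S n (x n) then Q n y / Zn n else 0))" for n
  proof (cases "n \<ge> 1")
    case True
    have one: "(\<Sum>y\<in>S n (x n). Q n y / Zn n) = 1"
      unfolding sum_divide_distrib[symmetric] Z[symmetric] Zn_def[symmetric] using Zs(2)[OF True] by simp
    have nn: "0 \<le> Q n y / Zn n" for y using Q0 Zs(2)[OF True] by simp
    obtain \<eta> where "\<And>y. pmf \<eta> y = (if y \<in> S n (x n) then Q n y / Zn n else 0)"
      by (rule finite_support_pmf[OF finS[of n "x n"] nn one]) (rule that)
    then show ?thesis by blast
  qed simp
  then have "\<forall>n. \<exists>\<eta>. n \<ge> 1 \<longrightarrow> (\<forall>y. pmf \<eta> y = (if y \<in> S n (x n) then Q n y / Zn n else 0))" by blast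
  from choice[OF this] obtain \<eta> where \<eta>: "\<And>n y. n \<ge> 1 \<Longrightarrow> pmf (\<eta> n) y = (if y \<in> S n (x n) then Q n y / Zn n else 0)"
    by blast
  obtain G \<mu> where G: "G \<le> sequentially" "G \<noteq> bot" and m: "\<mu> \<in> invariant_measures \<alpha>"
    and lim: "\<And>f. continuous_on UNIV f \<Longrightarrow> ((\<lambda>n. orbit_average \<alpha> \<eta> n f) \<longlongrightarrow> integral\<^sup>L \<mu> f) G"
    by (rule orbit_average_invariant_limit[OF compact_space cont order_refl sequentially_bot, where \<eta> = \<eta>]) (rule that)
  interpret full_prob_space \<mu> by (rule full_prob_space_invariant[OF m])
  \<comment> \<open>The partition is chosen after \<mu>, since its cells must be continuity sets of
    \<mu>. This is harmless because the measures \<eta> n were built without any partition.\<close>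
  obtain P where P: "P \<in> finite_measurable_partitions \<mu>" "\<And>C. C \<in> P \<Longrightarrow> continuity_set \<mu> C"
    "\<And>C x y. C \<in> P \<Longrightarrow> x \<in> C \<Longrightarrow> y \<in> C \<Longrightarrow> dist x y \<le> r"
    by (rule continuity_partition[OF compact_space cont m r(1)]) (rule that)
  note fc = finite_label_cell[OF m P(1)]
  let ?X = "cell P"
  let ?N = "itinerary \<alpha> ?X"
  have X_near: "dist y z \<le> r" if "?X y = ?X z" for y z
    using P(3)[OF cell_in(1)[OF fc(4), of y] cell_in(2)[OF fc(4), of y], of z] cell_in(2)[OF fc(4), of z] that by simp
  have finN: "finite (range (?N k))" for k
    using finite_labelD(1)[OF finite_label_itinerary[OF m cont fc(1)]] .
  have continuity_fiber: "continuity_set \<mu> (?N k -` {l})" if "l \<in> range (?N k)" for k l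
  proof -
    obtain x0 where l: "l = ?N k x0" using \<open>l \<in> range (?N k)\<close> by blast
    have c: "?X -` {?X z} = ?X z" for z
    proof (rule set_eqI)
      fix y
      show "y \<in> ?X -` {?X z} \<longleftrightarrow> y \<in> ?X z"
        using cell_eq[OF fc(4) cell_in(1)[OF fc(4), of z], of y] cell_in(2)[OF fc(4), of y] by auto
    qed
    have "?N k -` {l} = (\<Inter>i\<in>{..<k}. (\<alpha> ^^ i) -` (?X -` {?X ((\<alpha> ^^ i) x0)}))"
      unfolding l by (auto simp: itinerary_eq_iff)
    then show ?thesis
      unfolding c using P(2) cell_in(1)[OF fc(4)]
      by (simp only:) (intro continuity_set_INT[OF compact_space cont m] continuity_set_vimage[OF compact_space cont m]; simp)
  qed
  \<comment> \<open>For fixed k and \<epsilon> this is the limit n \<rightarrow> \<infinity> along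
    G. Neither \<mu> nor P depends on \<epsilon>, so afterwards k can go to infinity and the bound
    remains available for every \<epsilon>.\<close>
  have key: "real k * (ln s - (\<integral>x. ln (max (w x) \<epsilon>) \<partial>\<mu>)) \<le> label_entropy \<mu> (?N k)"
    if k: "k \<ge> 1" and e: "\<epsilon> > 0" for k \<epsilon>
  proof (rule tendsto_le[OF G(2)])
    define v where "v x = max (w x) \<epsilon>" for x
    have v: "w y \<le> v y" "0 < v y" for y using e by (auto simp: v_def)
    have clv: "continuous_on UNIV (\<lambda>x. ln (v x))" unfolding v_def by (rule continuous_on_ln_max[OF w(1) e])
    show "((\<lambda>n. real k * (ln s - orbit_average \<alpha> \<eta> n (\<lambda>x. ln (v x)))) \<longlongrightarrow>
        real k * (ln s - (\<integral>x. ln (max (w x) \<epsilon>) \<partial>\<mu>))) G"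
      unfolding v_def[symmetric] by (intro tendsto_intros lim clv)
    have xl: "((\<lambda>n. xlogx (orbit_average \<alpha> \<eta> n (indicator (?N k -` {l})))) \<longlongrightarrow> xlogx (measure \<mu> (?N k -` {l}))) G"
      if "l \<in> range (?N k)" for l
    proof (rule continuous_on_tendsto_compose[OF continuous_on_xlogx])
      show "((\<lambda>n. orbit_average \<alpha> \<eta> n (indicator (?N k -` {l}))) \<longlongrightarrow> measure \<mu> (?N k -` {l})) G"
        by (rule continuity_set_orbit_average[OF compact_space cont m continuity_fiber[OF that] G(2,1) lim])
      show "eventually (\<lambda>n. orbit_average \<alpha> \<eta> n (indicator (?N k -` {l})) \<in> {0..}) G"
        unfolding orbit_average_indicator by (intro always_eventually allI) (simp add: sum_nonneg)
    qed simp
    have c0: "((\<lambda>n. real k * (real k * ln (real (card P))) / real n) \<longlongrightarrow> 0) G"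
      using tendsto_mono[OF G(1) lim_const_over_n] .
    show "((\<lambda>n. real k * (real k * ln (real (card P))) / real n +
        (\<Sum>l\<in>range (?N k). xlogx (orbit_average \<alpha> \<eta> n (indicator (?N k -` {l}))))) \<longlongrightarrow> label_entropy \<mu> (?N k)) G"
      using tendsto_add[OF c0 tendsto_sum[OF xl]] by (simp add: label_entropy_def)
    have "eventually (\<lambda>n. n \<ge> 1) G" using G(1) eventually_ge_at_top[of "1::nat"] by (simp add: le_filter_def)
    then show "eventually (\<lambda>n. real k * (ln s - orbit_average \<alpha> \<eta> n (\<lambda>x. ln (v x))) \<le>
       real k * (real k * ln (real (card P))) / real n +
       (\<Sum>l\<in>range (?N k). xlogx (orbit_average \<alpha> \<eta> n (indicator (?N k -` {l}))))) G"
    proof (rule eventually_mono)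
      fix n :: nat assume n: "n \<ge> 1"
      let ?M = "measure_pmf (\<eta> n)"
      let ?A = "orbit_average \<alpha> \<eta> n (\<lambda>x. ln (v x))"
      interpret E: full_prob_space ?M by (rule full_prob_space_pmf)
      have inj: "inj_on (?N n) (S n (x n))"
        unfolding S_def by (rule itinerary_inj_on_fiber[OF r(2) X_near])
      have "ln (Zn n) - (\<Sum>i<n. measure_pmf.expectation (\<eta> n) (\<lambda>y. ln (v ((\<alpha> ^^ i) y)))) \<le> label_entropy ?M (?N n)"
        by (rule label_entropy_gibbs_state[OF finS w(2) _ Zs(2)[OF n] _ inj finN v])
          (simp_all add: Zn_def Z Q_def[symmetric] \<eta>[OF n])
      moreover have "(\<Sum>i<n. measure_pmf.expectation (\<eta> n) (\<lambda>y. ln (v ((\<alpha> ^^ i) y)))) = real n * ?A"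
        using n by (simp add: orbit_average_def)
      moreover have "real n * ln s \<le> ln (Zn n)"
      proof -
        have "ln (s ^ n) \<le> ln (Zn n)" using Zs[OF n] s by (subst ln_le_cancel_iff) auto
        then show ?thesis using s by (simp add: ln_realpow)
      qed
      ultimately have 1: "real n * (ln s - ?A) \<le> label_entropy ?M (?N n)" by (simp add: algebra_simps)
      have flp: "finite_label ?M (\<lambda>x. ?X ((\<alpha> ^^ j) x))" for j
        unfolding finite_label_def using finite_subset[OF fc(2,3)] by (auto intro: finite_subset[of _ "range ?X"])
      have "real k * label_entropy ?M (?N n) \<le> real k * (real k * ln (real (card P))) +
          (\<Sum>j<n. label_entropy ?M (\<lambda>x. ?N k ((\<alpha> ^^ j) x)))"
        by (rule E.misiurewicz[OF flp fc(3,2) k])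
      also have "(\<Sum>j<n. label_entropy ?M (\<lambda>x. ?N k ((\<alpha> ^^ j) x))) =
          (\<Sum>j<n. \<Sum>l\<in>range (?N k). xlogx (measure ?M ((\<alpha> ^^ j) -` (?N k -` {l}))))"
      proof (intro sum.cong refl)
        fix j
        have "(\<lambda>x. ?N k ((\<alpha> ^^ j) x)) -` {l} = (\<alpha> ^^ j) -` (?N k -` {l})" for l by auto
        then show "label_entropy ?M (\<lambda>x. ?N k ((\<alpha> ^^ j) x)) = (\<Sum>l\<in>range (?N k). xlogx (measure ?M ((\<alpha> ^^ j) -` (?N k -` {l}))))"
          by (subst label_entropy_superset[OF finN[of k]]) auto
      qed
      also have "\<dots> = (\<Sum>l\<in>range (?N k). \<Sum>j<n. xlogx (measure ?M ((\<alpha> ^^ j) -` (?N k -` {l}))))" by (rule sum.swap)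
      \<comment> \<open>Concavity: the mean of the entropies of the shifted measures is at most the
        entropy of the averaged measure, which is the quantity that converges to that of
        \<mu>.\<close>
      also have "\<dots> \<le> (\<Sum>l\<in>range (?N k). real n * xlogx (orbit_average \<alpha> \<eta> n (indicator (?N k -` {l}))))"
        unfolding orbit_average_indicator using n by (intro sum_mono xlogx_concave) auto
      also have "\<dots> = real n * (\<Sum>l\<in>range (?N k). xlogx (orbit_average \<alpha> \<eta> n (indicator (?N k -` {l}))))"
        by (simp add: sum_distrib_left)
      finally have 2: "real k * label_entropy ?M (?N n) \<le> real k * (real k * ln (real (card P))) +
         real n * (\<Sum>l\<in>range (?N k). xlogx (orbit_average \<alpha> \<eta> n (indicator (?N k -` {l}))))" by simp
      have "real k * (real n * (ln s - ?A)) \<le> real k * label_entropy ?M (?N n)" by (intro mult_left_mono 1) simp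
      with 2 have "real k * (real n * (ln s - ?A)) / real n \<le> (real k * (real k * ln (real (card P))) +
         real n * (\<Sum>l\<in>range (?N k). xlogx (orbit_average \<alpha> \<eta> n (indicator (?N k -` {l}))))) / real n"
        by (intro divide_right_mono) auto
      then show "real k * (ln s - ?A) \<le> real k * (real k * ln (real (card P))) / real n +
         (\<Sum>l\<in>range (?N k). xlogx (orbit_average \<alpha> \<eta> n (indicator (?N k -` {l}))))"
        using n by (simp add: add_divide_distrib)
    qed
  qed
  let ?h = "partition_entropy_rate \<mu> \<alpha> P"
  \<comment> \<open>Dividing \<open>key\<close> by k and letting k grow produces the entropy rate;
    it is moved to the left to give a lower bound uniform in \<epsilon>.\<close>
  have "ln s - ?h \<le> (\<integral>x. ln (max (w x) \<epsilon>) \<partial>\<mu>)" if "\<epsilon> > 0" for \<epsilon>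
  proof -
    have "ln s - (\<integral>x. ln (max (w x) \<epsilon>) \<partial>\<mu>) \<le> ?h"
    proof (rule LIMSEQ_le_const[OF partition_entropy_rate_tendsto[OF m cont P(1)]], intro exI allI impI)
      fix k :: nat assume k: "1 \<le> k"
      then show "ln s - (\<integral>x. ln (max (w x) \<epsilon>) \<partial>\<mu>) \<le> label_entropy \<mu> (?N k) / real k"
        using key[OF k that] by (simp add: le_divide_eq mult.commute)
    qed
    then show ?thesis by simp
  qed
  then have "ereal (ln s - ?h) \<le> ln_integral \<mu> w"
    by (intro ln_integral_ge_regularized[OF compact_space m w(1)])
  moreover have "ereal ?h \<le> KS_entropy \<mu> \<alpha>"
    unfolding KS_entropy_def using P(1) by (rule SUP_upper)
  ultimately have "ereal (ln s - ?h) + ereal ?h \<le> ln_integral \<mu> w + KS_entropy \<mu> \<alpha>" by (rule add_mono)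
  then show ?thesis using m by (intro bexI[of _ \<mu>]) auto
qed

end

theorem theorem26:
  fixes \<alpha> :: "'a::metric_space \<Rightarrow> 'a"
    and A :: "('a \<Rightarrow>\<^sub>C real) \<Rightarrow> ('a \<Rightarrow>\<^sub>C real)"
    and g \<rho> :: "'a \<Rightarrow>\<^sub>C real"
  assumes "compact (UNIV :: 'a set)"
    and "continuous_on UNIV \<alpha>"
    and "non_contracting_on (essential_points \<alpha>) \<alpha>"
    and "local_homeomorphism_on (essential_points \<alpha>) (essential_points \<alpha>) \<alpha>"
    and "transfer_operator \<alpha> A"
    and "compatible_on (essential_points \<alpha>) A"
    and "\<And>x. g x \<ge> 0"
    and "\<And>y. y \<in> essential_points \<alpha> \<Longrightarrow> \<rho> y = cocycle \<alpha> A y"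
    and "\<And>x. \<rho> x \<ge> 0"
  shows "spectral_exponent A g = ln_pressure \<alpha> (\<lambda>x. g x * \<rho> x)"
proof -
  interpret S: non_contracting_system \<alpha> by unfold_locales (rule assms)+
  obtain \<psi> :: "'a \<Rightarrow> real" where \<psi>: "continuous_on UNIV \<psi>" "\<And>x. 0 \<le> \<psi> x" "\<And>x. \<psi> x \<le> 1"
    "\<And>x. \<psi> x > 0 \<longleftrightarrow> x \<in> - essential_points \<alpha>"
    by (rule exists_positive_exactly_on_open[OF open_Compl[OF closed_essential_points[of \<alpha>]]]) (rule that)
  interpret W: weighted_transfer \<alpha> A g \<psi>
    by unfold_locales (use assms(1,2,5,7) \<psi> S.finite_fiber in auto)
  let ?w = "\<lambda>x. g x * \<rho> x" and ?K = "essential_points \<alpha>" and ?r = "W.Bg.radius"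
  have w: "continuous_on UNIV ?w" "\<And>x. 0 \<le> ?w x" using assms(7,9) by (auto intro!: continuous_intros)
  \<comment> \<open>Orbits starting in K stay in K, so the chosen extension of the cocycle is
    evaluated only where it agrees with the cocycle.\<close>
  have Zw: "preimage_sum ?K \<alpha> ?w n x = preimage_sum ?K \<alpha> W.w n x" for n x
    unfolding preimage_sum_def
  proof (intro sum.cong prod.cong refl)
    fix y i assume "y \<in> {y. y \<in> ?K \<and> (\<alpha> ^^ n) y = x}"
    then have "(\<alpha> ^^ i) y \<in> ?K" by (intro funpow_in[of ?K \<alpha>, OF S.K_forward]) auto
    then show "g ((\<alpha> ^^ i) y) * \<rho> ((\<alpha> ^^ i) y) = W.w ((\<alpha> ^^ i) y)" using assms(8) by (simp add: W.w_def)
  qed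
  have lhs: "spectral_exponent A g = ln_ereal ?r"
    unfolding spectral_exponent_def W.Bg.operator_spectral_radius_eq ..
  have upper: "ln_integral \<mu> ?w + KS_entropy \<mu> \<alpha> \<le> ereal (ln q)"
    if \<mu>: "\<mu> \<in> invariant_measures \<alpha>" and q: "?r < q" for \<mu> q
  proof -
    \<comment> \<open>An intermediate rate, so that the constant C is beaten by (q/q1)^m for a
      single large m; that m gives the strict gap demanded by \<open>pressure_le\<close>.\<close>
    define q1 where "q1 = (?r + q) / 2"
    have q1: "?r < q1" "q1 < q" "0 < q1" "0 < q" using q W.Bg.radius_nonneg by (auto simp: q1_def)
    obtain C where C: "C > 0" "\<And>n. W.Bg.growth n \<le> C * q1 ^ n"
      by (rule W.Bg.growth_le_power[OF q1(1)]) (rule that)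
    have "(\<lambda>n. C * (q1 / q) ^ n) \<longlonglongrightarrow> C * 0"
      using q1 by (intro tendsto_mult tendsto_const LIMSEQ_power_zero) auto
    then have "eventually (\<lambda>n. C * (q1 / q) ^ n < 1) sequentially"
      by (rule order_tendstoD(2)) simp
    then have "eventually (\<lambda>n. C * (q1 / q) ^ n < 1 \<and> n \<ge> 1) sequentially"
      using eventually_ge_at_top by (rule eventually_conj)
    then obtain m where m: "C * (q1 / q) ^ m < 1" "m \<ge> 1"
      using eventually_happens'[OF sequentially_bot] by blast
    have "C * q1 ^ m < q ^ m" using m(1) q1(4) by (simp add: power_divide divide_less_eq)
    then have "W.Bg.growth m < q ^ m" using C(2)[of m] by linarith
    then show ?thesis
      using W.preimage_sum_le_growth[of m] by (intro S.pressure_le[OF w m(2) q1(4) _ _ \<mu>]) (auto simp: Zw)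
  qed
  \<comment> \<open>If Z_n stayed below s^n everywhere for even one n, the Dini step would bound the
    spectral radius by s. So s^n is reached for every n, as \<open>pressure_ge\<close>
    requires.\<close>
  have lower: "ereal (ln s) \<le> ln_pressure \<alpha> ?w" if s: "0 < s" "s < ?r" for s
  proof -
    have "\<exists>x. s ^ n \<le> preimage_sum ?K \<alpha> ?w n x" if n: "n \<ge> 1" for n
    proof (rule ccontr)
      assume "\<not> ?thesis"
      then have "\<And>x. preimage_sum ?K \<alpha> W.w n x < s ^ n" by (auto simp: Zw not_le)
      from W.radius_le_preimage_sum[OF n this] have "?r \<le> root n (s ^ n)" .
      then show False using s n by (simp add: real_root_power_cancel)
    qed
    from S.pressure_ge[OF w s(1) this] obtain \<mu> where "\<mu> \<in> invariant_measures \<alpha>"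
      "ereal (ln s) \<le> ln_integral \<mu> ?w + KS_entropy \<mu> \<alpha>" by blast
    then show ?thesis unfolding ln_pressure_def by (rule SUP_upper2)
  qed
  show ?thesis
    unfolding lhs
  proof (rule antisym)
    show "ln_ereal ?r \<le> ln_pressure \<alpha> ?w"
    proof (cases "?r > 0")
      case True
      have "((\<lambda>s. ereal (ln s)) \<longlongrightarrow> ereal (ln ?r)) (at_left ?r)"
        using True by (intro tendsto_ereal tendsto_intros) auto
      moreover have "eventually (\<lambda>s. ereal (ln s) \<le> ln_pressure \<alpha> ?w) (at_left ?r)"
        using True by (intro eventually_at_leftI[of 0 ?r]) (auto intro: lower)
      ultimately have "ereal (ln ?r) \<le> ln_pressure \<alpha> ?w"
        by (rule tendsto_upperbound) (rule trivial_limit_at_left_real)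
      then show ?thesis using True by (simp add: ln_ereal_def)
    qed (simp add: ln_ereal_def)
    show "ln_pressure \<alpha> ?w \<le> ln_ereal ?r"
      unfolding ln_pressure_def
    proof (rule SUP_least)
      fix \<mu> assume \<mu>: "\<mu> \<in> invariant_measures \<alpha>"
      show "ln_integral \<mu> ?w + KS_entropy \<mu> \<alpha> \<le> ln_ereal ?r"
      proof (cases "?r > 0")
        case True
        have "((\<lambda>q. ereal (ln q)) \<longlongrightarrow> ereal (ln ?r)) (at_right ?r)"
          using True by (intro tendsto_ereal tendsto_intros) auto
        moreover have "eventually (\<lambda>q. ln_integral \<mu> ?w + KS_entropy \<mu> \<alpha> \<le> ereal (ln q)) (at_right ?r)"
          using upper[OF \<mu>] by (intro eventually_at_rightI[of ?r "?r + 1"]) auto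
        ultimately have "ln_integral \<mu> ?w + KS_entropy \<mu> \<alpha> \<le> ereal (ln ?r)"
          by (rule tendsto_lowerbound) (rule trivial_limit_at_right_real)
        then show ?thesis using True by (simp add: ln_ereal_def)
      next
        case False
        then have r0: "?r = 0" using W.Bg.radius_nonneg by simp
        \<comment> \<open>With spectral radius 0 every positive rate exp t is admissible, so the sum
          lies below every real number.\<close>
        have "ln_integral \<mu> ?w + KS_entropy \<mu> \<alpha> \<le> ereal t" for t
          using upper[OF \<mu>, of "exp t"] by (simp add: r0)
        then have bot: "ln_integral \<mu> ?w + KS_entropy \<mu> \<alpha> = -\<infinity>" by (rule ereal_bot)
        show ?thesis unfolding bot by simp
      qed
    qed
  qed
qed

end
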